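(* With $Q:=q^{13}$, the following hold: $$(2,1,44)-(8,1,11)=2q^2E(q^9)E(Q^3),$$ $$(5,3,18)-(8,1,11)=2q^5E(q^3)E(Q^9),$$ $$(4,1,22)-(10,7,10)=2q^4E(q^9)E(Q^3)U(3,13,q^3)^2,$$ $$(1,1,88)-(9,3,10)=2qE(q^3)E(Q^9)U(1,39,q^3)^2,$$ $$\frac{(4,1,22)-(10,7,10)}{(1,1,88)-(9,3,10)}=\frac{(5,3,18)-(8,1,11)}{(2,1,44)-(8,1,11)}=q^3\frac{E(q^3)E(Q^9)}{E(q^9)E(Q^3)}.$$
   Context: Let $|q|<1$, $(a;q)_\infty=\prod_{k\ge0}(1-aq^k)$, $(a;q)_n=\prod_{k=0}^{n-1}(1-aq^k)$. $G(q)=\sum_{n\ge0}\frac{q^{n^2}}{(q;q)_n}$, $H(q)=\sum_{n\ge0}\frac{q^{n(n+1)}}{(q;q)_n}$. For positive integers $r,s$, $U(r,s,q)=G(q^r)G(q^s)+q^{(s+r)/5}H(q^r)H(q^s)$ if $s+r\equiv0\pmod5$ and $U(r,s,q)=H(q^r)G(q^s)-q^{(s-r)/5}G(q^r)H(q^s)$ if $s-r\equiv0\pmod5$; $U(r,s,x)$ denotes this expression with $q$ replaced by $x$. $E(q)=(q;q)_\infty$. For integers $a,b,c$ with $a,c>0$, $b^2-4ac<0$, $(a,b,c)$ denotes $\sum_{n,m=-\infty}^{\infty}q^{an^2+bnm+cm^2}$. *)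

theory Defs
  imports "HOL-Analysis.Analysis"
begin

definition qpoch :: "complex \<Rightarrow> complex \<Rightarrow> nat \<Rightarrow> complex" where
  "qpoch a q n = (\<Prod>k<n. 1 - a * q ^ k)"

definition qpoch_inf :: "complex \<Rightarrow> complex \<Rightarrow> complex" where
  "qpoch_inf a q = (\<Prod>k. 1 - a * q ^ k)"

definition E :: "complex \<Rightarrow> complex" where
  "E q = qpoch_inf q q"

definition G :: "complex \<Rightarrow> complex" where
  "G q = (\<Sum>n. q ^ (n\<^sup>2) / qpoch q q n)"

definition H :: "complex \<Rightarrow> complex" where
  "H q = (\<Sum>n. q ^ (n * (n + 1)) / qpoch q q n)"

text \<open>
  The two congruence conditions overlap only when 5 divides both r and s, in which case the
  first clause is used; when neither holds the value 0 is a dummy. In the second clause the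
  exponent may be negative, hence the integer power.
\<close>

definition U :: "nat \<Rightarrow> nat \<Rightarrow> complex \<Rightarrow> complex" where
  "U r s x =
    (if (int s + int r) mod 5 = 0 then
       G (x ^ r) * G (x ^ s) + x powi ((int s + int r) div 5) * H (x ^ r) * H (x ^ s)
     else if (int s - int r) mod 5 = 0 then
       H (x ^ r) * G (x ^ s) - x powi ((int s - int r) div 5) * G (x ^ r) * H (x ^ s)
     else 0)"

text \<open>
  The theta series (a,b,c) of a positive definite form, for which all exponents are nonnegative.
\<close>

definition qform :: "int \<Rightarrow> int \<Rightarrow> int \<Rightarrow> complex \<Rightarrow> complex" where
  "qform a b c q = (\<Sum>\<^sub>\<infinity>(n, m)\<in>UNIV. q powi (a * n\<^sup>2 + b * n * m + c * m\<^sup>2))"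

end

theory Submission
  imports Defs "HOL-Complex_Analysis.Complex_Analysis" "HOL-Library.Nat_Bijection"
begin

text \<open>
  Put \<open>x = q\<^sup>3\<close>, \<open>P(x) = E(x) E(x\<^sup>3\<^sup>9)\<close>, \<open>R(x) = E(x\<^sup>3) E(x\<^sup>1\<^sup>3)\<close>.
  All forms involved have discriminant \<open>-351 = -39 \<cdot> 3\<^sup>2\<close>; completing the square turns their theta
  series into sums over \<open>u\<^sup>2 + 39 v\<^sup>2\<close> or \<open>3 u\<^sup>2 + 13 v\<^sup>2\<close> restricted to congruence classes
  modulo 12, so that linear relations between them are identities between weights on residue
  classes, averaged over the signs of \<open>u\<close> and \<open>v\<close>. With the Jacobi triple product this
  gives the first two identities and expresses
  \<open>T4 = ((1,1,88) - (9,3,10)) / 2q\<close> and \<open>T3 = ((4,1,22) - (10,7,10)) / 2q\<^sup>4\<close> through eta quotients,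
  from which \<open>P T4 = R T3\<close> is immediate.

  By the Rogers-Ramanujan identities, \<open>P(x) U(1,39,x)\<close> and \<open>R(x) U(3,13,x)\<close> are both equal to
  \<open>W = ((1,1,10) - (3,3,4)) / 2x\<close>, and it remains to show \<open>P T4 = W\<^sup>2\<close>.
  Comparing the arguments \<open>x\<close> and \<open>x\<^sup>2\<close> yields for \<open>s = x P(x) / R(x)\<close>, \<open>t = s(x\<^sup>2)\<close> the
  modular equation \<open>s\<^sup>3 + t\<^sup>3 + 2 s t (s + t) = s\<^sup>2 t\<^sup>2 + s t\<close>, and this
  implies that \<open>Y = P T4 / W\<^sup>2\<close> satisfies
  \<open>Y(x) Y(x\<^sup>2) = 1\<close>. Hence \<open>Y(x) = Y(x\<^sup>4) = \<dots> = Y(0) = 1\<close> for small \<open>x\<close>, and then for all \<open>x\<close>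
  by analytic continuation.
\<close>

subsection \<open>Infinite \<open>q\<close>-products\<close>

text \<open>The claim P T4 = W^2 is not a relation between s and t alone: written through R(x),
  R(x^2), s and t, both Y(x) and 1/Y(x^2) carry the factor x^2 (R(x^2)/R(x))^3, which the modular
  equation does not control. It cancels only in the product Y(x) Y(x^2), and this is why a
  functional equation takes the place of a direct proof of Y = 1.

  T4(x) contains s(x), s(x^2) and s(x^4). The modular equation is symmetric, so s(x) and s(x^4) are
  two roots of one cubic over s(x^2), and Vieta's formulas remove s(x^4). This needs s(x) and s(x^4)
  to be distinct, which is established only near 0; hence the analytic continuation. For that, only
  \<open>E\<close> has to be holomorphic, because W(x^2) is an eta expression.

  The modular equation itself arises because T4(x^2) and T3(x^2) have a second expression, through P
  and R at x and x^2 only. Inserted into P T4 = R T3 at x^2, it leaves an equation in s and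
  t.\<close>

lemma convergent_prod_qpoch:
  assumes "norm q < 1"
  shows "convergent_prod (\<lambda>k. 1 - a * q ^ k :: complex)"
proof -
  have "summable (\<lambda>k. norm (- a * q ^ k))"
    using assms by (auto simp: norm_mult norm_power intro!: summable_mult summable_geometric)
  then have "abs_convergent_prod (\<lambda>k. 1 + (- a * q ^ k))"
    by (intro summable_imp_abs_convergent_prod) auto
  then show ?thesis
    using abs_convergent_prod_imp_convergent_prod by force
qed

lemma qpoch_tendsto:
  assumes "norm q < 1"
  shows "qpoch a q \<longlonglongrightarrow> qpoch_inf a q"
  using convergent_prod_LIMSEQ[OF convergent_prod_qpoch[OF assms, of a]]
  unfolding qpoch_def qpoch_inf_def LIMSEQ_lessThan_iff_atMost .

lemma qpoch_inf_nonzero: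
  assumes "norm q < 1" "\<And>k. a * q ^ k \<noteq> 1"
  shows "qpoch_inf a q \<noteq> 0"
  unfolding qpoch_inf_def
  by (rule prodinf_nonzero[OF convergent_prod_qpoch]) (use assms in auto)

lemma qpoch_0 [simp]: "qpoch a q 0 = 1"
  by (simp add: qpoch_def)

lemma qpoch_Suc: "qpoch a q (Suc n) = qpoch a q n * (1 - a * q ^ n)"
  by (simp add: qpoch_def)

lemma power_Suc_neq_1:
  assumes "norm (q :: complex) < 1"
  shows "q * q ^ k \<noteq> 1"
proof
  assume "q * q ^ k = 1"
  then have "norm q * norm q ^ k = 1"
    by (metis norm_mult norm_one norm_power)
  moreover have "norm q ^ k \<le> 1"
    using assms by (simp add: power_le_one)
  ultimately show False
    using assms by (smt (verit) mult_left_le norm_ge_zero)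
qed

lemma qpoch_nonzero: "norm q < 1 \<Longrightarrow> qpoch q q n \<noteq> 0"
  using power_Suc_neq_1[of q] by (auto simp: qpoch_def)

lemma E_nonzero: "norm q < 1 \<Longrightarrow> E q \<noteq> 0"
  unfolding E_def using power_Suc_neq_1 by (intro qpoch_inf_nonzero) auto

lemma qpoch_Bseq:
  assumes "norm q < 1"
  obtains C where "C > 0" "\<And>n. norm (qpoch a q n) \<le> C"
  using convergent_imp_Bseq[OF convergentI[OF qpoch_tendsto[OF assms, of a]]]
  by (auto simp: Bseq_def)

lemma inverse_qpoch_Bseq:
  assumes "norm q < 1"
  obtains C where "C > 0" "\<And>n. norm (inverse (qpoch q q n)) \<le> C"
proof -
  have "(\<lambda>n. inverse (qpoch q q n)) \<longlonglongrightarrow> inverse (E q)"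
    unfolding E_def
    by (rule tendsto_inverse[OF qpoch_tendsto]) (use assms E_nonzero in \<open>auto simp: E_def\<close>)
  from convergent_imp_Bseq[OF convergentI[OF this]] that show ?thesis
    by (auto simp: Bseq_def)
qed

lemma norm_power_less_1: "norm (q :: complex) < 1 \<Longrightarrow> n > 0 \<Longrightarrow> norm (q ^ n) < 1"
  by (simp add: norm_power power_less_one_iff)

lemma qpoch_even: "qpoch a q (2 * n) = qpoch a (q\<^sup>2) n * qpoch (a * q) (q\<^sup>2) n"
  by (induction n) (auto simp: qpoch_Suc algebra_simps power_mult power2_eq_square
    power_mult_distrib)

lemma qpoch_inf_split2:
  assumes "norm q < 1"
  shows "qpoch_inf a q = qpoch_inf a (q\<^sup>2) * qpoch_inf (a * q) (q\<^sup>2)"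
proof (rule LIMSEQ_unique)
  have q2: "norm (q\<^sup>2) < 1"
    using assms norm_power_less_1 by simp
  show "(\<lambda>n. qpoch a q (2 * n)) \<longlonglongrightarrow> qpoch_inf a q"
    using LIMSEQ_subseq_LIMSEQ[OF qpoch_tendsto[OF assms], of "\<lambda>n. 2 * n"]
    by (auto simp: strict_mono_def o_def)
  show "(\<lambda>n. qpoch a q (2 * n)) \<longlonglongrightarrow> qpoch_inf a (q\<^sup>2) * qpoch_inf (a * q) (q\<^sup>2)"
    unfolding qpoch_even by (intro tendsto_mult qpoch_tendsto q2)
qed

lemma qpoch_triple:
  "qpoch a q (3 * n) = qpoch a (q ^ 3) n * qpoch (a * q) (q ^ 3) n * qpoch (a * q\<^sup>2) (q ^ 3) n"
proof (induction n)
  case (Suc n)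
  have "3 * Suc n = Suc (Suc (Suc (3 * n)))" by simp
  then show ?case
    by (simp only: qpoch_Suc Suc.IH power_mult power_Suc) (simp add: mult_ac power2_eq_square)
qed simp

lemma qpoch_inf_split3:
  assumes "norm q < 1"
  shows "qpoch_inf a q = qpoch_inf a (q ^ 3) * qpoch_inf (a * q) (q ^ 3) * qpoch_inf (a * q\<^sup>2)
    (q ^ 3)"
proof (rule LIMSEQ_unique)
  have q3: "norm (q ^ 3) < 1"
    using assms norm_power_less_1 by simp
  show "(\<lambda>n. qpoch a q (3 * n)) \<longlonglongrightarrow> qpoch_inf a q"
    using LIMSEQ_subseq_LIMSEQ[OF qpoch_tendsto[OF assms], of "\<lambda>n. 3 * n"]
    by (auto simp: strict_mono_def o_def)
  show "(\<lambda>n. qpoch a q (3 * n)) \<longlonglongrightarrow>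
      qpoch_inf a (q ^ 3) * qpoch_inf (a * q) (q ^ 3) * qpoch_inf (a * q\<^sup>2) (q ^ 3)"
    unfolding qpoch_triple by (intro tendsto_mult qpoch_tendsto q3)
qed

lemma qpoch_inf_mult_uminus:
  assumes "norm q < 1"
  shows "qpoch_inf a q * qpoch_inf (- a) q = qpoch_inf (a\<^sup>2) (q\<^sup>2)"
proof (rule LIMSEQ_unique)
  have q2: "norm (q\<^sup>2) < 1"
    using assms norm_power_less_1 by simp
  show "(\<lambda>n. qpoch a q n * qpoch (- a) q n) \<longlonglongrightarrow> qpoch_inf a q * qpoch_inf (- a) q"
    by (intro tendsto_mult qpoch_tendsto assms)
  have "(\<lambda>n. qpoch a q n * qpoch (- a) q n) = qpoch (a\<^sup>2) (q\<^sup>2)"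
    by (auto simp: qpoch_def prod.distrib[symmetric] power2_eq_square algebra_simps
        power_mult_distrib)
  then show "(\<lambda>n. qpoch a q n * qpoch (- a) q n) \<longlonglongrightarrow> qpoch_inf (a\<^sup>2) (q\<^sup>2)"
    using qpoch_tendsto[OF q2] by simp
qed

lemma qpoch_inf_cubic:
  assumes "norm q < 1" "w\<^sup>2 + w + 1 = 0"
  shows "qpoch_inf a q * qpoch_inf (w * a) q * qpoch_inf (w\<^sup>2 * a) q = qpoch_inf (a ^ 3) (q ^ 3)"
proof (rule LIMSEQ_unique)
  have q3: "norm (q ^ 3) < 1"
    using assms norm_power_less_1 by simp
  have w: "(1 - t) * (1 - w * t) * (1 - w\<^sup>2 * t) = 1 - t ^ 3" for t
    using assms(2) by algebra
  show "(\<lambda>n. qpoch a q n * qpoch (w * a) q n * qpoch (w\<^sup>2 * a) q n) \<longlonglongrightarrow>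
      qpoch_inf a q * qpoch_inf (w * a) q * qpoch_inf (w\<^sup>2 * a) q"
    by (intro tendsto_mult qpoch_tendsto assms)
  have "(\<lambda>n. qpoch a q n * qpoch (w * a) q n * qpoch (w\<^sup>2 * a) q n) = qpoch (a ^ 3) (q ^ 3)"
    using w[of "a * q ^ _"]
    by (auto simp: qpoch_def prod.distrib[symmetric] mult.assoc power_mult_distrib
        power_mult[symmetric] mult.commute[of 3])
  then show "(\<lambda>n. qpoch a q n * qpoch (w * a) q n * qpoch (w\<^sup>2 * a) q n) \<longlonglongrightarrow>
      qpoch_inf (a ^ 3) (q ^ 3)"
    using qpoch_tendsto[OF q3] by simp
qed

lemma E_0 [simp]: "E 0 = 1"
proof -
  have "qpoch 0 0 \<longlonglongrightarrow> E 0"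
    unfolding E_def by (rule qpoch_tendsto) simp
  moreover have "qpoch 0 0 = (\<lambda>_. 1)"
    by (auto simp: qpoch_def)
  ultimately show ?thesis
    by (simp add: LIMSEQ_const_iff)
qed

text \<open>On a disc of radius r < 1 the n-th factor differs from 1 by at most r^n, so the partial
  products converge locally uniformly. This is used only for the analytic continuation at the
  end.\<close>

lemma E_holomorphic: "E holomorphic_on ball 0 1"
proof (rule holomorphic_uniform_sequence)
  fix z :: complex assume "z \<in> ball 0 1"
  then have z: "norm z < 1" by simp
  \<comment> \<open>Midway between |z| and 1, which leaves a disc of radius r - |z| about z.\<close>
  define r where "r = (1 + norm z) / 2"
  have r: "norm z < r" "r < 1" "0 \<le> r"
    using z by (auto simp: r_def field_simps add_nonneg_nonneg)
  have "uniformly_convergent_on (cball 0 r) (\<lambda>N (q::complex). \<Prod>n<N. 1 - q * q ^ n)"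
  proof (rule uniformly_convergent_on_prod')
    show "uniformly_convergent_on (cball 0 r) (\<lambda>N (q::complex). \<Sum>n<N. norm (1 - q * q ^ n - 1))"
    proof (rule Weierstrass_m_test'_ev)
      show "summable (\<lambda>n. r ^ n)"
        using r by (simp add: summable_geometric)
      show "\<forall>\<^sub>F n in sequentially. \<forall>q\<in>cball 0 r. norm (norm (1 - q * q ^ n - 1 :: complex)) \<le> r ^ n"
      proof (intro always_eventually allI ballI)
        fix n :: nat and q :: complex
        assume "q \<in> cball 0 r"
        then have q: "norm q \<le> r" by simp
        have "norm q * norm q ^ n \<le> 1 * r ^ n"
          by (intro mult_mono power_mono) (use q r in auto)
        then show "norm (norm (1 - q * q ^ n - 1)) \<le> r ^ n"
          by (simp add: norm_mult norm_power)
      qed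
    qed
  qed (auto intro!: continuous_intros)
  then obtain g where g: "uniform_limit (cball 0 r) (\<lambda>N q. qpoch q q N) g sequentially"
    by (auto simp: uniformly_convergent_on_def qpoch_def)
  have gE: "g q = E q" if "q \<in> cball 0 r" for q
    using tendsto_uniform_limitI[OF g that] qpoch_tendsto[of q q] r that
    unfolding E_def by (intro LIMSEQ_unique) auto
  have "uniform_limit (cball 0 r) (\<lambda>N q. qpoch q q N) E sequentially"
    using g unfolding uniform_limit_iff by (simp only: gE cong: ball_cong)
  moreover have "cball z (r - norm z) \<subseteq> cball 0 r"
    by (simp add: cball_subset_cball_iff)
  ultimately have "uniform_limit (cball z (r - norm z)) (\<lambda>N q. qpoch q q N) E sequentially"
    by (rule uniform_limit_on_subset)
  moreover have "cball z (r - norm z) \<subseteq> ball 0 1"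
    using r by (subst cball_subset_ball_iff) auto
  ultimately show "\<exists>d>0. cball z d \<subseteq> ball 0 1 \<and>
      uniform_limit (cball z d) (\<lambda>N q. qpoch q q N) E sequentially"
    using r by (intro exI[of _ "r - norm z"]) auto
qed (auto simp: qpoch_def intro!: holomorphic_intros)

subsection \<open>Sums over the integers\<close>

text \<open>Dominated convergence over the integers, which turns finite \<open>q\<close>-identities
  into infinite ones. Tannery's theorem speaks of series over the naturals, hence the passage
  through \<open>int_decode\<close>.\<close>

lemma infsum_tannery_int:
  fixes f :: "nat \<Rightarrow> int \<Rightarrow> complex"
  assumes lim: "\<And>j. (\<lambda>N. f N j) \<longlonglongrightarrow> g j"
    and bound: "\<And>N j. norm (f N j) \<le> M j"
    and M: "M summable_on UNIV"
  shows "(\<lambda>N. infsum (f N) UNIV) \<longlonglongrightarrow> infsum g UNIV"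
proof -
  have M': "summable (\<lambda>k. M (int_decode k))"
    using M summable_on_reindex_bij_betw[OF bij_int_decode, of M] summable_on_imp_summable by blast
  have gM: "norm (g j) \<le> M j" for j
    by (rule LIMSEQ_le_const2[OF tendsto_norm[OF lim[of j]]]) (use bound in auto)
  have suminf: "infsum h UNIV = (\<Sum>k. h (int_decode k))" if "\<And>j. norm (h j) \<le> M j"
    for h :: "int \<Rightarrow> complex"
  proof -
    have "h summable_on UNIV"
      by (rule abs_summable_summable, rule summable_on_comparison_test[OF M]) (use that in auto)
    then have "(\<lambda>k. h (int_decode k)) summable_on UNIV"
      using summable_on_reindex_bij_betw[OF bij_int_decode, of h] by simp
    then have "(\<lambda>k. h (int_decode k)) sums infsum (\<lambda>k. h (int_decode k)) UNIV"
      using has_sum_imp_sums has_sum_infsum by blast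
    then show ?thesis
      using infsum_reindex_bij_betw[OF bij_int_decode, of h] by (simp add: sums_iff)
  qed
  have "eventually (\<lambda>(k, n). norm (f n (int_decode k)) \<le> M (int_decode k))
    (at_top \<times>\<^sub>F sequentially)"
    using bound by (intro always_eventually) auto
  from tannerys_theorem[OF lim this M']
  have "(\<lambda>n. \<Sum>k. f n (int_decode k)) \<longlonglongrightarrow> (\<Sum>k. g (int_decode k))"
    by simp
  then show ?thesis
    using suminf[of "f _"] suminf[of g] bound gM by simp
qed

lemma abs_summable_on_int:
  fixes f :: "int \<Rightarrow> complex"
  assumes "summable (\<lambda>n. norm (f (int n)))" "summable (\<lambda>n. norm (f (- int n)))"
  shows "(\<lambda>j. norm (f j)) summable_on UNIV"
proof -
  have "(\<lambda>j. norm (f j)) summable_on {0..}"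
    using assms(1)
    by (subst summable_on_reindex_bij_witness[of _ int nat UNIV "\<lambda>n. norm (f (int n))"])
      (auto simp: summable_on_UNIV_nonneg_real_iff)
  moreover have "(\<lambda>j. norm (f j)) summable_on {..0}"
    using assms(2)
    by (subst summable_on_reindex_bij_witness[of _ "\<lambda>n. - int n" "\<lambda>j. nat (- j)" UNIV
          "\<lambda>n. norm (f (- int n))"])
      (auto simp: summable_on_UNIV_nonneg_real_iff)
  ultimately have "(\<lambda>j. norm (f j)) summable_on ({0..} \<union> {..0})"
    by (rule summable_on_union)
  also have "({0..} \<union> {..0}) = (UNIV :: int set)" by auto
  finally show ?thesis .
qed

text \<open>Ratio test on each half of the integers: the ratio of consecutive terms is a constant
  times |q|^n, so the quadratic exponent beats any nonzero z.\<close>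

lemma abs_summable_gauss:
  fixes q z :: complex
  assumes q: "norm q < 1" "q \<noteq> 0" and z: "z \<noteq> 0"
  shows "(\<lambda>j. norm (z powi j * q powi (j * (j - 1) div 2))) summable_on UNIV"
proof -
  have div2: "(2 * a + b) div 2 = a + b div 2" for a b :: int
    by simp
  have tri: "(int n + 1) * int n div 2 = int n + int n * (int n - 1) div 2" for n
  proof -
    have "(int n + 1) * int n = 2 * int n + int n * (int n - 1)" by (simp add: algebra_simps)
    then show ?thesis by (simp only: div2)
  qed
  have tri': "(- int n - 1) * (- int n - 2) div 2 = int n + 1 + (- int n) * (- int n - 1) div 2"
    for n
  proof -
    have "(- int n - 1) * (- int n - 2) = 2 * (int n + 1) + (- int n) * (- int n - 1)"
      by (simp add: algebra_simps)
    then show ?thesis by (simp only: div2)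
  qed
  have small: "\<exists>N. \<forall>n\<ge>N. c * norm q ^ n \<le> 1 / 2" for c :: real
  proof -
    have "(\<lambda>n. c * norm q ^ n) \<longlonglongrightarrow> c * 0"
      by (intro tendsto_mult tendsto_const LIMSEQ_power_zero) (use q in auto)
    then have "eventually (\<lambda>n. c * norm q ^ n < 1 / 2) sequentially"
      by (rule order_tendstoD) auto
    then show ?thesis
      by (auto simp: eventually_sequentially intro: less_imp_le)
  qed
  show ?thesis
  proof (rule abs_summable_on_int)
    obtain N where N: "\<And>n. n \<ge> N \<Longrightarrow> norm z * norm q ^ n \<le> 1 / 2"
      using small by blast
    let ?f = "\<lambda>n. norm (z powi int n * q powi (int n * (int n - 1) div 2))"
    show "summable ?f"
    proof (rule summable_ratio_test[of "1/2" N])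
      fix n assume "n \<ge> N"
      have "?f (Suc n) = (norm z * norm q ^ n) * ?f n"
        using q z by (simp add: tri add.commute[of 1] power_int_add norm_mult norm_power_int
          norm_power)
      also have "\<dots> \<le> 1 / 2 * ?f n"
        by (intro mult_right_mono N \<open>n \<ge> N\<close>) auto
      finally show "norm (?f (Suc n)) \<le> 1 / 2 * norm (?f n)" by simp
    qed simp
    obtain N where N: "\<And>n. n \<ge> N \<Longrightarrow> (norm q / norm z) * norm q ^ n \<le> 1 / 2"
      using small by blast
    let ?g = "\<lambda>n. norm (z powi (- int n) * q powi ((- int n) * (- int n - 1) div 2))"
    show "summable ?g"
    proof (rule summable_ratio_test[of "1/2" N])
      fix n assume "n \<ge> N"
      have eq: "- int (Suc n) = - int n - 1" "- int n - 1 - 1 = - int n - 2" by auto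
      have "?g (Suc n) = ((norm q / norm z) * norm q ^ n) * ?g n"
        using q z unfolding eq tri'
        by (simp add: power_int_add power_int_diff norm_mult norm_power_int norm_power norm_divide)
      also have "\<dots> \<le> 1 / 2 * ?g n"
        by (intro mult_right_mono N \<open>n \<ge> N\<close>) auto
      finally show "norm (?g (Suc n)) \<le> 1 / 2 * norm (?g n)" by simp
    qed simp
  qed
qed

subsection \<open>Gaussian binomial coefficients\<close>

text \<open>The lower index is an integer and the value outside 0..n is 0. The Pascal rules then
  hold without side conditions, and all sums run over the whole of the integers, where shifts and
  reflections cost nothing.\<close>

definition qbin :: "complex \<Rightarrow> nat \<Rightarrow> int \<Rightarrow> complex" where
  "qbin q n k =
    (if 0 \<le> k \<and> k \<le> int n then qpoch q q n / (qpoch q q (nat k) * qpoch q q (nat (int n - k))) else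
      0)"

lemma qbin_eq_0: "k < 0 \<or> k > int n \<Longrightarrow> qbin q n k = 0"
  by (auto simp: qbin_def)

lemma qbin_sym: "qbin q n (int n - k) = qbin q n k"
  by (auto simp: qbin_def mult.commute)

text \<open>No range condition on k: at k = 0 the factor \<open>1 - q powi k\<close> vanishes, and
  elsewhere outside the range both coefficients do.\<close>

lemma qbin_absorb:
  assumes "norm q < 1"
  shows "(1 - q powi k) * qbin q (Suc n) k = (1 - q ^ Suc n) * qbin q n (k - 1)"
proof (cases "1 \<le> k \<and> k \<le> int n + 1")
  case True
  define m where "m = nat (k - 1)"
  have k: "k = int (Suc m)" and m: "m \<le> n" using True by (auto simp: m_def)
  have eq: "nat (int (Suc n) - int (Suc m)) = n - m" "nat (int n - int m) =
    n - m" "nat (int (Suc m)) = Suc m"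
    using m by auto
  have nz: "1 - q * q ^ m \<noteq> 0" using power_Suc_neq_1[OF assms, of m] by auto
  have "qbin q (Suc n) k = qpoch q q (Suc n) / (qpoch q q (Suc m) * qpoch q q (n - m))"
    using m unfolding k qbin_def eq by simp
  moreover have "qbin q n (k - 1) = qpoch q q n / (qpoch q q m * qpoch q q (n - m))"
    using m unfolding k qbin_def by (simp add: eq)
  moreover have "q powi k = q * q ^ m" unfolding k power_int_of_nat by simp
  ultimately show ?thesis
    using nz by (simp only: qpoch_Suc power_Suc) simp
next
  case False
  then consider "k < 0 \<or> k > int n + 1" | "k = 0" by linarith
  then show ?thesis by cases (auto simp: qbin_eq_0)
qed

lemma qbin_Suc:
  assumes q: "norm q < 1" "q \<noteq> 0"
  shows "qbin q (Suc n) k = qbin q n (k - 1) + q powi k * qbin q n k"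
proof (cases "0 \<le> k \<and> k \<le> int n")
  case True
  define m where "m = nat k"
  have k: "k = int m" and m: "m \<le> n" using True by (auto simp: m_def)
  have "(1 - q powi (int (Suc n) - k)) * qbin q (Suc n) (int (Suc n) - k) =
      (1 - q ^ Suc n) * qbin q n (int (Suc n) - k - 1)"
    by (rule qbin_absorb[OF q(1)])
  moreover have "int (Suc n) - k - 1 = int n - k" by simp
  ultimately have 1: "(1 - q powi (int (Suc n) - k)) * qbin q (Suc n) k =
    (1 - q ^ Suc n) * qbin q n k"
    by (simp only: qbin_sym)
  have "q powi k * q powi (int (Suc n) - k) = q powi int (Suc n)"
    using q by (subst power_int_add[symmetric]) auto
  then have 2: "q powi k * q powi (int (Suc n) - k) = q ^ Suc n"
    by (simp only: power_int_of_nat)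
  have nz: "1 - q ^ Suc n \<noteq> 0" using power_Suc_neq_1[OF q(1), of n] by auto
  \<comment> \<open>Absorption at k and at the mirrored index n + 1 - k, combined through 1 -
    q^(n+1) = (1 - q^k) + q^k (1 - q^(n+1-k)).\<close>
  have "(1 - q ^ Suc n) * (qbin q n (k - 1) + q powi k * qbin q n k) =
      (1 - q powi k) * qbin q (Suc n) k + q powi k * ((1 - q powi (int (Suc n) - k)) * qbin q
        (Suc n) k)"
    unfolding 1 qbin_absorb[OF q(1)] by (simp add: algebra_simps)
  also have "\<dots> = (1 - q powi k * q powi (int (Suc n) - k)) * qbin q (Suc n) k"
    by (simp add: algebra_simps)
  also have "\<dots> = (1 - q ^ Suc n) * qbin q (Suc n) k"
    unfolding 2 ..
  finally show ?thesis using nz mult_left_cancel by metis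
next
  case False
  \<comment> \<open>Outside 0..n the only index with a nonzero left-hand side is k = n + 1.\<close>
  show ?thesis
  proof (cases "k = int n + 1")
    case True
    have "nat (int n + 1) = Suc n" by simp
    then show ?thesis using qpoch_nonzero[OF q(1)] True
      by (simp add: qbin_def)
  next
    case False
    then show ?thesis using \<open>\<not> (0 \<le> k \<and> k \<le> int n)\<close>
      by (auto simp: qbin_eq_0)
  qed
qed

lemma qbin_Suc':
  assumes q: "norm q < 1" "q \<noteq> 0"
  shows "qbin q (Suc n) k = q powi (int n + 1 - k) * qbin q n (k - 1) + qbin q n k"
proof -
  have "qbin q (Suc n) k = qbin q (Suc n) (int (Suc n) - k)"
    by (rule qbin_sym[symmetric])
  also have "\<dots> = qbin q n (int n - k) + q powi (int n + 1 - k) * qbin q n (int n - (k - 1))"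
    using qbin_Suc[OF q, of n "int (Suc n) - k"] by (simp add: algebra_simps)
  finally show ?thesis by (simp only: qbin_sym) simp
qed

text \<open>The bound is uniform in both indices, as domination requires: (q;q)_n and its inverse
  both converge, so both are bounded.\<close>

lemma qbin_bound:
  assumes "norm q < 1"
  obtains C where "C > 0" "\<And>n k. norm (qbin q n k) \<le> C"
proof -
  obtain C where C: "C > 0" "\<And>n. norm (qpoch q q n) \<le> C"
    using qpoch_Bseq[OF assms] by blast
  obtain D where D: "D > 0" "\<And>n. norm (inverse (qpoch q q n)) \<le> D"
    using inverse_qpoch_Bseq[OF assms] by blast
  have "norm (qbin q n k) \<le> C * (D * D)" for n k
  proof (cases "0 \<le> k \<and> k \<le> int n")
    case True
    then have "qbin q n k =
      qpoch q q n * (inverse (qpoch q q (nat k)) * inverse (qpoch q q (nat (int n - k))))"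
      by (simp add: qbin_def field_simps)
    also have "norm \<dots> \<le> C * (D * D)"
      unfolding norm_mult using C D by (intro mult_mono) (auto intro: less_imp_le)
    finally show ?thesis .
  next
    case False
    then have "qbin q n k = 0" by (auto simp: qbin_def)
    then show ?thesis using C D by simp
  qed
  then show ?thesis using that[of "C * (D * D)"] C D by simp
qed

lemma qpoch_tendsto_E:
  assumes "norm q < 1" "filterlim g at_top sequentially"
  shows "(\<lambda>n. qpoch q q (g n)) \<longlonglongrightarrow> E q"
  unfolding E_def by (rule filterlim_compose[OF qpoch_tendsto[OF assms(1)] assms(2)])

text \<open>Both the lower index k and the complementary index f must tend to infinity; then (q;q)_h
  / ((q;q)_k (q;q)_f) tends to E/(E E). Since c may be negative, k is nonnegative only
  eventually.\<close>

lemma qbin_tendsto: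
  assumes q: "norm q < 1"
    and f: "filterlim f at_top sequentially" and g: "filterlim g at_top sequentially"
    and k: "\<And>n. k n = int (g n) + c" "\<And>n. int (h n) = int (f n) + k n"
  shows "(\<lambda>n. qbin q (h n) (k n)) \<longlonglongrightarrow> 1 / E q"
proof -
  have kk: "filterlim (\<lambda>n. nat (k n)) at_top sequentially"
    unfolding filterlim_at_top
  proof
    fix Z :: nat
    have "eventually (\<lambda>n. Z + nat \<bar>c\<bar> \<le> g n) sequentially"
      using g unfolding filterlim_at_top by blast
    then show "eventually (\<lambda>n. Z \<le> nat (k n)) sequentially"
      by eventually_elim (use k in auto)
  qed
  have ev: "eventually (\<lambda>n. 0 \<le> k n) sequentially"
  proof -
    have "eventually (\<lambda>n. nat \<bar>c\<bar> \<le> g n) sequentially"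
      using g unfolding filterlim_at_top by blast
    then show ?thesis by eventually_elim (use k in auto)
  qed
  have hh: "filterlim h at_top sequentially"
    unfolding filterlim_at_top
  proof
    fix Z :: nat
    have "eventually (\<lambda>n. Z \<le> f n) sequentially"
      using f unfolding filterlim_at_top by blast
    with ev show "eventually (\<lambda>n. Z \<le> h n) sequentially"
    proof eventually_elim
      case (elim n)
      then show ?case using k(2)[of n] by linarith
    qed
  qed
  have "(\<lambda>n. qpoch q q (h n) / (qpoch q q (nat (k n)) * qpoch q q (f n))) \<longlonglongrightarrow> E q / (E q * E q)"
    using E_nonzero[OF q] by (intro tendsto_divide tendsto_mult qpoch_tendsto_E q f kk hh) auto
  also have "E q / (E q * E q) = 1 / E q"
    using E_nonzero[OF q] by simp
  finally have *: "(\<lambda>n. qpoch q q (h n) / (qpoch q q (nat (k n)) * qpoch q q (f n))) \<longlonglongrightarrow> 1 / E q" .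
  show ?thesis
  proof (rule Lim_transform_eventually[OF *])
    show "\<forall>\<^sub>F n in sequentially. qpoch q q (h n) / (qpoch q q (nat (k n)) * qpoch q q (f n)) =
      qbin q (h n) (k n)"
      using ev by eventually_elim (use k in \<open>auto simp: qbin_def\<close>)
  qed
qed

lemma infsum_shift_int: "(\<Sum>\<^sub>\<infinity>j. f (j + c :: int)) = (infsum f UNIV :: complex)"
  by (rule infsum_reindex_bij_witness[of _ "\<lambda>j. j - c" "\<lambda>j. j + c"]) auto

lemma infsum_reflect_int: "(\<Sum>\<^sub>\<infinity>j. f (c - j :: int)) = (infsum f UNIV :: complex)"
  by (rule infsum_reindex_bij_witness[of _ "\<lambda>j. c - j" "\<lambda>j. c - j"]) auto

lemma qbin_summable:
  fixes m c :: int
  assumes "m \<noteq> 0"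
  shows "(\<lambda>j. f j * qbin q n (m * j + c)) summable_on UNIV"
proof (rule finite_nonzero_values_imp_summable_on)
  have "{j \<in> UNIV. f j * qbin q n (m * j + c) \<noteq> 0} \<subseteq> (\<lambda>j. m * j + c) -` {0..int n}"
    by (auto simp: qbin_def split: if_splits)
  moreover have "finite ((\<lambda>j. m * j + c) -` {0..int n})"
    using assms by (intro finite_vimageI) (auto simp: inj_def)
  ultimately show "finite {j \<in> UNIV. f j * qbin q n (m * j + c) \<noteq> 0}"
    by (rule finite_subset)
qed

subsection \<open>The Jacobi triple product\<close>

lemma div2_add: "(2 * a + b) div 2 = a + b div (2 :: int)"
  by simp

text \<open>Induction by the second Pascal rule: in the term with q^(n+1-k), shifting k by one
  extracts exactly -z q^n, the new part of the factor 1 - z q^n.\<close>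

lemma q_binomial_theorem:
  assumes q: "norm q < 1" "q \<noteq> 0" and z: "z \<noteq> 0"
  shows "(\<Sum>\<^sub>\<infinity>k. (-1) powi k * z powi k * q powi (k * (k - 1) div 2) * qbin q n k) = qpoch z q n"
proof (induction n)
  case 0
  have "(\<Sum>\<^sub>\<infinity>k. (-1) powi k * z powi k * q powi (k * (k - 1) div 2) * qbin q 0 k) =
      (\<Sum>\<^sub>\<infinity>k\<in>{0}. (-1) powi k * z powi k * q powi (k * (k - 1) div 2) * qbin q 0 k)"
    by (rule infsum_cong_neutral) (auto simp: qbin_def)
  then show ?case
    by (simp add: qbin_def)
next
  case (Suc n)
  let ?c = "\<lambda>k. (-1) powi k * z powi k * q powi (k * (k - 1) div 2)"
  have summ: "(\<lambda>k. f k * qbin q n k) summable_on UNIV" "(\<lambda>k. f k * qbin q n (k - 1)) summable_on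
    UNIV" for f
    using qbin_summable[of 1 f q n 0] qbin_summable[of 1 f q n "-1"] by simp_all
  have shift: "?c (k + 1) * q powi (int n + 1 - (k + 1)) = - z * q ^ n * ?c k" for k
  proof -
    have "(k + 1) * (k + 1 - 1) = 2 * k + k * (k - 1)" by (simp add: algebra_simps)
    then have "(k + 1) * (k + 1 - 1) div 2 = k + k * (k - 1) div 2" by (simp only: div2_add)
    then show ?thesis
      using q z by (simp add: power_int_add power_int_diff)
  qed
  have "(\<Sum>\<^sub>\<infinity>k. ?c k * qbin q (Suc n) k) =
      (\<Sum>\<^sub>\<infinity>k. ?c k * q powi (int n + 1 - k) * qbin q n (k - 1) + ?c k * qbin q n k)"
    by (simp add: qbin_Suc'[OF q] algebra_simps)
  also have "\<dots> = (\<Sum>\<^sub>\<infinity>k. ?c k * q powi (int n + 1 - k) * qbin q n (k - 1)) +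
      (\<Sum>\<^sub>\<infinity>k. ?c k * qbin q n k)"
    by (intro infsum_add summ)
  also have "(\<Sum>\<^sub>\<infinity>k. ?c k * q powi (int n + 1 - k) * qbin q n (k - 1)) =
      (\<Sum>\<^sub>\<infinity>k. ?c (k + 1) * q powi (int n + 1 - (k + 1)) * qbin q n (k + 1 - 1))"
    by (rule infsum_shift_int[symmetric])
  also have "\<dots> = (\<Sum>\<^sub>\<infinity>k. - z * q ^ n * (?c k * qbin q n k))"
    unfolding shift by (simp add: mult_ac)
  also have "\<dots> = - z * q ^ n * qpoch z q n"
    by (subst infsum_cmult_right') (simp add: Suc.IH)
  finally show ?case
    unfolding Suc.IH qpoch_Suc by (simp add: right_diff_distrib mult_ac)
qed

lemma qpoch_add: "qpoch a q (m + n) = qpoch a q m * qpoch (a * q ^ m) q n"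
  by (induction n) (simp_all add: qpoch_Suc power_add mult_ac)

text \<open>Each factor is turned around by 1 - z q^(-i) = -z q^(-i) (1 - q^i / z); the prefactor
  collects the powers -z q^(-i) for i = 1, ..., N.\<close>

lemma qpoch_reflect:
  assumes q: "q \<noteq> 0" and z: "z \<noteq> 0"
  shows "qpoch (z * q powi (- int N)) q N =
    q powi (- (int N * (int N + 1) div 2)) * (-1) ^ N * z ^ N * qpoch (q / z) q N"
proof (induction N)
  case (Suc N)
  let ?e = "int N * (int N + 1) div 2"
  have "int (Suc N) * (int (Suc N) + 1) = 2 * int (Suc N) + int N * (int N + 1)"
    by (simp add: algebra_simps)
  then have e: "int (Suc N) * (int (Suc N) + 1) div 2 = int (Suc N) + ?e"
    by (simp only: div2_add)
  have w: "z * q powi (- int (Suc N)) * q ^ 1 = z * q powi (- int N)"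
    using q by (simp add: power_int_diff power_int_minus field_simps)
  have "qpoch (z * q powi (- int (Suc N))) q (1 + N) =
      (1 - z * q powi (- int (Suc N))) * qpoch (z * q powi (- int N)) q N"
    unfolding qpoch_add w by (simp add: qpoch_def)
  also have "1 - z * q powi (- int (Suc N)) = - z * q powi (- int (Suc N)) * (1 - q / z * q ^ N)"
    using q z unfolding power_int_minus power_int_of_nat by (simp add: field_simps)
  finally have "qpoch (z * q powi (- int (Suc N))) q (Suc N) =
      (q powi (- int (Suc N)) * q powi (- ?e)) * (-1) ^ Suc N * z ^ Suc N * qpoch (q / z) q (Suc N)"
    unfolding Suc.IH qpoch_Suc[of "q / z"] by (simp add: mult_ac)
  also have "q powi (- int (Suc N)) * q powi (- ?e) = q powi (- (int (Suc N) + ?e))"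
    unfolding minus_add_distrib by (rule power_int_add[symmetric]) (use q in simp)
  finally show ?case
    unfolding e .
qed simp

text \<open>The q-binomial theorem with upper index 2N at z q^(-N), recentred by k = N + j. The
  product splits in the middle: its upper half is (z;q)_N, its lower half is reflected into
  (q/z;q)_N, and the reflection constant K also comes out of the sum.\<close>

lemma finite_triple_product:
  assumes q: "norm q < 1" "q \<noteq> 0" and z: "z \<noteq> 0"
  shows "(\<Sum>\<^sub>\<infinity>j. (-1) powi j * z powi j * q powi (j * (j - 1) div 2) * qbin q (2 * N) (int N + j)) =
    qpoch z q N * qpoch (q / z) q N"
proof -
  let ?w = "z * q powi (- int N)"
  let ?K = "q powi (- (int N * (int N + 1) div 2)) * (-1) ^ N * z ^ N"
  have w: "?w \<noteq> 0" using q z by simp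
  have K: "?K \<noteq> 0" using q z by simp
  \<comment> \<open>Recentring the exponent k(k-1)/2 - N k at k = N + j leaves j(j-1)/2 and a
    constant, the exponent in K.\<close>
  have tri: "(int N + j) * (int N + j - 1) div 2 - int N * (int N + j) =
      j * (j - 1) div 2 - int N * (int N + 1) div 2" for j
  proof -
    have "even (j * (j - 1))" "even (int N * (int N + 1))" "even ((int N + j) * (int N + j - 1))"
      by auto
    then obtain a b c where abc: "j * (j - 1) = 2 * a" "int N * (int N + 1) = 2 * b"
      "(int N + j) * (int N + j - 1) = 2 * c" unfolding dvd_def by blast
    have "2 * c - 2 * (int N * (int N + j)) = 2 * a - 2 * b"
      unfolding abc[symmetric] by (simp add: algebra_simps)
    then show ?thesis unfolding abc by simp
  qed
  have term_eq: "(-1) powi (j + int N) * ?w powi (j + int N) * q powi ((j + int N) * (j + int N -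
    1) div 2) *
      qbin q (2 * N) (j + int N) =
      ?K * ((-1) powi j * z powi j * q powi (j * (j - 1) div 2) * qbin q (2 * N) (int N + j))" for j
  proof -
    have "?w powi (j + int N) = z powi (j + int N) * q powi (- (int N * (j + int N)))"
      by (simp add: power_int_mult_distrib power_int_mult[symmetric])
    then have "?w powi (j + int N) * q powi ((j + int N) * (j + int N - 1) div 2) =
        z powi (j + int N) * q powi ((int N + j) * (int N + j - 1) div 2 - int N * (int N + j))"
      using q by (simp add: power_int_add[symmetric] add.commute)
    also have "\<dots> = z powi j * z ^ N * (q powi (j * (j - 1) div 2) * q powi
      (- (int N * (int N + 1) div 2)))"
      unfolding tri using q z by (simp add: power_int_add power_int_diff power_int_minus
        divide_inverse)
    finally show ?thesis
      by (simp add: power_int_add add.commute mult_ac)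
  qed
  have prod1: "qpoch ?w q (2 * N) = qpoch ?w q N * qpoch z q N"
  proof -
    have "?w * q ^ N = z"
      using q by (simp add: power_int_minus)
    then show ?thesis
      using qpoch_add[of ?w q N N] by (simp only: mult_2)
  qed
  have prod2: "qpoch ?w q N = ?K * qpoch (q / z) q N"
    by (rule qpoch_reflect[OF q(2) z])
  have "?K * (\<Sum>\<^sub>\<infinity>j. (-1) powi j * z powi j * q powi (j * (j - 1) div 2) * qbin q (2 * N) (int N +
    j)) =
     (\<Sum>\<^sub>\<infinity>j. (-1) powi (j + int N) * ?w powi (j + int N) * q powi ((j + int N) * (j + int N - 1) div
       2) *
      qbin q (2 * N) (j + int N))"
    unfolding term_eq by (rule infsum_cmult_right'[symmetric])
  also have "\<dots> = qpoch ?w q (2 * N)"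
    unfolding q_binomial_theorem[OF q w, symmetric]
    by (rule infsum_shift_int)
  also have "\<dots> = ?K * (qpoch z q N * qpoch (q / z) q N)"
    unfolding prod1 prod2 by simp
  finally show ?thesis using K mult_left_cancel by blast
qed

theorem jacobi_triple_product:
  assumes q: "norm q < 1" "q \<noteq> 0" and z: "z \<noteq> 0"
  shows "(\<Sum>\<^sub>\<infinity>j. (-1) powi j * z powi j * q powi (j * (j - 1) div 2)) =
    qpoch_inf z q * qpoch_inf (q / z) q * E q"
proof -
  let ?t = "\<lambda>j. (-1) powi j * z powi j * q powi (j * (j - 1) div 2)"
  obtain C where C: "C > 0" "\<And>n k. norm (qbin q n k) \<le> C"
    using qbin_bound[OF q(1)] by blast
  have "(\<lambda>N. \<Sum>\<^sub>\<infinity>j. ?t j * qbin q (2 * N) (int N + j)) \<longlonglongrightarrow>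
      (\<Sum>\<^sub>\<infinity>j. ?t j * (1 / E q))"
  proof (rule infsum_tannery_int)
    show "(\<lambda>j. norm (z powi j * q powi (j * (j - 1) div 2)) * C) summable_on UNIV"
      by (intro summable_on_cmult_left abs_summable_gauss q z)
    show "norm (?t j * qbin q (2 * N) (int N + j)) \<le> norm (z powi j * q powi (j * (j - 1) div 2)) *
      C" for N j
      using C by (auto simp: norm_mult norm_power_int intro!: mult_left_mono)
    fix j
    \<comment> \<open>The index complementary to N - j is N + j. It is a natural number for all N
      only if j is nonnegative; for negative j the mirrored coefficient is used.\<close>
    have "(\<lambda>N. qbin q (2 * N) (int N - j)) \<longlonglongrightarrow> 1 / E q"
    proof (cases "j \<ge> 0")
      case True
      show ?thesis
        by (rule qbin_tendsto[of q "\<lambda>N. N + nat j" "\<lambda>N. N" _ "-j" "\<lambda>N. 2 * N"])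
          (use q True in \<open>auto intro: filterlim_add_const_nat_at_top filterlim_ident\<close>)
    next
      case False
      have "(\<lambda>N. qbin q (2 * N) (int N + j)) \<longlonglongrightarrow> 1 / E q"
        by (rule qbin_tendsto[of q "\<lambda>N. N + nat (- j)" "\<lambda>N. N" _ j "\<lambda>N. 2 * N"])
          (use q False in \<open>auto intro: filterlim_add_const_nat_at_top filterlim_ident\<close>)
      moreover have "qbin q (2 * N) (int N + j) = qbin q (2 * N) (int N - j)" for N
        using qbin_sym[of q "2 * N" "int N - j"] by (simp add: algebra_simps)
      ultimately show ?thesis by simp
    qed
    moreover have "qbin q (2 * N) (int N + j) = qbin q (2 * N) (int N - j)" for N
      using qbin_sym[of q "2 * N" "int N - j"] by (simp add: algebra_simps)
    ultimately show "(\<lambda>N. ?t j * qbin q (2 * N) (int N + j)) \<longlonglongrightarrow> ?t j * (1 / E q)"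
      by (intro tendsto_mult tendsto_const) simp
  qed
  moreover have "(\<lambda>N. \<Sum>\<^sub>\<infinity>j. ?t j * qbin q (2 * N) (int N + j)) \<longlonglongrightarrow>
    qpoch_inf z q * qpoch_inf (q / z) q"
    unfolding finite_triple_product[OF q z] by (intro tendsto_mult qpoch_tendsto q)
  ultimately have "(\<Sum>\<^sub>\<infinity>j. ?t j * (1 / E q)) = qpoch_inf z q * qpoch_inf (q / z) q"
    by (rule LIMSEQ_unique)
  then have "(\<Sum>\<^sub>\<infinity>j. ?t j) * (1 / E q) = qpoch_inf z q * qpoch_inf (q / z) q"
    by (simp only: infsum_cmult_left')
  then show ?thesis
    using E_nonzero[OF q(1)] by (simp add: field_simps)
qed

subsection \<open>The Rogers-Ramanujan identities\<close>

lemma abs_summable_quadratic: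
  assumes q: "norm q < 1" "q \<noteq> 0" and a: "a > 0"
    and e: "\<And>j. e j = int a * (j * (j - 1) div 2) + b * j"
  shows "(\<lambda>j. norm (q powi e j :: complex)) summable_on UNIV"
proof -
  have "(\<lambda>j. norm ((q powi b) powi j * (q ^ a) powi (j * (j - 1) div 2))) summable_on UNIV"
    using q a by (intro abs_summable_gauss norm_power_less_1) auto
  moreover have "(q powi b) powi j * (q ^ a) powi (j * (j - 1) div 2) = q powi e j" for j
    using q by (simp add: e power_int_power power_int_mult[symmetric] power_int_add mult.commute)
  ultimately show ?thesis by simp
qed

lemma triangular_int: "2 * (j * (j - 1) div 2) = j * (j - 1 :: int)"
  by (simp add: dvd_mult_div_cancel)

lemma div2_eqI: "2 * b = a \<Longrightarrow> a div 2 = (b :: int)"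
  by auto

text \<open>Every halved exponent is brought to the normal form a (j(j-1) div 2) + b j. The only
  division left is then an atom, and exponents can be compared linearly.\<close>

lemma rr_exponent_1: "j * (5 * j + 1) div 2 = 5 * (j * (j - 1) div 2) + 3 * (j :: int)"
proof (rule div2_eqI)
  have "2 * (5 * t + 3 * j) = j * (5 * j + 1)" if "2 * t = j * (j - 1)" for t
    using that by (simp add: algebra_simps)
  then show "2 * (5 * (j * (j - 1) div 2) + 3 * j) = j * (5 * j + 1)"
    using triangular_int .
qed

lemma rr_exponent_2: "j * (5 * j - 3) div 2 = 5 * (j * (j - 1) div 2) + (j :: int)"
proof (rule div2_eqI)
  have "2 * (5 * t + j) = j * (5 * j - 3)" if "2 * t = j * (j - 1)" for t
    using that by (simp add: algebra_simps)
  then show "2 * (5 * (j * (j - 1) div 2) + j) = j * (5 * j - 3)"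
    using triangular_int .
qed

lemma triangular_reflect:
  "(- 1 - j) * (- 1 - j - 1) div 2 = j * (j - 1) div 2 + 2 * j + (1 :: int)"
  "(1 - j) * (1 - j - 1) div 2 = j * (j - 1) div (2 :: int)"
proof -
  have "2 * (t + 2 * j + 1) = (- 1 - j) * (- 1 - j - 1)" if "2 * t = j * (j - 1)" for t
    using that by (simp add: algebra_simps)
  then show "(- 1 - j) * (- 1 - j - 1) div 2 = j * (j - 1) div 2 + 2 * j + 1"
    using triangular_int by (intro div2_eqI) blast
  show "(1 - j) * (1 - j - 1) div 2 = j * (j - 1) div 2"
    by (simp add: algebra_simps)
qed

lemma neg_one_powi: "(-1 :: complex) powi j = (if even j then 1 else -1)"
  by (simp add: power_int_minus_left)

lemma square_exponent: "j\<^sup>2 = 2 * (j * (j - 1) div 2) + (j :: int)"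
  using triangular_int[of j] by (simp add: algebra_simps power2_eq_square)

section \<open>Finite Rogers-Ramanujan identities\<close>

context
  fixes q :: complex
  assumes q: "norm q < 1" "q \<noteq> 0"
begin

text \<open>A polynomial truncation: for growing N the coefficient \<open>qbin q N j\<close> tends
  to 1/(q;q)_j, so c = 0 and c = 1 give the series \<open>G\<close> and \<open>H\<close>. The value
  c = 2 occurs only as an intermediate quantity.\<close>

definition rr_sum :: "int \<Rightarrow> nat \<Rightarrow> complex" where
  "rr_sum c N = (\<Sum>\<^sub>\<infinity>j. q powi (j\<^sup>2 + c * j) * qbin q N j)"

lemma summable_qbin_1:
  "(\<lambda>k. f k * qbin q n k) summable_on UNIV" "(\<lambda>k. f k * qbin q n (k - 1)) summable_on UNIV"
  using qbin_summable[of 1 f q n 0] qbin_summable[of 1 f q n "-1"] by simp_all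

lemma summable_qbin_2:
  "(\<lambda>j. f j * qbin q n (int m + 2 * j)) summable_on UNIV"
  "(\<lambda>j. f j * qbin q n (int m + 1 + 2 * j)) summable_on UNIV"
  "(\<lambda>j. f j * qbin q n (int m + 2 * j - 1)) summable_on UNIV"
  using qbin_summable[of 2 f q n "int m"] qbin_summable[of 2 f q n "int m + 1"]
    qbin_summable[of 2 f q n "int m - 1"] by (simp_all add: algebra_simps)

lemma rr_sum_0: "rr_sum c 0 = 1"
proof -
  have "rr_sum c 0 = (\<Sum>\<^sub>\<infinity>j\<in>{0}. q powi (j\<^sup>2 + c * j) * qbin q 0 j)"
    unfolding rr_sum_def by (rule infsum_cong_neutral) (auto simp: qbin_def)
  then show ?thesis by (simp add: qbin_def)
qed

lemma rr_sum_Suc: "rr_sum c (Suc N) = rr_sum c N + q powi (int N + 1 + c) * rr_sum (c + 1) N"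
proof -
  have "rr_sum c (Suc N) = (\<Sum>\<^sub>\<infinity>j\<in>UNIV.
      q powi (j\<^sup>2 + c * j) * q powi (int N + 1 - j) * qbin q N (j - 1) + q powi (j\<^sup>2 + c * j) * qbin
        q N j)"
    unfolding rr_sum_def by (simp add: qbin_Suc'[OF q] algebra_simps)
  also have "\<dots> = (\<Sum>\<^sub>\<infinity>j. q powi (j\<^sup>2 + c * j) * q powi (int N + 1 - j) * qbin q N (j - 1)) +
    rr_sum c N"
    unfolding rr_sum_def by (intro infsum_add summable_qbin_1)
  also have "(\<Sum>\<^sub>\<infinity>j. q powi (j\<^sup>2 + c * j) * q powi (int N + 1 - j) * qbin q N (j - 1)) =
      (\<Sum>\<^sub>\<infinity>j. q powi ((j + 1)\<^sup>2 + c * (j + 1)) * q powi (int N + 1 - (j + 1)) * qbin q N (j + 1 -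
        1))"
    by (rule infsum_shift_int[symmetric])
  also have "\<dots> = (\<Sum>\<^sub>\<infinity>j. q powi (int N + 1 + c) * (q powi (j\<^sup>2 + (c + 1) * j) * qbin q N j))"
  proof (rule infsum_cong)
    fix j
    have "(j + 1)\<^sup>2 + c * (j + 1) + (int N + 1 - (j + 1)) = int N + 1 + c + (j\<^sup>2 + (c + 1) * j)"
      by (simp add: power2_eq_square algebra_simps)
    then have "q powi ((j + 1)\<^sup>2 + c * (j + 1)) * q powi (int N + 1 - (j + 1)) =
        q powi (int N + 1 + c) * q powi (j\<^sup>2 + (c + 1) * j)"
      using q by (simp only: power_int_add[symmetric] simp_thms)
    then show "q powi ((j + 1)\<^sup>2 + c * (j + 1)) * q powi (int N + 1 - (j + 1)) * qbin q N (j + 1 -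
      1) =
        q powi (int N + 1 + c) * (q powi (j\<^sup>2 + (c + 1) * j) * qbin q N j)"
      by simp
  qed
  also have "\<dots> = q powi (int N + 1 + c) * rr_sum (c + 1) N"
    unfolding rr_sum_def by (rule infsum_cmult_right')
  finally show ?thesis by simp
qed

text \<open>The difference inserts 1 - q^j, which absorption turns into 1 - q^(N+1) with a lowered
  binomial. The purpose is to express c = 2 through c = 0 and c = 1.\<close>

lemma rr_sum_diff: "rr_sum 0 (Suc N) - rr_sum 1 (Suc N) = (1 - q ^ Suc N) * q * rr_sum 2 N"
proof -
  have "rr_sum 0 (Suc N) = (\<Sum>\<^sub>\<infinity>j. q powi (j\<^sup>2 + 1 * j) * qbin q (Suc N) j +
      q powi (j\<^sup>2) * (1 - q powi j) * qbin q (Suc N) j)"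
    unfolding rr_sum_def using q by (simp add: power_int_add algebra_simps)
  also have "\<dots> = rr_sum 1 (Suc N) + (\<Sum>\<^sub>\<infinity>j. q powi (j\<^sup>2) * (1 - q powi j) * qbin q (Suc N) j)"
    unfolding rr_sum_def by (intro infsum_add summable_qbin_1)
  also have "(\<Sum>\<^sub>\<infinity>j. q powi (j\<^sup>2) * (1 - q powi j) * qbin q (Suc N) j) =
      (\<Sum>\<^sub>\<infinity>j. (1 - q ^ Suc N) * (q powi (j\<^sup>2) * qbin q N (j - 1)))"
    by (rule infsum_cong) (simp only: mult.assoc qbin_absorb[OF q(1)] mult.left_commute)
  also have "\<dots> = (1 - q ^ Suc N) * (\<Sum>\<^sub>\<infinity>j. q powi (j\<^sup>2) * qbin q N (j - 1))"
    by (rule infsum_cmult_right')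
  also have "(\<Sum>\<^sub>\<infinity>j. q powi (j\<^sup>2) * qbin q N (j - 1)) =
      (\<Sum>\<^sub>\<infinity>j. q powi ((j + 1)\<^sup>2) * qbin q N (j + 1 - 1))"
    by (rule infsum_shift_int[symmetric])
  also have "\<dots> = (\<Sum>\<^sub>\<infinity>j. q * (q powi (j\<^sup>2 + 2 * j) * qbin q N j))"
    using q by (intro infsum_cong) (simp add: power2_eq_square algebra_simps power_int_add)
  also have "\<dots> = q * rr_sum 2 N"
    unfolding rr_sum_def by (rule infsum_cmult_right')
  finally show ?thesis by (simp add: algebra_simps)
qed

text \<open>Eliminating c = 2 closes the system: c = 0 and c = 1 now satisfy recurrences among
  themselves, which the alternating sums below satisfy as well.\<close>

lemma rr_sum_1_Suc: "rr_sum 1 (Suc N) = (1 - q ^ Suc N) * rr_sum 1 N + q ^ Suc N * rr_sum 0 (Suc N)"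
proof -
  have "rr_sum 1 (Suc N) = rr_sum 1 N + q ^ Suc N * (q * rr_sum 2 N)"
    using rr_sum_Suc[of 1 N] q by (simp add: power_int_add power2_eq_square)
  then have "(1 - q ^ Suc N) * rr_sum 1 (Suc N) = (1 - q ^ Suc N) * rr_sum 1 N +
      q ^ Suc N * ((1 - q ^ Suc N) * q * rr_sum 2 N)"
    by (simp only:) (simp only: algebra_simps)
  then show ?thesis
    unfolding rr_sum_diff[symmetric] by (simp only: algebra_simps) simp
qed

text \<open>With \<open>rr_alt_1\<close>, the alternating sides of Bressoud's finite
  Rogers-Ramanujan identities. In the limit the central binomials all become 1/E(q).\<close>

definition rr_alt_0 :: "nat \<Rightarrow> complex" where
  "rr_alt_0 N = (\<Sum>\<^sub>\<infinity>j. (-1) powi j * q powi (j * (5 * j + 1) div 2) * qbin q (2 * N) (int N +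
    2 * j))"

definition rr_alt_1 :: "nat \<Rightarrow> complex" where
  "rr_alt_1 N = (\<Sum>\<^sub>\<infinity>j. (-1) powi j * q powi (j * (5 * j - 3) div 2) * qbin q (2 * N + 1) (int N +
    2 * j))"

lemma infsum_antisym_int:
  fixes f :: "int \<Rightarrow> complex"
  assumes "\<And>j. f (c - j) = - f j"
  shows "infsum f UNIV = 0"
proof -
  have "infsum f UNIV = - infsum f UNIV"
    unfolding infsum_uminus[symmetric] assms[symmetric] infsum_reflect_int ..
  then show ?thesis by simp
qed

text \<open>Two Pascal rules split the binomial in three. The first part is q^(N+1) times
  \<open>rr_alt_1 N\<close>, the last is \<open>rr_alt_0 N\<close>, and the middle one is
  antisymmetric under j -> -1 - j and so vanishes.\<close>

lemma rr_alt_0_Suc: "rr_alt_0 (Suc N) = rr_alt_0 N + q ^ Suc N * rr_alt_1 N"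
proof -
  let ?c = "\<lambda>j. (-1) powi j * q powi (j * (5 * j + 1) div 2)"
  have "rr_alt_0 (Suc N) = (\<Sum>\<^sub>\<infinity>j\<in>UNIV.
      ?c j * q powi (int N + 1 - 2 * j) * qbin q (2 * N + 1) (int N + 2 * j) +
      (?c j * q powi (int N + 1 + 2 * j) * qbin q (2 * N) (int N + 1 + 2 * j) +
       ?c j * qbin q (2 * N) (int N + 2 * j)))"
  proof -
    have "qbin q (2 * Suc N) (int (Suc N) + 2 * j) =
      q powi (int N + 1 - 2 * j) * qbin q (2 * N + 1) (int N + 2 * j) +
      (q powi (int N + 1 + 2 * j) * qbin q (2 * N) (int N + 1 + 2 * j) +
       qbin q (2 * N) (int N + 2 * j))" for j
    proof -
      have "qbin q (2 * Suc N) (int (Suc N) + 2 * j) =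
         q powi (int N + 1 - 2 * j) * qbin q (2 * N + 1) (int N + 2 * j) + qbin q (2 * N + 1)
           (int N + 1 + 2 * j)"
        using qbin_Suc'[OF q, of "2 * N + 1" "int N + 1 + 2 * j"] by (simp add: algebra_simps)
      then show ?thesis
        using qbin_Suc[OF q, of "2 * N" "int N + 1 + 2 * j"] by (simp add: algebra_simps)
    qed
    then show ?thesis unfolding rr_alt_0_def by (simp add: distrib_left mult.assoc)
  qed
  also have "\<dots> = (\<Sum>\<^sub>\<infinity>j. ?c j * q powi (int N + 1 - 2 * j) * qbin q (2 * N + 1) (int N + 2 * j)) +
      ((\<Sum>\<^sub>\<infinity>j. ?c j * q powi (int N + 1 + 2 * j) * qbin q (2 * N) (int N + 1 + 2 * j)) + rr_alt_0 N)"
    unfolding rr_alt_0_def by (subst infsum_add, (intro summable_on_add summable_qbin_2)+)+ simp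
  also have "(\<Sum>\<^sub>\<infinity>j. ?c j * q powi (int N + 1 + 2 * j) * qbin q (2 * N) (int N + 1 + 2 * j)) = 0"
  proof (rule infsum_antisym_int)
    fix j :: int
    have 1: "qbin q (2 * N) (int N + 1 + 2 * (- 1 - j)) = qbin q (2 * N) (int N + 1 + 2 * j)"
      using qbin_sym[of q "2 * N" "int N + 1 + 2 * j"] by (simp add: algebra_simps)
    have "(- 1 - j) * (5 * (- 1 - j) + 1) div 2 + (int N + 1 + 2 * (- 1 - j)) =
        j * (5 * j + 1) div 2 + (int N + 1 + 2 * j)"
      unfolding rr_exponent_1 triangular_reflect by simp
    then have 2: "q powi ((- 1 - j) * (5 * (- 1 - j) + 1) div 2) * q powi (int N + 1 +
      2 * (- 1 - j)) =
        q powi (j * (5 * j + 1) div 2) * q powi (int N + 1 + 2 * j)"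
      using q by (simp only: power_int_add[symmetric] simp_thms)
    have 3: "(-1 :: complex) powi (- 1 - j) = - ((-1) powi j)"
      by (simp add: neg_one_powi)
    show "?c (- 1 - j) * q powi (int N + 1 + 2 * (- 1 - j)) * qbin q (2 * N) (int N + 1 +
      2 * (- 1 - j)) =
        - (?c j * q powi (int N + 1 + 2 * j) * qbin q (2 * N) (int N + 1 + 2 * j))"
      unfolding 1 3 mult.assoc[of _ "q powi _" "q powi _"] 2 by simp
  qed
  also have "(\<Sum>\<^sub>\<infinity>j. ?c j * q powi (int N + 1 - 2 * j) * qbin q (2 * N + 1) (int N + 2 * j)) =
     (\<Sum>\<^sub>\<infinity>j. q ^ Suc N * ((-1) powi j * q powi (j * (5 * j - 3) div 2) * qbin q (2 * N + 1) (int N +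
       2 * j)))"
  proof (rule infsum_cong)
    fix j :: int
    have "j * (5 * j + 1) div 2 + (int N + 1 - 2 * j) = int (Suc N) + j * (5 * j - 3) div 2"
      unfolding rr_exponent_1 rr_exponent_2 by simp
    then have "q powi (j * (5 * j + 1) div 2) * q powi (int N + 1 - 2 * j) =
        q powi int (Suc N) * q powi (j * (5 * j - 3) div 2)"
      using q by (simp only: power_int_add[symmetric] simp_thms)
    then show "?c j * q powi (int N + 1 - 2 * j) * qbin q (2 * N + 1) (int N + 2 * j) =
      q ^ Suc N * ((-1) powi j * q powi (j * (5 * j - 3) div 2) * qbin q (2 * N + 1) (int N +
        2 * j))"
      by (simp only: power_int_of_nat mult.assoc) (simp only: mult_ac)
  qed
  also have "\<dots> = q ^ Suc N * rr_alt_1 N"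
    unfolding rr_alt_1_def by (rule infsum_cmult_right')
  finally show ?thesis by simp
qed

text \<open>The same threefold splitting. Here the reflection j -> 1 - j turns the middle part into
  -q^(N+1) times \<open>rr_alt_1 N\<close> instead of annihilating it, which yields precisely the
  recurrence of \<open>rr_sum_1_Suc\<close>.\<close>

lemma rr_alt_1_Suc: "rr_alt_1 (Suc N) = (1 - q ^ Suc N) * rr_alt_1 N + q ^ Suc N * rr_alt_0 (Suc N)"
proof -
  let ?c = "\<lambda>j. (-1) powi j * q powi (j * (5 * j - 3) div 2)"
  have "rr_alt_1 (Suc N) = (\<Sum>\<^sub>\<infinity>j\<in>UNIV.
      ?c j * q powi (int N + 1 + 2 * j) * qbin q (2 * Suc N) (int (Suc N) + 2 * j) +
      (?c j * q powi (int N + 2 - 2 * j) * qbin q (2 * N + 1) (int N + 2 * j - 1) +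
       ?c j * qbin q (2 * N + 1) (int N + 2 * j)))"
  proof -
    have "qbin q (2 * Suc N + 1) (int (Suc N) + 2 * j) =
      q powi (int N + 1 + 2 * j) * qbin q (2 * Suc N) (int (Suc N) + 2 * j) +
      (q powi (int N + 2 - 2 * j) * qbin q (2 * N + 1) (int N + 2 * j - 1) +
       qbin q (2 * N + 1) (int N + 2 * j))" for j
    proof -
      have "qbin q (2 * Suc N + 1) (int (Suc N) + 2 * j) =
         qbin q (2 * N + 2) (int N + 2 * j) + q powi (int N + 1 + 2 * j) * qbin q (2 * Suc N)
           (int (Suc N) + 2 * j)"
        using qbin_Suc[OF q, of "2 * N + 2" "int N + 1 + 2 * j"] by (simp add: algebra_simps)
      then show ?thesis
        using qbin_Suc'[OF q, of "2 * N + 1" "int N + 2 * j"] by (simp add: algebra_simps)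
    qed
    then show ?thesis unfolding rr_alt_1_def by (simp add: distrib_left mult.assoc)
  qed
  also have "\<dots> = (\<Sum>\<^sub>\<infinity>j. ?c j * q powi (int N + 1 + 2 * j) * qbin q (2 * Suc N) (int (Suc N) +
    2 * j)) +
      ((\<Sum>\<^sub>\<infinity>j. ?c j * q powi (int N + 2 - 2 * j) * qbin q (2 * N + 1) (int N + 2 * j - 1)) + rr_alt_1
        N)"
    unfolding rr_alt_1_def by (subst infsum_add, (intro summable_on_add summable_qbin_2)+)+ simp
  also have "(\<Sum>\<^sub>\<infinity>j. ?c j * q powi (int N + 2 - 2 * j) * qbin q (2 * N + 1) (int N + 2 * j - 1)) =
     (\<Sum>\<^sub>\<infinity>j. ?c (1 - j) * q powi (int N + 2 - 2 * (1 - j)) * qbin q (2 * N + 1) (int N +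
       2 * (1 - j) - 1))"
    by (rule infsum_reflect_int[symmetric])
  also have "\<dots> = (\<Sum>\<^sub>\<infinity>j. - (q ^ Suc N) * (?c j * qbin q (2 * N + 1) (int N + 2 * j)))"
  proof (rule infsum_cong)
    fix j :: int
    have 1: "qbin q (2 * N + 1) (int N + 2 * (1 - j) - 1) = qbin q (2 * N + 1) (int N + 2 * j)"
      using qbin_sym[of q "2 * N + 1" "int N + 2 * j"] by (simp add: algebra_simps)
    have "(1 - j) * (5 * (1 - j) - 3) div 2 + (int N + 2 - 2 * (1 - j)) =
      int (Suc N) + j * (5 * j - 3) div 2"
      unfolding rr_exponent_2 triangular_reflect by simp
    then have 2: "q powi ((1 - j) * (5 * (1 - j) - 3) div 2) * q powi (int N + 2 - 2 * (1 - j)) =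
        q powi int (Suc N) * q powi (j * (5 * j - 3) div 2)"
      using q by (simp only: power_int_add[symmetric] simp_thms)
    have 3: "(-1 :: complex) powi (1 - j) = - ((-1) powi j)"
      by (simp add: neg_one_powi)
    show "?c (1 - j) * q powi (int N + 2 - 2 * (1 - j)) * qbin q (2 * N + 1) (int N + 2 * (1 - j) -
      1) =
       - (q ^ Suc N) * (?c j * qbin q (2 * N + 1) (int N + 2 * j))"
      unfolding 1 3 mult.assoc[of _ "q powi _" "q powi _"] 2 power_int_of_nat by simp
  qed
  also have "\<dots> = - (q ^ Suc N) * rr_alt_1 N"
    unfolding rr_alt_1_def by (rule infsum_cmult_right')
  also have "(\<Sum>\<^sub>\<infinity>j. ?c j * q powi (int N + 1 + 2 * j) * qbin q (2 * Suc N) (int (Suc N) + 2 * j)) =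
     (\<Sum>\<^sub>\<infinity>j. q ^ Suc N * ((-1) powi j * q powi (j * (5 * j + 1) div 2) * qbin q (2 * Suc N)
       (int (Suc N) + 2 * j)))"
  proof (rule infsum_cong)
    fix j :: int
    have "j * (5 * j - 3) div 2 + (int N + 1 + 2 * j) = int (Suc N) + j * (5 * j + 1) div 2"
      unfolding rr_exponent_1 rr_exponent_2 by simp
    then have "q powi (j * (5 * j - 3) div 2) * q powi (int N + 1 + 2 * j) =
        q powi int (Suc N) * q powi (j * (5 * j + 1) div 2)"
      using q by (simp only: power_int_add[symmetric] simp_thms)
    then show "?c j * q powi (int N + 1 + 2 * j) * qbin q (2 * Suc N) (int (Suc N) + 2 * j) =
      q ^ Suc N * ((-1) powi j * q powi (j * (5 * j + 1) div 2) * qbin q (2 * Suc N) (int (Suc N) +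
        2 * j))"
      by (simp only: power_int_of_nat mult.assoc) (simp only: mult_ac)
  qed
  also have "\<dots> = q ^ Suc N * rr_alt_0 (Suc N)"
    unfolding rr_alt_0_def by (rule infsum_cmult_right')
  finally show ?thesis by (simp add: left_diff_distrib)
qed

lemma rr_finite: "rr_sum 0 N = rr_alt_0 N \<and> rr_sum 1 N = rr_alt_1 N"
proof (induction N)
  case 0
  have "rr_alt_0 0 = (\<Sum>\<^sub>\<infinity>j\<in>{0}. (-1) powi j * q powi (j * (5 * j + 1) div 2) * qbin q 0 (2 * j))"
    unfolding rr_alt_0_def by (rule infsum_cong_neutral) (auto simp: qbin_def)
  moreover have "rr_alt_1 0 = (\<Sum>\<^sub>\<infinity>j\<in>{0}. (-1) powi j * q powi (j * (5 * j - 3) div 2) * qbin q 1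
    (2 * j))"
    unfolding rr_alt_1_def by (rule infsum_cong_neutral) (auto simp: qbin_def)
  ultimately show ?case
    using qpoch_nonzero[OF q(1), of 1] by (simp add: rr_sum_0 qbin_def)
next
  case (Suc N)
  have "rr_sum 0 (Suc N) = rr_alt_0 (Suc N)"
    using rr_sum_Suc[of 0 N] rr_alt_0_Suc[of N] Suc q by (simp add: power_int_add)
  then show ?case
    using rr_sum_1_Suc[of N] rr_alt_1_Suc[of N] Suc by simp
qed

section \<open>Passage to the limit in the finite identities\<close>

lemma qbin_tendsto_fixed:
  "(\<lambda>N. qbin q N j) \<longlonglongrightarrow> (if j \<ge> 0 then 1 / qpoch q q (nat j) else 0)"
proof (cases "j \<ge> 0")
  case True
  have "filterlim (\<lambda>N. nat (int N - j)) at_top sequentially"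
    unfolding filterlim_at_top
  proof
    fix Z :: nat
    show "eventually (\<lambda>N. Z \<le> nat (int N - j)) sequentially"
      using eventually_ge_at_top[of "Z + nat j"] by eventually_elim (use True in auto)
  qed
  then have "(\<lambda>N. qpoch q q N / (qpoch q q (nat j) * qpoch q q (nat (int N - j)))) \<longlonglongrightarrow>
      E q / (qpoch q q (nat j) * E q)"
    using E_nonzero[OF q(1)] qpoch_nonzero[OF q(1)] 
    by (intro tendsto_divide tendsto_mult tendsto_const qpoch_tendsto_E q filterlim_ident) auto
  then have *: "(\<lambda>N. qpoch q q N / (qpoch q q (nat j) * qpoch q q (nat (int N - j)))) \<longlonglongrightarrow>
      1 / qpoch q q (nat j)"
    using E_nonzero[OF q(1)] by simp
  have "(\<lambda>N. qbin q N j) \<longlonglongrightarrow> 1 / qpoch q q (nat j)"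
  proof (rule Lim_transform_eventually[OF *])
    show "\<forall>\<^sub>F N in sequentially. qpoch q q N / (qpoch q q (nat j) * qpoch q q (nat (int N - j))) =
      qbin q N j"
      using eventually_ge_at_top[of "nat j"] by eventually_elim (use True in \<open>auto simp: qbin_def\<close>)
  qed
  then show ?thesis using True by simp
qed (simp add: qbin_eq_0)

lemma rr_sum_tendsto:
  fixes c :: nat
  shows "rr_sum (int c) \<longlonglongrightarrow> (\<Sum>n. q ^ (n\<^sup>2 + c * n) / qpoch q q n)"
proof -
  obtain C where C: "C > 0" "\<And>n k. norm (qbin q n k) \<le> C"
    using qbin_bound[OF q(1)] by blast
  obtain D where D: "D > 0" "\<And>n. norm (inverse (qpoch q q n)) \<le> D"
    using inverse_qpoch_Bseq[OF q(1)] by blast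
  let ?g = "\<lambda>j. q powi (j\<^sup>2 + int c * j) * (if j \<ge> 0 then 1 / qpoch q q (nat j) else 0)"
  have summ: "(\<lambda>j. norm (q powi (j\<^sup>2 + int c * j))) summable_on UNIV"
    by (rule abs_summable_quadratic[where a = 2 and b = "int c + 1"])
      (use q in \<open>auto simp: square_exponent algebra_simps\<close>)
  have "rr_sum (int c) \<longlonglongrightarrow> infsum ?g UNIV"
    unfolding rr_sum_def
  proof (rule infsum_tannery_int)
    show "(\<lambda>j. norm (q powi (j\<^sup>2 + int c * j)) * C) summable_on UNIV"
      by (intro summable_on_cmult_left summ)
    show "(\<lambda>N. q powi (j\<^sup>2 + int c * j) * qbin q N j) \<longlonglongrightarrow> ?g j" for j
      by (intro tendsto_mult tendsto_const qbin_tendsto_fixed)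
  qed (use C in \<open>auto simp: norm_mult intro!: mult_left_mono\<close>)
  moreover have "infsum ?g UNIV = (\<Sum>n. q ^ (n\<^sup>2 + c * n) / qpoch q q n)"
  proof -
    have g_norm: "norm (?g j) \<le> norm (q powi (j\<^sup>2 + int c * j)) * D" for j
      using D by (auto simp: norm_mult norm_divide divide_inverse norm_inverse intro!:
        mult_left_mono)
    have "?g summable_on UNIV"
      by (rule abs_summable_summable, rule summable_on_comparison_test[where f = "\<lambda>j. norm
        (q powi (j\<^sup>2 + int c * j)) * D"])
       (use g_norm in \<open>auto intro!: summable_on_cmult_left summ\<close>)
    then have "?g summable_on {0..}"
      by (rule summable_on_subset_banach) auto
    then have hs: "(?g has_sum infsum ?g {0..}) {0..}"
      by (rule has_sum_infsum)
    have "((\<lambda>n. q ^ (n\<^sup>2 + c * n) / qpoch q q n) has_sum infsum ?g {0..}) UNIV"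
    proof (subst has_sum_reindex_bij_witness[of UNIV nat int "{0..}" ?g])
      fix n :: nat
      have "(int n)\<^sup>2 + int c * int n = int (n\<^sup>2 + c * n)" by simp
      then show "?g (int n) = q ^ (n\<^sup>2 + c * n) / qpoch q q n"
        by (simp only: power_int_of_nat) simp
    qed (use hs in auto)
    then have "(\<lambda>n. q ^ (n\<^sup>2 + c * n) / qpoch q q n) sums infsum ?g {0..}"
      by (rule has_sum_imp_sums)
    moreover have "infsum ?g UNIV = infsum ?g {0..}"
      by (rule infsum_cong_neutral) auto
    ultimately show ?thesis by (simp add: sums_iff)
  qed
  ultimately show ?thesis by simp
qed

lemma qbin_central_tendsto:
  "(\<lambda>N. qbin q (2 * N + d) (int N + c)) \<longlonglongrightarrow> 1 / E q"
proof -
  \<comment> \<open>The offset |c| keeps the lower index N + |c| + c and its complement N + |c| - c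
    + d nonnegative for every N.\<close>
  have "(\<lambda>N. qbin q (2 * (N + nat \<bar>c\<bar>) + d) (int (N + nat \<bar>c\<bar>) + c)) \<longlonglongrightarrow> 1 / E q"
    by (rule qbin_tendsto[of q "\<lambda>N. N + nat (\<bar>c\<bar> - c + int d)" "\<lambda>N. N" _ "\<bar>c\<bar> + c"])
      (use q in \<open>auto intro: filterlim_add_const_nat_at_top filterlim_ident\<close>)
  then show ?thesis by (rule LIMSEQ_offset)
qed

lemma rr_alt_tendsto:
  fixes b :: int
  assumes e: "\<And>j. e j = 5 * (j * (j - 1) div 2) + b * j"
  shows "(\<lambda>N. \<Sum>\<^sub>\<infinity>j. (-1) powi j * q powi e j * qbin q (2 * N + d) (int N + 2 * j)) \<longlonglongrightarrow>
     (\<Sum>\<^sub>\<infinity>j. (-1) powi j * q powi e j * (1 / E q))"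
proof -
  obtain C where C: "C > 0" "\<And>n k. norm (qbin q n k) \<le> C"
    using qbin_bound[OF q(1)] by blast
  show ?thesis
  proof (rule infsum_tannery_int)
    show "(\<lambda>j. norm (q powi e j) * C) summable_on UNIV"
      by (intro summable_on_cmult_left abs_summable_quadratic[where a = 5 and b = b]) (use q e
        in auto)
    show "(\<lambda>N. (-1) powi j * q powi e j * qbin q (2 * N + d) (int N + 2 * j)) \<longlonglongrightarrow>
        (-1) powi j * q powi e j * (1 / E q)" for j
      by (intro tendsto_mult tendsto_const qbin_central_tendsto)
    show "norm ((-1) powi j * q powi e j * qbin q (2 * N + d) (int N + 2 * j)) \<le>
      norm (q powi e j) * C"
      for N j
      using C by (auto simp: norm_mult norm_power_int intro!: mult_left_mono)
  qed
qed

theorem rogers_ramanujan_G: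
  "E q * G q = (\<Sum>\<^sub>\<infinity>j. (-1) powi j * q powi (j * (5 * j + 1) div 2))"
proof -
  have "rr_sum 0 \<longlonglongrightarrow> G q"
    using rr_sum_tendsto[of 0] by (simp add: G_def)
  moreover have eq: "rr_sum 0 = (\<lambda>N. \<Sum>\<^sub>\<infinity>j\<in>UNIV.
      (-1) powi j * q powi (j * (5 * j + 1) div 2) * qbin q (2 * N) (int N + 2 * j))"
    using rr_finite by (auto simp: rr_alt_0_def)
  have "rr_sum 0 \<longlonglongrightarrow> (\<Sum>\<^sub>\<infinity>j. (-1) powi j * q powi (j * (5 * j + 1) div 2) * (1 / E q))"
    using rr_alt_tendsto[of "\<lambda>j. j * (5 * j + 1) div 2" 3 0] rr_exponent_1
    unfolding eq by simp
  ultimately have "G q = (\<Sum>\<^sub>\<infinity>j. (-1) powi j * q powi (j * (5 * j + 1) div 2) * (1 / E q))"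
    by (rule LIMSEQ_unique)
  also have "\<dots> = (\<Sum>\<^sub>\<infinity>j. (-1) powi j * q powi (j * (5 * j + 1) div 2)) * (1 / E q)"
    by (rule infsum_cmult_left')
  finally show ?thesis using E_nonzero[OF q(1)] by (simp add: field_simps)
qed

theorem rogers_ramanujan_H:
  "E q * H q = (\<Sum>\<^sub>\<infinity>j. (-1) powi j * q powi (j * (5 * j - 3) div 2))"
proof -
  have "rr_sum 1 \<longlonglongrightarrow> H q"
    using rr_sum_tendsto[of 1] by (simp add: H_def power2_eq_square algebra_simps)
  moreover have eq: "rr_sum 1 = (\<lambda>N. \<Sum>\<^sub>\<infinity>j\<in>UNIV.
      (-1) powi j * q powi (j * (5 * j - 3) div 2) * qbin q (2 * N + 1) (int N + 2 * j))"
    using rr_finite by (auto simp: rr_alt_1_def)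
  have "rr_sum 1 \<longlonglongrightarrow> (\<Sum>\<^sub>\<infinity>j. (-1) powi j * q powi (j * (5 * j - 3) div 2) * (1 / E q))"
    using rr_alt_tendsto[of "\<lambda>j. j * (5 * j - 3) div 2" 1 1] rr_exponent_2
    unfolding eq by simp
  ultimately have "H q = (\<Sum>\<^sub>\<infinity>j. (-1) powi j * q powi (j * (5 * j - 3) div 2) * (1 / E q))"
    by (rule LIMSEQ_unique)
  also have "\<dots> = (\<Sum>\<^sub>\<infinity>j. (-1) powi j * q powi (j * (5 * j - 3) div 2)) * (1 / E q)"
    by (rule infsum_cmult_left')
  finally show ?thesis using E_nonzero[OF q(1)] by (simp add: field_simps)
qed

end

subsection \<open>Weighted lattice sums over diagonal forms\<close>

definition bounded_weight :: "(int \<Rightarrow> int \<Rightarrow> complex) \<Rightarrow> bool" where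
  "bounded_weight w \<longleftrightarrow> (\<exists>K. \<forall>u v. norm (w u v) \<le> K)"

lemma bounded_weight_intros [intro]:
  "bounded_weight (\<lambda>u v. c)"
  "bounded_weight (\<lambda>u v. of_bool (P u v))"
  "bounded_weight w \<Longrightarrow> bounded_weight w' \<Longrightarrow> bounded_weight (\<lambda>u v. w u v + w' u v)"
  "bounded_weight w \<Longrightarrow> bounded_weight w' \<Longrightarrow> bounded_weight (\<lambda>u v. w u v - w' u v)"
  "bounded_weight w \<Longrightarrow> bounded_weight w' \<Longrightarrow> bounded_weight (\<lambda>u v. w u v * w' u v)"
proof -
  show "bounded_weight (\<lambda>u v. c)" "bounded_weight (\<lambda>u v. of_bool (P u v))"
    by (auto simp: bounded_weight_def intro: exI[of _ "norm c"] exI[of _ 1])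
  assume "bounded_weight w" "bounded_weight w'"
  then obtain K K' where K: "\<And>u v. norm (w u v) \<le> K" "\<And>u v. norm (w' u v) \<le> K'"
    unfolding bounded_weight_def by blast
  show "bounded_weight (\<lambda>u v. w u v + w' u v)"
    unfolding bounded_weight_def by (intro exI[of _ "K + K'"] allI norm_triangle_le add_mono K)
  show "bounded_weight (\<lambda>u v. w u v - w' u v)"
    unfolding bounded_weight_def
    by (intro exI[of _ "K + K'"] allI order.trans[OF norm_triangle_ineq4] add_mono K)
  have "0 \<le> K" "0 \<le> K'"
    using K[of 0 0] norm_ge_zero order.trans by blast+
  then show "bounded_weight (\<lambda>u v. w u v * w' u v)"
    unfolding bounded_weight_def norm_mult
    by (intro exI[of _ "K * K'"] allI mult_mono K) auto
qed

definition lattice_sum :: "nat \<Rightarrow> nat \<Rightarrow> (int \<Rightarrow> int \<Rightarrow> complex) \<Rightarrow> complex \<Rightarrow> complex" where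
  "lattice_sum a b w z = (\<Sum>\<^sub>\<infinity>(u, v)\<in>UNIV. w u v * z powi (int a * u\<^sup>2 + int b * v\<^sup>2))"

definition theta_sum :: "(int \<Rightarrow> complex) \<Rightarrow> complex \<Rightarrow> complex" where
  "theta_sum f z = (\<Sum>\<^sub>\<infinity>u. f u * z powi (u\<^sup>2))"

lemma abs_summable_square:
  assumes "norm z < 1" "z \<noteq> 0"
  shows "(\<lambda>u :: int. norm (z powi (u\<^sup>2) :: complex)) summable_on UNIV"
  by (rule abs_summable_quadratic[where a = 2 and b = 1]) (use assms
    in \<open>auto simp: square_exponent\<close>)

lemma abs_summable_times:
  fixes f g :: "int \<Rightarrow> complex"
  assumes "(\<lambda>u. norm (f u)) summable_on UNIV" "(\<lambda>v. norm (g v)) summable_on UNIV"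
  shows "(\<lambda>(u, v). norm (f u * g v)) summable_on UNIV"
proof -
  have "(\<lambda>p. norm ((\<lambda>(u, v). f u * g v) p)) summable_on (UNIV \<times> UNIV)"
    unfolding Infinite_Sum.abs_summable_on_Sigma_iff
  proof (intro conjI ballI)
    show "(\<lambda>v. norm (case (u, v) of (u, v) \<Rightarrow> f u * g v)) summable_on UNIV" for u
      using summable_on_cmult_right[OF assms(2), of "norm (f u)"] by (simp add: norm_mult)
    have "(\<lambda>u. norm (f u) * infsum (\<lambda>v. norm (g v)) UNIV) summable_on UNIV"
      by (rule summable_on_cmult_left[OF assms(1)])
    then show "(\<lambda>u. norm (infsum (\<lambda>v. norm (case (u, v) of (u, v) \<Rightarrow> f u * g v)) UNIV)) summable_on
      UNIV"
      by (simp add: norm_mult infsum_cmult_right' abs_mult infsum_nonneg)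
  qed
  then show ?thesis by (simp add: case_prod_unfold)
qed

lemma infsum_times:
  fixes f g :: "int \<Rightarrow> complex"
  assumes "(\<lambda>u. norm (f u)) summable_on UNIV" "(\<lambda>v. norm (g v)) summable_on UNIV"
  shows "(\<Sum>\<^sub>\<infinity>(u, v)\<in>UNIV. f u * g v) = infsum f UNIV * infsum g UNIV"
proof -
  have "(\<lambda>(u, v). f u * g v) summable_on (UNIV \<times> UNIV)"
    by (rule abs_summable_summable)
      (use abs_summable_times[OF assms] in \<open>simp add: case_prod_unfold\<close>)
  from infsum_Sigma'_banach[OF this] show ?thesis
    by (simp add: infsum_cmult_right' infsum_cmult_left')
qed

lemma lattice_sum_abs_summable:
  assumes "norm z < 1" "z \<noteq> 0" "a > 0" "b > 0"
  shows "(\<lambda>(u, v). norm (z powi (int a * u\<^sup>2 + int b * v\<^sup>2) :: complex)) summable_on UNIV"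
proof -
  have "(\<lambda>(u, v). norm ((z ^ a) powi (u\<^sup>2) * (z ^ b) powi (v\<^sup>2))) summable_on UNIV"
    by (intro abs_summable_times abs_summable_square norm_power_less_1) (use assms in auto)
  then show ?thesis
    using assms by (simp add: power_int_add power_int_power)
qed

context
  fixes z :: complex and a b :: nat
  assumes z: "norm z < 1" "z \<noteq> 0" and ab: "a > 0" "b > 0"
begin

lemma lattice_sum_summable:
  assumes "bounded_weight w"
  shows "(\<lambda>(u, v). w u v * z powi (int a * u\<^sup>2 + int b * v\<^sup>2)) summable_on UNIV"
proof -
  obtain K where K: "\<And>u v. norm (w u v) \<le> K"
    using assms unfolding bounded_weight_def by blast
  show ?thesis
  proof (rule abs_summable_summable, rule summable_on_comparison_test)
    show "(\<lambda>p. K * (case p of (u, v) \<Rightarrow> norm (z powi (int a * u\<^sup>2 + int b * v\<^sup>2)))) summable_on UNIV"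
      by (intro summable_on_cmult_right lattice_sum_abs_summable z ab)
  qed (auto simp: norm_mult intro!: mult_right_mono K)
qed

lemma lattice_sum_add:
  assumes "bounded_weight w" "bounded_weight w'"
  shows "lattice_sum a b (\<lambda>u v. w u v + w' u v) z = lattice_sum a b w z + lattice_sum a b w' z"
  unfolding lattice_sum_def
  using infsum_add[OF lattice_sum_summable[OF assms(1)] lattice_sum_summable[OF assms(2)]]
  by (simp add: case_prod_unfold distrib_right)

lemma lattice_sum_cmult: "lattice_sum a b (\<lambda>u v. c * w u v) z = c * lattice_sum a b w z"
  unfolding lattice_sum_def infsum_cmult_right'[symmetric] by (simp add: case_prod_unfold
    mult.assoc)

lemma lattice_sum_diff:
  assumes "bounded_weight w" "bounded_weight w'"
  shows "lattice_sum a b (\<lambda>u v. w u v - w' u v) z = lattice_sum a b w z - lattice_sum a b w' z"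
  using lattice_sum_add[OF assms(1) bounded_weight_intros(5)[OF bounded_weight_intros(1)[of "-1"]
    assms(2)]]
    lattice_sum_cmult[of "-1" w'] by simp

lemma lattice_sum_neg:
  "lattice_sum a b (\<lambda>u v. w (- u) v) z = lattice_sum a b w z"
  "lattice_sum a b (\<lambda>u v. w u (- v)) z = lattice_sum a b w z"
  unfolding lattice_sum_def
  by (rule infsum_reindex_bij_witness[of _ "\<lambda>(u, v). (- u, v)" "\<lambda>(u, v). (- u, v)"]; auto)
    (rule infsum_reindex_bij_witness[of _ "\<lambda>(u, v). (u, - v)" "\<lambda>(u, v). (u, - v)"]; auto)

lemma lattice_sum_symmetrize:
  assumes "bounded_weight w"
  shows "lattice_sum a b (\<lambda>u v. w u v + w (- u) v + w u (- v) + w (- u) (- v)) z =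
    4 * lattice_sum a b w z"
proof -
  have b: "bounded_weight (\<lambda>u v. w (- u) v)" "bounded_weight (\<lambda>u v. w u (- v))" "bounded_weight
    (\<lambda>u v. w (- u) (- v))"
    using assms unfolding bounded_weight_def by blast+
  have "lattice_sum a b (\<lambda>u v. w (- u) (- v)) z = lattice_sum a b w z"
    using lattice_sum_neg(1)[of "\<lambda>u v. w u (- v)"] lattice_sum_neg(2)[of w] by simp
  moreover note b' = bounded_weight_intros(3)[OF assms b(1)]
  moreover note lattice_sum_add[OF bounded_weight_intros(3)[OF b' b(2)] b(3)]
  ultimately show ?thesis
    unfolding lattice_sum_add[OF b' b(2)] lattice_sum_add[OF assms b(1)]
      lattice_sum_neg(1)[of w] lattice_sum_neg(2)[of w] by simp
qed

lemma lattice_sum_eqI: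
  assumes "bounded_weight w" "bounded_weight w'"
    and "\<And>u v. w u v + w (- u) v + w u (- v) + w (- u) (- v) =
      w' u v + w' (- u) v + w' u (- v) + w' (- u) (- v)"
  shows "lattice_sum a b w z = lattice_sum a b w' z"
proof -
  have "(\<lambda>u v. w u v + w (- u) v + w u (- v) + w (- u) (- v)) =
      (\<lambda>u v. w' u v + w' (- u) v + w' u (- v) + w' (- u) (- v))"
    by (intro ext assms(3))
  then have "4 * lattice_sum a b w z = 4 * lattice_sum a b w' z"
    using lattice_sum_symmetrize[OF assms(1)] lattice_sum_symmetrize[OF assms(2)] by metis
  then show ?thesis by simp
qed

text \<open>Product weights are where eta quotients enter: each factor is a one-dimensional theta
  series, accessible to the triple product.\<close>

lemma lattice_sum_times:
  assumes "\<And>u. norm (f u) \<le> K" "\<And>v. norm (g v) \<le> L"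
  shows "lattice_sum a b (\<lambda>u v. f u * g v) z = theta_sum f (z ^ a) * theta_sum g (z ^ b)"
proof -
  have *: "(\<lambda>u. norm (f u * (z ^ c) powi (u\<^sup>2))) summable_on UNIV"
    if "c > 0" "\<And>u. norm (f u) \<le> M" for c f and M :: real
  proof (rule summable_on_comparison_test)
    show "(\<lambda>u :: int. M * norm ((z ^ c) powi (u\<^sup>2))) summable_on UNIV"
      by (intro summable_on_cmult_right abs_summable_square norm_power_less_1) (use z that in auto)
  qed (use that in \<open>auto simp: norm_mult intro!: mult_right_mono\<close>)
  have "lattice_sum a b (\<lambda>u v. f u * g v) z =
      (\<Sum>\<^sub>\<infinity>(u, v)\<in>UNIV. (f u * (z ^ a) powi (u\<^sup>2)) * (g v * (z ^ b) powi (v\<^sup>2)))"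
    unfolding lattice_sum_def using z by (simp add: power_int_power power_int_add mult_ac)
  also have "\<dots> = theta_sum f (z ^ a) * theta_sum g (z ^ b)"
    unfolding theta_sum_def by (rule infsum_times[OF *[OF ab(1) assms(1)] *[OF ab(2) assms(2)]])
  finally show ?thesis .
qed

text \<open>The exponent is homogeneous of degree 2, so z^4 in place of z doubles u and v. This puts
  theta series at q^2 on the same lattice as those at q, as a condition on even pairs.\<close>

lemma lattice_sum_scale:
  "lattice_sum a b (\<lambda>u v. of_bool (P u v)) (z ^ 4) =
    lattice_sum a b (\<lambda>u v. of_bool (even u \<and> even v \<and> P (u div 2) (v div 2))) z"
proof -
  let ?h = "\<lambda>(u, v). of_bool (even u \<and> even v \<and> P (u div 2) (v div 2)) * z powi (int a * u\<^sup>2 +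
    int b * v\<^sup>2)"
  have "lattice_sum a b (\<lambda>u v. of_bool (P u v)) (z ^ 4) = infsum ?h {(u, v). even u \<and> even v}"
    unfolding lattice_sum_def
  proof (rule infsum_reindex_bij_witness[of _ "\<lambda>(u, v). (u div 2, v div 2)" "\<lambda>(u, v). (2 * u,
    2 * v)"])
    fix p :: "int \<times> int"
    obtain u v where p: "p = (u, v)" by (cases p)
    have "int 4 * (int a * u\<^sup>2 + int b * v\<^sup>2) = int a * (2 * u)\<^sup>2 + int b * (2 * v)\<^sup>2"
      by (simp add: power2_eq_square algebra_simps)
    then have "(z ^ 4) powi (int a * u\<^sup>2 + int b * v\<^sup>2) =
      z powi (int a * (2 * u)\<^sup>2 + int b * (2 * v)\<^sup>2)"
      by (simp only: power_int_power)
    then show "?h (case p of (u, v) \<Rightarrow> (2 * u, 2 * v)) =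
        (case p of (u, v) \<Rightarrow> of_bool (P u v) * (z ^ 4) powi (int a * u\<^sup>2 + int b * v\<^sup>2))"
      by (simp only: p split) simp
  qed auto
  also have "\<dots> = infsum ?h UNIV"
    by (rule infsum_cong_neutral) auto
  finally show ?thesis unfolding lattice_sum_def .
qed

end

section \<open>Binary quadratic forms as diagonal lattice sums\<close>

lemma bij_betw_pairsI:
  fixes f g :: "int \<Rightarrow> int \<Rightarrow> int"
  assumes P: "\<And>n m. P (f n m) (g n m)"
    and inj: "\<And>n m n' m'. f n m = f n' m' \<Longrightarrow> g n m = g n' m' \<Longrightarrow> n = n' \<and> m = m'"
    and surj: "\<And>u v. P u v \<Longrightarrow> \<exists>n m. u = f n m \<and> v = g n m"
  shows "bij_betw (\<lambda>(n, m). (f n m, g n m)) UNIV {(u, v). P u v}"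
proof (rule bij_betwI')
  fix p p' :: "int \<times> int"
  show "((\<lambda>(n, m). (f n m, g n m)) p = (\<lambda>(n, m). (f n m, g n m)) p') = (p = p')"
    using inj[of "fst p" "snd p" "fst p'" "snd p'"] by (auto simp: case_prod_unfold prod_eq_iff)
next
  fix p :: "int \<times> int"
  show "(\<lambda>(n, m). (f n m, g n m)) p \<in> {(u, v). P u v}"
    using P by (cases p) auto
next
  fix p :: "int \<times> int"
  assume "p \<in> {(u, v). P u v}"
  then obtain n m where "p = (f n m, g n m)"
    using surj by (cases p) blast
  then show "\<exists>x\<in>UNIV. p = (\<lambda>(n, m). (f n m, g n m)) x"
    by (intro bexI[of _ "(n, m)"]) auto
qed

text \<open>The multiplier k clears the denominators of completing the square; it is 4 or 8 for all
  forms below. Evaluating at \<open>z ^ k\<close> avoids fractional powers of the argument.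
  \<open>P\<close> describes the image of the substitution.\<close>

lemma qform_eq_lattice_sum:
  fixes f g :: "int \<Rightarrow> int \<Rightarrow> int"
  assumes form: "\<And>n m. int k * (A * n\<^sup>2 + B * n * m + C * m\<^sup>2) =
    int a * (f n m)\<^sup>2 + int b * (g n m)\<^sup>2"
    and P: "\<And>n m. P (f n m) (g n m)"
    and inj: "\<And>n m n' m'. f n m = f n' m' \<Longrightarrow> g n m = g n' m' \<Longrightarrow> n = n' \<and> m = m'"
    and surj: "\<And>u v. P u v \<Longrightarrow> \<exists>n m. u = f n m \<and> v = g n m"
  shows "qform A B C (z ^ k) = lattice_sum a b (\<lambda>u v. of_bool (P u v)) z"
proof -
  let ?h = "\<lambda>(u, v). of_bool (P u v) * z powi (int a * u\<^sup>2 + int b * v\<^sup>2)"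
  have bij: "bij_betw (\<lambda>(n, m). (f n m, g n m)) UNIV {(u, v). P u v}"
    using P inj surj by (rule bij_betw_pairsI)
  have "qform A B C (z ^ k) = infsum (\<lambda>p. ?h (case p of (n, m) \<Rightarrow> (f n m, g n m))) UNIV"
    unfolding qform_def by (rule infsum_cong) (auto simp: power_int_power form P)
  also have "\<dots> = infsum ?h {(u, v). P u v}"
    by (rule infsum_reindex_bij_betw[OF bij])
  also have "\<dots> = infsum ?h UNIV"
    by (rule infsum_cong_neutral) auto
  finally show ?thesis unfolding lattice_sum_def .
qed

lemma parity_eq_dvd: "(even u = even v) \<longleftrightarrow> 2 dvd u - (v :: int)"
  by auto

lemmas congruence_simps = mod_eq_dvd_iff dvd_eq_mod_eq_0[symmetric] parity_eq_dvd

lemma qform_1_1_10_eq_lattice_sum_1_39: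
  "qform 1 1 10 (z ^ 4) = lattice_sum 1 39 (\<lambda>u v. of_bool (even u = even v)) z"
proof (rule qform_eq_lattice_sum[where f = "\<lambda>n m. 2 * n + m" and g = "\<lambda>n m. m"])
  fix u v :: int
  assume "even u = even v"
  then obtain a where "u - v = 2 * a"
    unfolding congruence_simps unfolding dvd_def by auto
  then show "\<exists>n m. u = 2 * n + m \<and> v = m"
    by (intro exI[of _ "a"] exI[of _ "v"]) auto
qed (simp add: power2_eq_square algebra_simps, unfold congruence_simps, presburger, linarith)

lemma qform_2_1_5_eq_lattice_sum_1_39:
  "qform 2 1 5 (z ^ 8) = lattice_sum 1 39 (\<lambda>u v. of_bool (u mod 4 = v mod 4)) z"
proof (rule qform_eq_lattice_sum[where f = "\<lambda>n m. 4 * n + m" and g = "\<lambda>n m. m"])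
  fix u v :: int
  assume "u mod 4 = v mod 4"
  then obtain a where "u - v = 4 * a"
    unfolding congruence_simps unfolding dvd_def by auto
  then show "\<exists>n m. u = 4 * n + m \<and> v = m"
    by (intro exI[of _ "a"] exI[of _ "v"]) auto
qed (simp add: power2_eq_square algebra_simps, unfold congruence_simps, presburger, linarith)

lemma qform_3_3_4_eq_lattice_sum_3_13:
  "qform 3 3 4 (z ^ 4) = lattice_sum 3 13 (\<lambda>u v. of_bool (even u = even v)) z"
proof (rule qform_eq_lattice_sum[where f = "\<lambda>n m. 2 * n + m" and g = "\<lambda>n m. m"])
  fix u v :: int
  assume "even u = even v"
  then obtain a where "u - v = 2 * a"
    unfolding congruence_simps unfolding dvd_def by auto
  then show "\<exists>n m. u = 2 * n + m \<and> v = m"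
    by (intro exI[of _ "a"] exI[of _ "v"]) auto
qed (simp add: power2_eq_square algebra_simps, unfold congruence_simps, presburger, linarith)

text \<open>A bridge between the two lattices: 8 (2n^2 + nm + 5m^2) equals (4n + m)^2 + 39 m^2 and
  also 3 (3m - n)^2 + 13 (n + m)^2. So the series (2,1,5) can be eliminated between relations for
  u^2 + 39 v^2 and relations for 3 u^2 + 13 v^2.\<close>

lemma qform_2_1_5_eq_lattice_sum_3_13:
  "qform 2 1 5 (z ^ 8) = lattice_sum 3 13 (\<lambda>u v. of_bool (u mod 4 = v mod 4)) z"
proof (rule qform_eq_lattice_sum[where f = "\<lambda>n m. 3 * m - n" and g = "\<lambda>n m. -n - m"])
  fix u v :: int
  assume "u mod 4 = v mod 4"
  then obtain a where "u - v = 4 * a"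
    unfolding congruence_simps unfolding dvd_def by auto
  then show "\<exists>n m. u = 3 * m - n \<and> v = -n - m"
    by (intro exI[of _ "- v - a"] exI[of _ "a"]) auto
qed (simp add: power2_eq_square algebra_simps, unfold congruence_simps, presburger, linarith)

lemma qform_2_1_44_eq_lattice_sum_1_39:
  "qform 2 1 44 (z ^ 8) = lattice_sum 1 39 (\<lambda>u v. of_bool (u mod 4 = v mod 4 \<and> v mod 3 = 0)) z"
proof (rule qform_eq_lattice_sum[where f = "\<lambda>n m. 4 * n + m" and g = "\<lambda>n m. -3 * m"])
  fix u v :: int
  assume "u mod 4 = v mod 4 \<and> v mod 3 = 0"
  then obtain a b where "u - v = 4 * a" and "v = 3 * b"
    unfolding congruence_simps unfolding dvd_def by auto
  then show "\<exists>n m. u = 4 * n + m \<and> v = -3 * m"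
    by (intro exI[of _ "b + a"] exI[of _ "- b"]) auto
qed (simp add: power2_eq_square algebra_simps, unfold congruence_simps, presburger, linarith)

text \<open>The forms (2,1,44), (5,3,18) and (8,1,11) are each diagonalized in both ways, because
  the duplication relation for T4 lives on u^2 + 39 v^2 and the one for T3 on 3 u^2 + 13
  v^2.\<close>

lemma qform_2_1_44_eq_lattice_sum_3_13:
  "qform 2 1 44 (z ^ 8) = lattice_sum 3 13 (\<lambda>u v. of_bool (u mod 4 = v mod 4 \<and> u mod 3 = v mod 3))
    z"
proof (rule qform_eq_lattice_sum[where f = "\<lambda>n m. n + 10 * m" and g = "\<lambda>n m. n - 2 * m"])
  fix u v :: int
  assume "u mod 4 = v mod 4 \<and> u mod 3 = v mod 3"
  then obtain a b where "u - v = 4 * a" and "u - v = 3 * b"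
    unfolding congruence_simps unfolding dvd_def by auto
  then show "\<exists>n m. u = n + 10 * m \<and> v = n - 2 * m"
    by (intro exI[of _ "v + 2 * (b - a)"] exI[of _ "b - a"]) auto
qed (simp add: power2_eq_square algebra_simps, unfold congruence_simps, presburger, linarith)

lemma qform_5_3_18_eq_lattice_sum_1_39:
  "qform 5 3 18 (z ^ 8) = lattice_sum 1 39 (\<lambda>u v. of_bool (u mod 4 = v mod 4 \<and> u mod 3 = v mod 3))
    z"
proof (rule qform_eq_lattice_sum[where f = "\<lambda>n m. n + 12 * m" and g = "\<lambda>n m. n"])
  fix u v :: int
  assume "u mod 4 = v mod 4 \<and> u mod 3 = v mod 3"
  then obtain a b where "u - v = 4 * a" and "u - v = 3 * b"
    unfolding congruence_simps unfolding dvd_def by auto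
  then show "\<exists>n m. u = n + 12 * m \<and> v = n"
    by (intro exI[of _ "v"] exI[of _ "b - a"]) auto
qed (simp add: power2_eq_square algebra_simps, unfold congruence_simps, presburger, linarith)

lemma qform_5_3_18_eq_lattice_sum_3_13:
  "qform 5 3 18 (z ^ 8) = lattice_sum 3 13 (\<lambda>u v. of_bool (u mod 4 = v mod 4 \<and> u mod 3 = 0)) z"
proof (rule qform_eq_lattice_sum[where f = "\<lambda>n m. 3 * m - 3 * n" and g = "\<lambda>n m. n + 3 * m"])
  fix u v :: int
  assume "u mod 4 = v mod 4 \<and> u mod 3 = 0"
  then obtain a b where "u - v = 4 * a" and "u = 3 * b"
    unfolding congruence_simps unfolding dvd_def by auto
  then show "\<exists>n m. u = 3 * m - 3 * n \<and> v = n + 3 * m"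
    by (intro exI[of _ "- a"] exI[of _ "b - a"]) auto
qed (simp add: power2_eq_square algebra_simps, unfold congruence_simps, presburger, linarith)

lemma qform_8_1_11_eq_lattice_sum_1_39:
  "qform 8 1 11 (z ^ 8) = lattice_sum 1 39 (\<lambda>u v. of_bool (u mod 4 = v mod 4 \<and> u mod 3 = (- v) mod
    3)) z"
proof (rule qform_eq_lattice_sum[where f = "\<lambda>n m. 5 * n - 7 * m" and g = "\<lambda>n m. n + m"])
  fix u v :: int
  assume "u mod 4 = v mod 4 \<and> u mod 3 = (- v) mod 3"
  then obtain a b where "u - v = 4 * a" and "u + v = 3 * b"
    unfolding congruence_simps unfolding dvd_def by auto
  then show "\<exists>n m. u = 5 * n - 7 * m \<and> v = n + m"
    by (intro exI[of _ "2 * v + 3 * a - 2 * b"] exI[of _ "v + a - b"]) auto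
qed (simp add: power2_eq_square algebra_simps, unfold congruence_simps, presburger, linarith)

lemma qform_8_1_11_eq_lattice_sum_3_13:
  "qform 8 1 11 (z ^ 8) = lattice_sum 3 13 (\<lambda>u v. of_bool (u mod 4 = v mod 4 \<and> u mod 3 = (- v) mod
    3)) z"
proof (rule qform_eq_lattice_sum[where f = "\<lambda>n m. -2 * n - 5 * m" and g = "\<lambda>n m. 2 * n - m"])
  fix u v :: int
  assume "u mod 4 = v mod 4 \<and> u mod 3 = (- v) mod 3"
  then obtain a b where "u - v = 4 * a" and "u + v = 3 * b"
    unfolding congruence_simps unfolding dvd_def by auto
  then show "\<exists>n m. u = -2 * n - 5 * m \<and> v = 2 * n - m"
    by (intro exI[of _ "v + a - b"] exI[of _ "b - v - 2 * a"]) auto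
qed (simp add: power2_eq_square algebra_simps, unfold congruence_simps, presburger, linarith)

lemma qform_1_1_88_eq_lattice_sum_1_39:
  "qform 1 1 88 (z ^ 4) = lattice_sum 1 39 (\<lambda>u v. of_bool (even u = even v \<and> v mod 3 = 0)) z"
proof (rule qform_eq_lattice_sum[where f = "\<lambda>n m. 2 * n + m" and g = "\<lambda>n m. 3 * m"])
  fix u v :: int
  assume "even u = even v \<and> v mod 3 = 0"
  then obtain a b where "u - v = 2 * a" and "v = 3 * b"
    unfolding congruence_simps unfolding dvd_def by auto
  then show "\<exists>n m. u = 2 * n + m \<and> v = 3 * m"
    by (intro exI[of _ "b + a"] exI[of _ "b"]) auto
qed (simp add: power2_eq_square algebra_simps, unfold congruence_simps, presburger, linarith)

lemma qform_9_3_10_eq_lattice_sum_1_39: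
  "qform 9 3 10 (z ^ 4) = lattice_sum 1 39 (\<lambda>u v. of_bool (even u = even v \<and> u mod 3 = v mod 3)) z"
proof (rule qform_eq_lattice_sum[where f = "\<lambda>n m. 6 * n + m" and g = "\<lambda>n m. m"])
  fix u v :: int
  assume "even u = even v \<and> u mod 3 = v mod 3"
  then obtain a b where "u - v = 2 * a" and "u - v = 3 * b"
    unfolding congruence_simps unfolding dvd_def by auto
  then show "\<exists>n m. u = 6 * n + m \<and> v = m"
    by (intro exI[of _ "a - b"] exI[of _ "v"]) auto
qed (simp add: power2_eq_square algebra_simps, unfold congruence_simps, presburger, linarith)

lemma qform_4_1_22_eq_lattice_sum_3_13:
  "qform 4 1 22 (z ^ 4) = lattice_sum 3 13 (\<lambda>u v. of_bool (even u = even v \<and> u mod 3 = v mod 3)) z"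
proof (rule qform_eq_lattice_sum[where f = "\<lambda>n m. n + 5 * m" and g = "\<lambda>n m. n - m"])
  fix u v :: int
  assume "even u = even v \<and> u mod 3 = v mod 3"
  then obtain a b where "u - v = 2 * a" and "u - v = 3 * b"
    unfolding congruence_simps unfolding dvd_def by auto
  then show "\<exists>n m. u = n + 5 * m \<and> v = n - m"
    by (intro exI[of _ "v + a - b"] exI[of _ "a - b"]) auto
qed (simp add: power2_eq_square algebra_simps, unfold congruence_simps, presburger, linarith)

lemma qform_10_7_10_eq_lattice_sum_3_13:
  "qform 10 7 10 (z ^ 4) = lattice_sum 3 13 (\<lambda>u v. of_bool (even u = even v \<and> u mod 3 = 0)) z"
proof (rule qform_eq_lattice_sum[where f = "\<lambda>n m. 3 * n + 3 * m" and g = "\<lambda>n m. n - m"])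
  fix u v :: int
  assume "even u = even v \<and> u mod 3 = 0"
  then obtain a b where "u - v = 2 * a" and "u = 3 * b"
    unfolding congruence_simps unfolding dvd_def by auto
  then show "\<exists>n m. u = 3 * n + 3 * m \<and> v = n - m"
    by (intro exI[of _ "2 * b - a"] exI[of _ "a - b"]) auto
qed (simp add: power2_eq_square algebra_simps, unfold congruence_simps, presburger, linarith)

subsection \<open>One-dimensional theta series as eta quotients\<close>

lemma qpoch_inf_E:
  assumes "norm x < 1"
  shows "qpoch_inf x (x\<^sup>2) * E (x\<^sup>2) = E x"
  using qpoch_inf_split2[OF assms, of x] unfolding E_def by (simp add: power2_eq_square)

lemma qpoch_inf_uminus_self:
  assumes "norm x < 1"
  shows "qpoch_inf (- x) x = E (x\<^sup>2) / E x"
  using qpoch_inf_mult_uminus[OF assms, of x] E_nonzero[OF assms] unfolding E_def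
  by (simp add: field_simps)

lemma qpoch_inf_uminus_odd:
  assumes x: "norm x < 1"
  shows "qpoch_inf (- x) (x\<^sup>2) = (E (x\<^sup>2))\<^sup>2 / (E x * E (x ^ 4))"
proof -
  have x2: "norm (x\<^sup>2) < 1" "norm (x ^ 4) < 1" using norm_power_less_1[OF x] by auto
  have 1: "qpoch_inf x (x\<^sup>2) * E (x\<^sup>2) = E x"
    by (rule qpoch_inf_E[OF x])
  have 2: "qpoch_inf (x\<^sup>2) (x ^ 4) * E (x ^ 4) = E (x\<^sup>2)"
    using qpoch_inf_E[OF x2(1)] by (simp flip: power_mult)
  have 3: "qpoch_inf x (x\<^sup>2) * qpoch_inf (- x) (x\<^sup>2) = qpoch_inf (x\<^sup>2) (x ^ 4)"
    using qpoch_inf_mult_uminus[OF x2(1), of x] by (simp flip: power_mult)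
  have "qpoch_inf (- x) (x\<^sup>2) * (E x * E (x ^ 4)) =
      (qpoch_inf x (x\<^sup>2) * qpoch_inf (- x) (x\<^sup>2)) * E (x ^ 4) * E (x\<^sup>2)"
    unfolding 1[symmetric] by (simp only: mult_ac)
  then have "qpoch_inf (- x) (x\<^sup>2) * (E x * E (x ^ 4)) = (E (x\<^sup>2))\<^sup>2"
    unfolding 2 3 by (simp only: power2_eq_square[of "E (x\<^sup>2)"])
  then show ?thesis
    using E_nonzero[OF x] E_nonzero[OF x2(2)] by (simp add: nonzero_eq_divide_eq)
qed

text \<open>The linear term of the exponent is absorbed into the variable -c x^b. In the
  applications c is 1, -1 or a primitive cube root of unity.\<close>

lemma jacobi_triple_product':
  assumes x: "norm x < 1" "x \<noteq> 0" and a: "a > 0" and c: "c \<noteq> 0"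
    and e: "\<And>j. e j = int a * (j * (j - 1) div 2) + int b * j"
  shows "(\<Sum>\<^sub>\<infinity>j. c powi j * x powi e j) =
    qpoch_inf (- c * x ^ b) (x ^ a) * qpoch_inf (- (x ^ a) / (c * x ^ b)) (x ^ a) * E (x ^ a)"
proof -
  have "c powi j * x powi e j = (-1) powi j * (- c * x ^ b) powi j * (x ^ a) powi (j * (j - 1) div
    2)" for j
  proof -
    have "(-1) powi j * (- c * x ^ b) powi j = c powi j * x powi (int b * j)"
      by (simp add: power_int_mult_distrib[symmetric] power_int_power[symmetric])
    then show ?thesis
      using x by (simp add: e power_int_add power_int_power)
  qed
  then show ?thesis
    using jacobi_triple_product[of "x ^ a" "- c * x ^ b"] x a c norm_power_less_1[OF x(1) a]
    by simp
qed

lemma abs_summable_theta: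
  assumes "norm z < 1" "z \<noteq> 0" "\<And>u. norm (f u) \<le> K"
  shows "(\<lambda>u :: int. f u * z powi (u\<^sup>2) :: complex) summable_on UNIV"
proof (rule abs_summable_summable, rule summable_on_comparison_test)
  show "(\<lambda>u :: int. K * norm (z powi (u\<^sup>2))) summable_on UNIV"
    by (intro summable_on_cmult_right abs_summable_square assms)
qed (use assms in \<open>auto simp: norm_mult intro!: mult_right_mono\<close>)

lemma theta_sum_mod_6:
  fixes r :: int
  assumes z: "norm z < 1" "z \<noteq> 0" and K: "\<And>u. norm (f u) \<le> K" and even: "\<And>u. f (- u) = f u"
    and r: "0 < r" "r < 3" and supp: "\<And>u. u mod 6 \<noteq> r \<Longrightarrow> u mod 6 \<noteq> 6 - r \<Longrightarrow> f u = 0"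
  shows "theta_sum f z = 2 * (\<Sum>\<^sub>\<infinity>j. f (6 * j + r) * z powi ((6 * j + r)\<^sup>2))"
proof -
  let ?h = "\<lambda>u. f u * z powi (u\<^sup>2)"
  let ?A = "{u. u mod 6 = r}" and ?B = "{u. u mod 6 = 6 - r}"
  have summ: "?h summable_on X" for X
    by (rule summable_on_subset_banach[OF abs_summable_theta[OF z K]]) auto
  have "theta_sum f z = infsum ?h (?A \<union> ?B)"
    unfolding theta_sum_def by (rule infsum_cong_neutral) (use supp in auto)
  also have "\<dots> = infsum ?h ?A + infsum ?h ?B"
    by (rule infsum_Un_disjoint) (use summ r in auto)
  also have "infsum ?h ?B = infsum ?h ?A"
    by (rule infsum_reindex_bij_witness[of _ uminus uminus])
      (use even r in \<open>auto simp: zmod_zminus1_eq_if\<close>)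
  also have "infsum ?h ?A = (\<Sum>\<^sub>\<infinity>j. ?h (6 * j + r))"
    by (rule infsum_reindex_bij_witness[of _ "\<lambda>j. 6 * j + r" "\<lambda>u. u div 6"]) (use r in auto)
  finally show ?thesis by simp
qed

lemma theta_sum_even:
  assumes "\<And>u. odd u \<Longrightarrow> f u = 0"
  shows "theta_sum f z = (\<Sum>\<^sub>\<infinity>j. f (2 * j) * z powi ((2 * j)\<^sup>2))"
proof -
  have "theta_sum f z = infsum (\<lambda>u. f u * z powi (u\<^sup>2)) {u. even u}"
    unfolding theta_sum_def by (rule infsum_cong_neutral) (use assms in auto)
  also have "\<dots> = (\<Sum>\<^sub>\<infinity>j. f (2 * j) * z powi ((2 * j)\<^sup>2))"
    by (rule infsum_reindex_bij_witness[of _ "\<lambda>j. 2 * j" "\<lambda>u. u div 2"]) auto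
  finally show ?thesis .
qed

lemma theta_sum_odd:
  assumes "\<And>u. even u \<Longrightarrow> f u = 0"
  shows "theta_sum f z = (\<Sum>\<^sub>\<infinity>j. f (2 * j + 1) * z powi ((2 * j + 1)\<^sup>2))"
proof -
  have "theta_sum f z = infsum (\<lambda>u. f u * z powi (u\<^sup>2)) {u. odd u}"
    unfolding theta_sum_def by (rule infsum_cong_neutral) (use assms in auto)
  also have "\<dots> = (\<Sum>\<^sub>\<infinity>j. f (2 * j + 1) * z powi ((2 * j + 1)\<^sup>2))"
    by (rule infsum_reindex_bij_witness[of _ "\<lambda>j. 2 * j + 1" "\<lambda>u. u div 2"]) auto
  finally show ?thesis .
qed

text \<open>The even quadratic character modulo 12, written as the product of the odd characters
  modulo 4 and 3 so that it can be evaluated from these two residues.\<close>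

definition chi12 :: "int \<Rightarrow> complex" where
  "chi12 u = (if u mod 4 = 1 then 1 else if u mod 4 = 3 then - 1 else 0) *
    (if u mod 3 = 1 then 1 else if u mod 3 = 2 then - 1 else 0)"

text \<open>This is cos(2 pi u / 3), the mean of w^u and w^(-u) for a primitive cube root of unity
  w.\<close>

definition cos3 :: "int \<Rightarrow> complex" where
  "cos3 u = (if u mod 3 = 0 then 1 else - 1 / 2)"

text \<open>On even u this is (-1)^(u/2).\<close>

definition half_sign :: "int \<Rightarrow> complex" where
  "half_sign u = (if u mod 4 = 0 then 1 else if u mod 4 = 2 then - 1 else 0)"

text \<open>Euler's pentagonal number theorem: the support is u = 6j + 1 up to sign, and (6j + 1)^2
  = 24 j(3j + 1)/2 + 1. The triple product gives residues 1 and 2 modulo 3, and E(x^3) supplies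
  residue 0.\<close>

lemma theta_sum_chi12:
  assumes z: "norm z < 1" "z \<noteq> 0"
  shows "theta_sum chi12 z = 2 * z * E (z ^ 24)"
proof -
  define x where "x = z ^ 24"
  have x: "norm x < 1" "x \<noteq> 0" "norm (x ^ 3) < 1"
    using z norm_power_less_1[OF z(1)] by (auto simp: x_def simp flip: power_mult)
  have "theta_sum chi12 z = 2 * (\<Sum>\<^sub>\<infinity>j. chi12 (6 * j + 1) * z powi ((6 * j + 1)\<^sup>2))"
  proof (rule theta_sum_mod_6[OF z, of _ 1])
    show "norm (chi12 u) \<le> 1" for u by (auto simp: chi12_def)
    show "chi12 (- u) = chi12 u" for u by (auto simp: chi12_def zmod_zminus1_eq_if)
    fix u :: int assume u: "u mod 6 \<noteq> 1" "u mod 6 \<noteq> 6 - 1"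
    have "u mod 4 \<noteq> 1 \<and> u mod 4 \<noteq> 3 \<or> u mod 3 = 0" using u by presburger
    moreover have "u mod 3 \<noteq> 1 \<and> u mod 3 \<noteq> 2" if "u mod 3 = 0" using that by simp
    ultimately show "chi12 u = 0" by (auto simp: chi12_def)
  qed auto
  also have "(\<Sum>\<^sub>\<infinity>j. chi12 (6 * j + 1) * z powi ((6 * j + 1)\<^sup>2)) =
      (\<Sum>\<^sub>\<infinity>j. z * ((-1) powi j * x powi (3 * (j * (j - 1) div 2) + 2 * j)))"
  proof (rule infsum_cong)
    fix j :: int
    have "(6 * j + 1) mod 3 = 1" by presburger
    moreover have "(6 * j + 1) mod 4 = (if even j then 1 else 3)" by presburger
    ultimately have 1: "chi12 (6 * j + 1) = (-1) powi j" by (simp add: chi12_def neg_one_powi)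
    have "24 * (3 * t + 2 * j) + 1 = (6 * j + 1)\<^sup>2" if "2 * t = j * (j - 1)" for t
      using that by (simp add: power2_eq_square algebra_simps)
    from this[OF triangular_int] have sq: "(6 * j + 1)\<^sup>2 =
      int 24 * (3 * (j * (j - 1) div 2) + 2 * j) + 1"
      by simp
    have "z powi ((6 * j + 1)\<^sup>2) = z powi (int 24 * (3 * (j * (j - 1) div 2) + 2 * j)) * z"
      unfolding sq by (rule power_int_add_1) (use z in simp)
    then have "z powi ((6 * j + 1)\<^sup>2) = x powi (3 * (j * (j - 1) div 2) + 2 * j) * z"
      unfolding x_def power_int_power .
    then show "chi12 (6 * j + 1) * z powi ((6 * j + 1)\<^sup>2) =
        z * ((-1) powi j * x powi (3 * (j * (j - 1) div 2) + 2 * j))"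
      unfolding 1 by simp
  qed
  also have "\<dots> = z * (\<Sum>\<^sub>\<infinity>j. (-1) powi j * x powi (3 * (j * (j - 1) div 2) + 2 * j))"
    by (rule infsum_cmult_right')
  also have "(\<Sum>\<^sub>\<infinity>j. (-1) powi j * x powi (3 * (j * (j - 1) div 2) + 2 * j)) =
      qpoch_inf (x\<^sup>2) (x ^ 3) * qpoch_inf x (x ^ 3) * E (x ^ 3)"
    using jacobi_triple_product'[OF x(1,2), of 3 "-1" "\<lambda>j. 3 * (j * (j - 1) div 2) + 2 * j" 2] x(2)
    by (simp add: power2_eq_square power3_eq_cube)
  also have "\<dots> = E x"
    using qpoch_inf_split3[OF x(1), of x] unfolding E_def
    by (simp add: power2_eq_square power3_eq_cube mult_ac)
  finally show ?thesis unfolding x_def by simp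
qed

text \<open>The four quotients A, B, C, D are the product forms of the sums over j of x^(3j^2+2j),
  of cos3(j) x^(j^2), of x^(3j^2+j) and of -cos3(2j+1) x^(j^2+j).\<close>

definition eta_A :: "complex \<Rightarrow> complex" where
  "eta_A x = (E (x\<^sup>2))\<^sup>2 * E (x ^ 3) * E (x ^ 12) / (E x * E (x ^ 4) * E (x ^ 6))"

definition eta_B :: "complex \<Rightarrow> complex" where
  "eta_B x = E x * E (x ^ 4) * (E (x ^ 6))\<^sup>2 / (E (x\<^sup>2) * E (x ^ 3) * E (x ^ 12))"

definition eta_C :: "complex \<Rightarrow> complex" where
  "eta_C x = E (x ^ 4) * (E (x ^ 6))\<^sup>2 / (E (x\<^sup>2) * E (x ^ 12))"

definition eta_D :: "complex \<Rightarrow> complex" where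
  "eta_D x = (E (x\<^sup>2))\<^sup>2 * E (x ^ 12) / (E (x ^ 4) * E (x ^ 6))"

context
  fixes x :: complex
  assumes x: "norm x < 1" "x \<noteq> 0"
begin

lemma E_power_nonzero: "n > 0 \<Longrightarrow> E (x ^ n) \<noteq> 0"
  using E_nonzero norm_power_less_1 x(1) by blast

lemmas E_powers_nonzero = E_power_nonzero[of 1] E_power_nonzero[of 2] E_power_nonzero[of 3]
  E_power_nonzero[of 4] E_power_nonzero[of 6] E_power_nonzero[of 12]

lemma qpoch_inf_uminus_odd_3: "qpoch_inf (- (x ^ 3)) (x ^ 6) =
  (E (x ^ 6))\<^sup>2 / (E (x ^ 3) * E (x ^ 12))"
  using qpoch_inf_uminus_odd[of "x ^ 3"] norm_power_less_1[OF x(1), of 3] by (simp flip: power_mult)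

lemma qpoch_inf_uminus_even: "n > 0 \<Longrightarrow> qpoch_inf (- (x ^ n)) (x ^ n) = E (x ^ (2 * n)) / E (x ^ n)"
  using qpoch_inf_uminus_self[of "x ^ n"] norm_power_less_1[OF x(1), of n]
  by (simp add: mult.commute flip: power_mult)

lemma infsum_eta_A: "(\<Sum>\<^sub>\<infinity>j. x powi (3 * j\<^sup>2 + 2 * j)) = eta_A x"
proof -
  have e: "3 * j\<^sup>2 + 2 * j = int 6 * (j * (j - 1) div 2) + int 5 * j" for j
    using square_exponent[of j] by simp
  have "(\<Sum>\<^sub>\<infinity>j. 1 powi j * x powi (3 * j\<^sup>2 + 2 * j)) =
      qpoch_inf (- 1 * x ^ 5) (x ^ 6) * qpoch_inf (- (x ^ 6) / (1 * x ^ 5)) (x ^ 6) * E (x ^ 6)"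
    by (rule jacobi_triple_product'[OF x _ _ e]) auto
  moreover have "- (x ^ 6) / (1 * x ^ 5) = - x"
    using x(2) by (simp add: eval_nat_numeral)
  \<comment> \<open>Odd exponents by residue modulo 6: the triple product supplies 1 and 5, so
    residue 3 has to be divided out of the full product.\<close>
  moreover have "qpoch_inf (- x) (x\<^sup>2) = qpoch_inf (- x) (x ^ 6) * qpoch_inf (- (x ^ 3)) (x ^ 6) *
    qpoch_inf (- (x ^ 5)) (x ^ 6)"
    using qpoch_inf_split3[of "x\<^sup>2" "- x"] norm_power_less_1[OF x(1), of 2]
    by (simp add: eval_nat_numeral mult_ac)
  ultimately show ?thesis
    using E_powers_nonzero
    unfolding eta_A_def qpoch_inf_uminus_odd[OF x(1)] qpoch_inf_uminus_odd_3
    by (simp add: field_simps power2_eq_square)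
qed

lemma infsum_eta_C: "(\<Sum>\<^sub>\<infinity>j. x powi (3 * j\<^sup>2 + j)) = eta_C x"
proof -
  have e: "3 * j\<^sup>2 + j = int 6 * (j * (j - 1) div 2) + int 4 * j" for j
    using square_exponent[of j] by simp
  have "(\<Sum>\<^sub>\<infinity>j. 1 powi j * x powi (3 * j\<^sup>2 + j)) =
      qpoch_inf (- 1 * x ^ 4) (x ^ 6) * qpoch_inf (- (x ^ 6) / (1 * x ^ 4)) (x ^ 6) * E (x ^ 6)"
    by (rule jacobi_triple_product'[OF x _ _ e]) auto
  also have "- (x ^ 6) / (1 * x ^ 4) = - (x\<^sup>2)"
    using x(2) by (simp add: eval_nat_numeral)
  finally have 1: "(\<Sum>\<^sub>\<infinity>j. x powi (3 * j\<^sup>2 + j)) =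
      qpoch_inf (- (x ^ 4)) (x ^ 6) * qpoch_inf (- (x\<^sup>2)) (x ^ 6) * E (x ^ 6)"
    by simp
  have 2: "qpoch_inf (- (x\<^sup>2)) (x\<^sup>2) = qpoch_inf (- (x\<^sup>2)) (x ^ 6) * qpoch_inf (- (x ^ 4)) (x ^ 6) *
    qpoch_inf (- (x ^ 6)) (x ^ 6)"
    using qpoch_inf_split3[of "x\<^sup>2" "- (x\<^sup>2)"] norm_power_less_1[OF x(1), of 2]
    by (simp add: eval_nat_numeral mult_ac)
  have 3: "qpoch_inf (- (x\<^sup>2)) (x\<^sup>2) * E (x\<^sup>2) = E (x ^ 4)"
    "qpoch_inf (- (x ^ 6)) (x ^ 6) * E (x ^ 6) = E (x ^ 12)"
    using E_power_nonzero[of 2] E_power_nonzero[of 6] qpoch_inf_uminus_even[of 2]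
      qpoch_inf_uminus_even[of 6]
    by simp_all
  have "(\<Sum>\<^sub>\<infinity>j. x powi (3 * j\<^sup>2 + j)) * (E (x\<^sup>2) * E (x ^ 12)) =
      (qpoch_inf (- (x\<^sup>2)) (x\<^sup>2) * E (x\<^sup>2)) * (E (x ^ 6))\<^sup>2"
    unfolding 1 2 3(2)[symmetric] by (simp only: mult_ac power2_eq_square)
  then have "(\<Sum>\<^sub>\<infinity>j. x powi (3 * j\<^sup>2 + j)) * (E (x\<^sup>2) * E (x ^ 12)) =
      E (x ^ 4) * (E (x ^ 6))\<^sup>2"
    unfolding 3 .
  then show ?thesis
    using E_power_nonzero[of 2] E_power_nonzero[of 12] unfolding eta_C_def
    by (simp add: nonzero_eq_divide_eq)
qed

end

lemma mod3_cases: "k mod 3 = 0 \<or> k mod 3 = 1 \<or> k mod 3 = (2 :: int)"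
  by presburger

lemma cube_root_unity:
  obtains w :: complex where "w\<^sup>2 + w + 1 = 0" "w \<noteq> 0" "w ^ 3 = 1"
    "\<And>k. w powi k + w powi (- k) = 2 * cos3 k"
proof -
  define w where "w = Complex (- 1 / 2) (sqrt 3 / 2)"
  have w: "w\<^sup>2 + w + 1 = 0"
    by (simp add: w_def power2_eq_square complex_eq_iff)
  then have w3: "w ^ 3 = 1"
    by algebra
  have w0: "w \<noteq> 0"
    by (simp add: w_def complex_eq_iff)
  have "w powi k = w ^ nat (k mod 3)" for k
  proof -
    have "w powi k = w powi (int 3 * (k div 3) + k mod 3)" by simp
    also have "\<dots> = w powi (k mod 3)"
    proof -
      have "w powi (int 3 * (k div 3)) = 1"
        unfolding power_int_power[symmetric] w3 by simp
      then show ?thesis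
        by (simp only: power_int_add[OF disjI1[OF w0]] mult_1_left)
    qed
    finally show ?thesis by (simp add: power_int_def)
  qed
  note p = this
  have iw: "w + w ^ 2 = - 1" using w by algebra
  have "w powi k + w powi (- k) = 2 * cos3 k" for k
  proof -
    consider "k mod 3 = 0" | "k mod 3 = 1" | "k mod 3 = 2" 
      using mod3_cases by blast
    then show ?thesis
      by cases (use iw in \<open>simp_all add: p cos3_def zmod_zminus1_eq_if add.commute\<close>)
  qed
  with that w w0 w3 show ?thesis by blast
qed

context
  fixes x :: complex
  assumes x: "norm x < 1" "x \<noteq> 0"
begin

text \<open>The reflection j -> c - j exchanges w^l and w^(-l) and fixes the exponent, so both
  halves of the cosine have the same sum. A single power of w remains, as the triple product
  requires.\<close>

lemma infsum_cos3:
  fixes l e :: "int \<Rightarrow> int"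
  assumes w: "norm w = 1" "\<And>k. w powi k + w powi (- k) = 2 * cos3 k"
    and refl: "\<And>j. l (c - j) = - l j" "\<And>j. e (c - j) = e j"
    and summ: "(\<lambda>j. norm (x powi e j)) summable_on UNIV"
  shows "(\<Sum>\<^sub>\<infinity>j. cos3 (l j) * x powi e j) = (\<Sum>\<^sub>\<infinity>j. w powi l j * x powi e j)"
proof -
  have summ': "(\<lambda>j. w powi k j * x powi e j) summable_on UNIV" for k
    by (rule abs_summable_summable) (use summ in \<open>simp add: norm_mult norm_power_int w(1)\<close>)
  have "(\<Sum>\<^sub>\<infinity>j. w powi (- l j) * x powi e j) = (\<Sum>\<^sub>\<infinity>j. w powi l j * x powi e j)"
    using infsum_reflect_int[of "\<lambda>j. w powi l j * x powi e j" c] by (simp add: refl)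
  moreover have "2 * (\<Sum>\<^sub>\<infinity>j. cos3 (l j) * x powi e j) =
      (\<Sum>\<^sub>\<infinity>j. w powi l j * x powi e j + w powi (- l j) * x powi e j)"
    unfolding infsum_cmult_right'[symmetric] distrib_right[symmetric] w(2) by (simp add: mult.assoc)
  ultimately show ?thesis
    using infsum_add[OF summ'[of l] summ'[of "\<lambda>j. - l j"]] by simp
qed

lemma infsum_eta_B: "(\<Sum>\<^sub>\<infinity>j. cos3 j * x powi (j\<^sup>2)) = eta_B x"
proof -
  obtain w where w: "w\<^sup>2 + w + 1 = 0" "w \<noteq> 0" "w ^ 3 = 1"
    "\<And>k. w powi k + w powi (- k) = 2 * cos3 k"
    using cube_root_unity by blast
  have e: "j\<^sup>2 = int 2 * (j * (j - 1) div 2) + int 1 * j" for j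
    using square_exponent[of j] by simp
  have norm_w: "norm w = 1"
    using w(3) by (metis norm_one norm_power norm_ge_zero power_eq_1_iff zero_neq_numeral)
  have "(\<Sum>\<^sub>\<infinity>j. cos3 j * x powi (j\<^sup>2)) = (\<Sum>\<^sub>\<infinity>j. w powi j * x powi (j\<^sup>2))"
    by (rule infsum_cos3[OF norm_w w(4), where c = 0]) (use abs_summable_square[OF x] in auto)
  also have "\<dots> = qpoch_inf (- w * x ^ 1) (x\<^sup>2) * qpoch_inf (- x\<^sup>2 / (w * x ^ 1)) (x\<^sup>2) * E (x\<^sup>2)"
    by (rule jacobi_triple_product'[OF x _ _ e]) (use w in auto)
  also have "- x\<^sup>2 / (w * x ^ 1) = w\<^sup>2 * (- x)"
    using w(2,3) x(2) by (simp add: field_simps power2_eq_square power3_eq_cube)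
  finally have 1: "(\<Sum>\<^sub>\<infinity>j. cos3 j * x powi (j\<^sup>2)) =
      qpoch_inf (w * (- x)) (x\<^sup>2) * qpoch_inf (w\<^sup>2 * (- x)) (x\<^sup>2) * E (x\<^sup>2)"
    by simp
  \<comment> \<open>The triple product yields the factors twisted by w and w^2; the cubic identity
    recovers their product from the untwisted third factor.\<close>
  have "qpoch_inf (- x) (x\<^sup>2) * qpoch_inf (w * (- x)) (x\<^sup>2) * qpoch_inf (w\<^sup>2 * (- x)) (x\<^sup>2) =
    qpoch_inf (- (x ^ 3)) (x ^ 6)"
    using qpoch_inf_cubic[of "x\<^sup>2" w "- x"] w(1) norm_power_less_1[OF x(1), of 2]
      by (simp flip: power_mult)
  then show ?thesis
    unfolding 1 eta_B_def qpoch_inf_uminus_odd[OF x(1)] qpoch_inf_uminus_odd_3[OF x]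
    using E_powers_nonzero[OF x]
    by (simp add: field_simps power2_eq_square)
qed

lemma infsum_eta_D: "(\<Sum>\<^sub>\<infinity>j. cos3 (2 * j + 1) * x powi (j\<^sup>2 + j)) = - eta_D x"
proof -
  obtain w where w: "w\<^sup>2 + w + 1 = 0" "w \<noteq> 0" "w ^ 3 = 1"
    "\<And>k. w powi k + w powi (- k) = 2 * cos3 k"
    using cube_root_unity by blast
  have e: "j\<^sup>2 + j = int 2 * (j * (j - 1) div 2) + int 2 * j" for j
    using square_exponent[of j] by simp
  have norm_w: "norm w = 1"
    using w(3) by (metis norm_one norm_power norm_ge_zero power_eq_1_iff zero_neq_numeral)
  have "(\<Sum>\<^sub>\<infinity>j. cos3 (2 * j + 1) * x powi (j\<^sup>2 + j)) =
      (\<Sum>\<^sub>\<infinity>j. w powi (2 * j + 1) * x powi (j\<^sup>2 + j))"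
  proof (rule infsum_cos3[OF norm_w w(4), where c = "- 1"])
    show "(\<lambda>j. norm (x powi (j\<^sup>2 + j))) summable_on UNIV"
      by (rule abs_summable_quadratic[OF x, where a = 2 and b = 2]) (simp_all add: e)
  qed (auto simp: power2_eq_square algebra_simps)
  also have "\<dots> = (\<Sum>\<^sub>\<infinity>j. w * ((w\<^sup>2) powi j * x powi (j\<^sup>2 + j)))"
    using w(2) by (simp add: power_int_add power_int_power mult_ac)
  also have "\<dots> = w * (\<Sum>\<^sub>\<infinity>j. (w\<^sup>2) powi j * x powi (j\<^sup>2 + j))"
    by (rule infsum_cmult_right')
  also have "(\<Sum>\<^sub>\<infinity>j. (w\<^sup>2) powi j * x powi (j\<^sup>2 + j)) =
      qpoch_inf (- w\<^sup>2 * x\<^sup>2) (x\<^sup>2) * qpoch_inf (- x\<^sup>2 / (w\<^sup>2 * x\<^sup>2)) (x\<^sup>2) * E (x\<^sup>2)"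
    by (rule jacobi_triple_product'[OF x _ _ e]) (use w in auto)
  also have "- x\<^sup>2 / (w\<^sup>2 * x\<^sup>2) = - w"
    using w(2,3) x(2) by (simp add: field_simps power2_eq_square power3_eq_cube)
  \<comment> \<open>The product starts one step too early, at -w instead of -w x^2. Its first factor
    1 + w joins the outer w, and w (1 + w) = -1 is the sign in front of
    \<open>eta_D\<close>.\<close>
  also have "qpoch_inf (- w) (x\<^sup>2) = (1 + w) * qpoch_inf (w * (- (x\<^sup>2))) (x\<^sup>2)"
  proof (rule LIMSEQ_unique)
    have x2: "norm (x\<^sup>2) < 1" using norm_power_less_1[OF x(1)] by simp
    show "(\<lambda>n. qpoch (- w) (x\<^sup>2) (Suc n)) \<longlonglongrightarrow> qpoch_inf (- w) (x\<^sup>2)"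
      by (rule LIMSEQ_Suc[OF qpoch_tendsto[OF x2]])
    have "qpoch (- w) (x\<^sup>2) (Suc n) = (1 + w) * qpoch (w * (- (x\<^sup>2))) (x\<^sup>2) n" for n
      using qpoch_add[of "- w" "x\<^sup>2" 1 n] by (simp add: qpoch_def)
    then show "(\<lambda>n. qpoch (- w) (x\<^sup>2) (Suc n)) \<longlonglongrightarrow> (1 + w) * qpoch_inf (w * (- (x\<^sup>2))) (x\<^sup>2)"
      by (simp only:) (intro tendsto_mult tendsto_const qpoch_tendsto x2)
  qed
  finally have 1: "(\<Sum>\<^sub>\<infinity>j. cos3 (2 * j + 1) * x powi (j\<^sup>2 + j)) =
      (w * (1 + w)) * (qpoch_inf (w * (- (x\<^sup>2))) (x\<^sup>2) * qpoch_inf (w\<^sup>2 * (- (x\<^sup>2))) (x\<^sup>2)) * E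
        (x\<^sup>2)"
    by (simp add: mult_ac)
  have 2: "w * (1 + w) = - 1" using w(1) by algebra
  have "qpoch_inf (- (x\<^sup>2)) (x\<^sup>2) * qpoch_inf (w * (- (x\<^sup>2))) (x\<^sup>2) * qpoch_inf (w\<^sup>2 * (- (x\<^sup>2)))
    (x\<^sup>2) = qpoch_inf (- (x ^ 6)) (x ^ 6)"
    using qpoch_inf_cubic[of "x\<^sup>2" w "- (x\<^sup>2)"] w(1) norm_power_less_1[OF x(1), of 2]
      by (simp flip: power_mult)
  then have "(E (x ^ 4) / E (x\<^sup>2)) * (qpoch_inf (w * (- (x\<^sup>2))) (x\<^sup>2) * qpoch_inf (w\<^sup>2 * (- (x\<^sup>2)))
    (x\<^sup>2)) =
      E (x ^ 12) / E (x ^ 6)"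
    using qpoch_inf_uminus_even[OF x, of 2] qpoch_inf_uminus_even[OF x, of 6]
      by (simp add: mult.assoc)
  then show ?thesis
    unfolding 1 2 eta_D_def
    using E_powers_nonzero[OF x]
    by (simp add: field_simps power2_eq_square)
qed

lemma infsum_alternating_square: "(\<Sum>\<^sub>\<infinity>j. (-1) powi j * x powi (j\<^sup>2)) = (E x)\<^sup>2 / E (x\<^sup>2)"
proof -
  have e: "j\<^sup>2 = int 2 * (j * (j - 1) div 2) + int 1 * j" for j
    using square_exponent[of j] by simp
  have "(\<Sum>\<^sub>\<infinity>j. (-1) powi j * x powi (j\<^sup>2)) =
      qpoch_inf (- (-1) * x ^ 1) (x\<^sup>2) * qpoch_inf (- x\<^sup>2 / ((-1) * x ^ 1)) (x\<^sup>2) * E (x\<^sup>2)"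
    by (rule jacobi_triple_product'[OF x _ _ e]) auto
  moreover have "- x\<^sup>2 / ((-1) * x ^ 1) = x"
    using x(2) by (simp add: power2_eq_square)
  ultimately have "(\<Sum>\<^sub>\<infinity>j. (-1) powi j * x powi (j\<^sup>2)) * E (x\<^sup>2) = (E x)\<^sup>2"
    unfolding qpoch_inf_E[OF x(1), symmetric] by (simp add: power2_eq_square mult_ac)
  then show ?thesis
    using E_power_nonzero[OF x, of 2] by (simp add: nonzero_eq_divide_eq)
qed

lemma infsum_triangular: "(\<Sum>\<^sub>\<infinity>j. x powi (j\<^sup>2 + j)) = 2 * (E (x ^ 4))\<^sup>2 / E (x\<^sup>2)"
proof -
  have x2: "norm (x\<^sup>2) < 1" using norm_power_less_1[OF x(1)] by simp
  have e: "j\<^sup>2 + j = int 2 * (j * (j - 1) div 2) + int 2 * j" for j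
    using square_exponent[of j] by simp
  have "(\<Sum>\<^sub>\<infinity>j. 1 powi j * x powi (j\<^sup>2 + j)) =
      qpoch_inf (- 1 * x\<^sup>2) (x\<^sup>2) * qpoch_inf (- x\<^sup>2 / (1 * x\<^sup>2)) (x\<^sup>2) * E (x\<^sup>2)"
    by (rule jacobi_triple_product'[OF x _ _ e]) auto
  moreover have "- x\<^sup>2 / (1 * x\<^sup>2) = - 1"
    using x(2) by simp
  moreover have "qpoch_inf (- 1) (x\<^sup>2) = 2 * qpoch_inf (- (x\<^sup>2)) (x\<^sup>2)"
  proof (rule LIMSEQ_unique)
    show "(\<lambda>n. qpoch (- 1) (x\<^sup>2) (Suc n)) \<longlonglongrightarrow> qpoch_inf (- 1) (x\<^sup>2)"
      by (rule LIMSEQ_Suc[OF qpoch_tendsto[OF x2]])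
    have "qpoch (- 1) (x\<^sup>2) (Suc n) = 2 * qpoch (- (x\<^sup>2)) (x\<^sup>2) n" for n
      using qpoch_add[of "- 1" "x\<^sup>2" 1 n] by (simp add: qpoch_def)
    then show "(\<lambda>n. qpoch (- 1) (x\<^sup>2) (Suc n)) \<longlonglongrightarrow> 2 * qpoch_inf (- (x\<^sup>2)) (x\<^sup>2)"
      by (simp only:) (intro tendsto_mult tendsto_const qpoch_tendsto x2)
  qed
  ultimately show ?thesis
    using qpoch_inf_uminus_even[OF x, of 2] E_power_nonzero[OF x, of 2]
    by (simp add: field_simps power2_eq_square)
qed

end

lemma powi_affine:
  assumes "z \<noteq> 0" "e' = int k * e + int c"
  shows "(z :: complex) powi e' = z ^ c * (z ^ k) powi e"
  using assms by (simp add: power_int_add power_int_power)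

context
  fixes z :: complex
  assumes z: "norm z < 1" "z \<noteq> 0"
begin

lemma theta_sum_even_coprime_3:
  "theta_sum (\<lambda>u. of_bool (even u \<and> u mod 3 \<noteq> 0)) z = 2 * z ^ 4 * eta_A (z ^ 12)"
proof -
  have "theta_sum (\<lambda>u. of_bool (even u \<and> u mod 3 \<noteq> 0)) z =
      2 * (\<Sum>\<^sub>\<infinity>j. of_bool (even (6 * j + 2) \<and> (6 * j + 2) mod 3 \<noteq> 0) * z powi ((6 * j + 2)\<^sup>2))"
  proof (rule theta_sum_mod_6[OF z, of _ 1])
    fix u :: int assume u: "u mod 6 \<noteq> 2" "u mod 6 \<noteq> 6 - 2"
    have "odd u \<or> u mod 3 = 0" using u by presburger
    then show "of_bool (even u \<and> u mod 3 \<noteq> 0) = (0 :: complex)" by auto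
  qed (auto simp: zmod_zminus1_eq_if)
  also have "(\<Sum>\<^sub>\<infinity>j. of_bool (even (6 * j + 2) \<and> (6 * j + 2) mod 3 \<noteq> 0) * z powi ((6 * j + 2)\<^sup>2)) =
      (\<Sum>\<^sub>\<infinity>j. z ^ 4 * (z ^ 12) powi (3 * j\<^sup>2 + 2 * j))"
  proof (rule infsum_cong)
    fix j :: int
    have "(6 * j + 2) mod 3 \<noteq> 0" by presburger
    moreover have "z powi ((6 * j + 2)\<^sup>2) = z ^ 4 * (z ^ 12) powi (3 * j\<^sup>2 + 2 * j)"
      by (rule powi_affine[OF z(2)]) (simp add: power2_eq_square algebra_simps)
    ultimately show "of_bool (even (6 * j + 2) \<and> (6 * j + 2) mod 3 \<noteq> 0) * z powi ((6 * j + 2)\<^sup>2) =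
        z ^ 4 * (z ^ 12) powi (3 * j\<^sup>2 + 2 * j)" by simp
  qed
  also have "\<dots> = z ^ 4 * eta_A (z ^ 12)"
    using infsum_eta_A[of "z ^ 12"] norm_power_less_1[OF z(1), of 12] z(2)
      by (simp add: infsum_cmult_right')
  finally show ?thesis by simp
qed

lemma theta_sum_odd_coprime_3:
  "theta_sum (\<lambda>u. of_bool (odd u \<and> u mod 3 \<noteq> 0)) z = 2 * z * eta_C (z ^ 12)"
proof -
  have "theta_sum (\<lambda>u. of_bool (odd u \<and> u mod 3 \<noteq> 0)) z =
      2 * (\<Sum>\<^sub>\<infinity>j. of_bool (odd (6 * j + 1) \<and> (6 * j + 1) mod 3 \<noteq> 0) * z powi ((6 * j + 1)\<^sup>2))"
  proof (rule theta_sum_mod_6[OF z, of _ 1])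
    fix u :: int assume u: "u mod 6 \<noteq> 1" "u mod 6 \<noteq> 6 - 1"
    have "even u \<or> u mod 3 = 0" using u by presburger
    then show "of_bool (odd u \<and> u mod 3 \<noteq> 0) = (0 :: complex)" by auto
  qed (auto simp: zmod_zminus1_eq_if)
  also have "(\<Sum>\<^sub>\<infinity>j. of_bool (odd (6 * j + 1) \<and> (6 * j + 1) mod 3 \<noteq> 0) * z powi ((6 * j + 1)\<^sup>2)) =
      (\<Sum>\<^sub>\<infinity>j. z * (z ^ 12) powi (3 * j\<^sup>2 + j))"
  proof (rule infsum_cong)
    fix j :: int
    have "(6 * j + 1) mod 3 \<noteq> 0" by presburger
    moreover have "z powi ((6 * j + 1)\<^sup>2) = z ^ 1 * (z ^ 12) powi (3 * j\<^sup>2 + j)"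
      by (rule powi_affine[OF z(2)]) (simp add: power2_eq_square algebra_simps)
    ultimately show "of_bool (odd (6 * j + 1) \<and> (6 * j + 1) mod 3 \<noteq> 0) * z powi ((6 * j + 1)\<^sup>2) =
        z * (z ^ 12) powi (3 * j\<^sup>2 + j)" by simp
  qed
  also have "\<dots> = z * eta_C (z ^ 12)"
    using infsum_eta_C[of "z ^ 12"] norm_power_less_1[OF z(1), of 12] z(2)
      by (simp add: infsum_cmult_right')
  finally show ?thesis by simp
qed

lemma theta_sum_even_cos3: "theta_sum (\<lambda>u. if even u then cos3 u else 0) z = eta_B (z ^ 4)"
proof -
  have "theta_sum (\<lambda>u. if even u then cos3 u else 0) z =
      (\<Sum>\<^sub>\<infinity>j. (if even (2 * j) then cos3 (2 * j) else 0) * z powi ((2 * j)\<^sup>2))"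
    by (rule theta_sum_even) simp
  also have "\<dots> = (\<Sum>\<^sub>\<infinity>j. cos3 j * (z ^ 4) powi (j\<^sup>2))"
  proof (rule infsum_cong)
    fix j :: int
    have "(2 * j) mod 3 = 0 \<longleftrightarrow> j mod 3 = 0" by presburger
    moreover have "z powi ((2 * j)\<^sup>2) = z ^ 0 * (z ^ 4) powi (j\<^sup>2)"
      by (rule powi_affine[OF z(2)]) (simp add: power2_eq_square)
    ultimately show "(if even (2 * j) then cos3 (2 * j) else 0) * z powi ((2 * j)\<^sup>2) =
      cos3 j * (z ^ 4) powi (j\<^sup>2)"
      by (simp add: cos3_def)
  qed
  also have "\<dots> = eta_B (z ^ 4)"
    using infsum_eta_B[of "z ^ 4"] norm_power_less_1[OF z(1), of 4] z(2) by simp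
  finally show ?thesis .
qed

lemma theta_sum_odd_cos3: "theta_sum (\<lambda>u. if odd u then cos3 u else 0) z = - z * eta_D (z ^ 4)"
proof -
  have "theta_sum (\<lambda>u. if odd u then cos3 u else 0) z =
      (\<Sum>\<^sub>\<infinity>j. (if odd (2 * j + 1) then cos3 (2 * j + 1) else 0) * z powi ((2 * j + 1)\<^sup>2))"
    by (rule theta_sum_odd) simp
  also have "\<dots> = (\<Sum>\<^sub>\<infinity>j. z * (cos3 (2 * j + 1) * (z ^ 4) powi (j\<^sup>2 + j)))"
  proof (rule infsum_cong)
    fix j :: int
    have "z powi ((2 * j + 1)\<^sup>2) = z ^ 1 * (z ^ 4) powi (j\<^sup>2 + j)"
      by (rule powi_affine[OF z(2)]) (simp add: power2_eq_square algebra_simps)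
    then show "(if odd (2 * j + 1) then cos3 (2 * j + 1) else 0) * z powi ((2 * j + 1)\<^sup>2) =
        z * (cos3 (2 * j + 1) * (z ^ 4) powi (j\<^sup>2 + j))"
      by simp
  qed
  also have "\<dots> = - z * eta_D (z ^ 4)"
    using infsum_eta_D[of "z ^ 4"] norm_power_less_1[OF z(1), of 4] z(2)
      by (simp add: infsum_cmult_right')
  finally show ?thesis .
qed

lemma theta_sum_half_sign: "theta_sum half_sign z = (E (z ^ 4))\<^sup>2 / E (z ^ 8)"
proof -
  have "theta_sum half_sign z = (\<Sum>\<^sub>\<infinity>j. half_sign (2 * j) * z powi ((2 * j)\<^sup>2))"
  proof (rule theta_sum_even)
    fix u :: int assume "odd u"
    then have "u mod 4 \<noteq> 0" "u mod 4 \<noteq> 2" by presburger+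
    then show "half_sign u = 0" by (simp add: half_sign_def)
  qed
  also have "\<dots> = (\<Sum>\<^sub>\<infinity>j. (-1) powi j * (z ^ 4) powi (j\<^sup>2))"
  proof (rule infsum_cong)
    fix j :: int
    have "(2 * j) mod 4 = (if even j then 0 else 2)" by presburger
    moreover have "z powi ((2 * j)\<^sup>2) = z ^ 0 * (z ^ 4) powi (j\<^sup>2)"
      by (rule powi_affine[OF z(2)]) (simp add: power2_eq_square)
    ultimately show "half_sign (2 * j) * z powi ((2 * j)\<^sup>2) = (-1) powi j * (z ^ 4) powi (j\<^sup>2)"
      by (simp add: half_sign_def neg_one_powi)
  qed
  also have "\<dots> = (E (z ^ 4))\<^sup>2 / E (z ^ 8)"
    using infsum_alternating_square[of "z ^ 4"] norm_power_less_1[OF z(1), of 4] z(2)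
    by (simp flip: power_mult)
  finally show ?thesis .
qed

lemma theta_sum_odd_all: "theta_sum (\<lambda>u. of_bool (odd u)) z = 2 * z * (E (z ^ 16))\<^sup>2 / E (z ^ 8)"
proof -
  have "theta_sum (\<lambda>u. of_bool (odd u)) z =
      (\<Sum>\<^sub>\<infinity>j. of_bool (odd (2 * j + 1)) * z powi ((2 * j + 1)\<^sup>2))"
    by (rule theta_sum_odd) simp
  also have "\<dots> = (\<Sum>\<^sub>\<infinity>j. z * (z ^ 4) powi (j\<^sup>2 + j))"
  proof (rule infsum_cong)
    fix j :: int
    have "z powi ((2 * j + 1)\<^sup>2) = z ^ 1 * (z ^ 4) powi (j\<^sup>2 + j)"
      by (rule powi_affine[OF z(2)]) (simp add: power2_eq_square algebra_simps)
    then show "of_bool (odd (2 * j + 1)) * z powi ((2 * j + 1)\<^sup>2) = z * (z ^ 4) powi (j\<^sup>2 + j)"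
      by simp
  qed
  also have "\<dots> = z * (2 * (E ((z ^ 4) ^ 4))\<^sup>2 / E ((z ^ 4)\<^sup>2))"
    using infsum_triangular[of "z ^ 4"] norm_power_less_1[OF z(1), of 4] z(2)
    by (simp add: infsum_cmult_right')
  finally show ?thesis by (simp flip: power_mult)
qed

end

subsection \<open>Linear relations between the theta series\<close>

lemma mod4_cases: "k mod 4 = 0 \<or> k mod 4 = 1 \<or> k mod 4 = 2 \<or> k mod 4 = (3 :: int)"
  by presburger

lemma even_iff_mod4: "even u \<longleftrightarrow> u mod 4 = 0 \<or> u mod 4 = (2 :: int)"
  by presburger

text \<open>The inverse of 2 modulo 3 is -1. Conditions on u/2 modulo 3 thus remain conditions on u
  modulo 3.\<close>

lemma half_mod3: "even u \<Longrightarrow> (u div 2) mod 3 = (- u) mod (3 :: int)"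
  by presburger

lemma half_even: "even u \<Longrightarrow> even (u div 2) \<longleftrightarrow> u mod 4 = (0 :: int)"
  by presburger

abbreviation even_coprime :: "int \<Rightarrow> complex" where
  "even_coprime u \<equiv> of_bool (even u \<and> u mod 3 \<noteq> 0)"

abbreviation odd_coprime :: "int \<Rightarrow> complex" where
  "odd_coprime u \<equiv> of_bool (odd u \<and> u mod 3 \<noteq> 0)"

abbreviation even_cos3 :: "int \<Rightarrow> complex" where
  "even_cos3 u \<equiv> (if even u then cos3 u else 0)"

abbreviation odd_cos3 :: "int \<Rightarrow> complex" where
  "odd_cos3 u \<equiv> (if odd u then cos3 u else 0)"

lemma norm_weights:
  "norm (chi12 u) \<le> 1" "norm (half_sign u) \<le> 1" "norm (even_cos3 u) \<le> 1" "norm (odd_cos3 u) \<le> 1"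
  "norm (of_bool (P u) :: complex) \<le> 1"
  by (auto simp: chi12_def cos3_def half_sign_def)

lemma bounded_weights:
  "bounded_weight (\<lambda>u v. chi12 u)" "bounded_weight (\<lambda>u v. chi12 v)"
  "bounded_weight (\<lambda>u v. half_sign u)" "bounded_weight (\<lambda>u v. half_sign v)"
  "bounded_weight (\<lambda>u v. even_cos3 u)" "bounded_weight (\<lambda>u v. even_cos3 v)"
  "bounded_weight (\<lambda>u v. odd_cos3 u)" "bounded_weight (\<lambda>u v. odd_cos3 v)"
  unfolding bounded_weight_def using norm_weights by blast+

lemmas bounded_rules = bounded_weight_intros bounded_weights


lemmas residue_simps = chi12_def cos3_def half_sign_def even_iff_mod4[symmetric] half_mod3 half_even
  mod_minus_eq

context
  fixes z :: complex
  assumes z: "norm z < 1" "z \<noteq> 0"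
begin

text \<open>Only the averages of the weights over the sign changes of both variables matter.\<close>

lemma lattice_sum_eqI_mod_12:
  assumes ab: "a > 0" "b > 0"
    and bd: "bounded_weight w" "bounded_weight w'"
    and w: "\<And>u v. w u v = W (u mod 4) (u mod 3) (v mod 4) (v mod 3)"
    and w': "\<And>u v. w' u v = W' (u mod 4) (u mod 3) (v mod 4) (v mod 3)"
    and eq: "\<forall>(a, a')\<in>{(0, 0), (1, 3), (2, 2), (3, 1)}. \<forall>(c, c')\<in>{(0, 0), (1, 2), (2, 1)}.
      \<forall>(b, b')\<in>{(0, 0), (1, 3), (2, 2), (3, 1)}. \<forall>(d, d')\<in>{(0, 0), (1, 2), (2, 1)}.
        W a c b d + W a' c' b d + W a c b' d' + W a' c' b' d' =
        W' a c b d + W' a' c' b d + W' a c b' d' + W' a' c' b' d'"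
  shows "lattice_sum a b w z = lattice_sum a b w' z"
proof (rule lattice_sum_eqI[OF z ab bd])
  fix u v
  have 4: "(x mod 4, (- x) mod 4) \<in> {(0, 0), (1, 3), (2, 2), (3, 1)}" for x :: int
    using mod4_cases[of x] by (auto simp: zmod_zminus1_eq_if)
  have 3: "(x mod 3, (- x) mod 3) \<in> {(0, 0), (1, 2), (2, 1)}" for x :: int
    using mod3_cases[of x] by (auto simp: zmod_zminus1_eq_if)
  show "w u v + w (- u) v + w u (- v) + w (- u) (- v) = w' u v + w' (- u) v + w' u (- v) +
    w' (- u) (- v)"
    unfolding w w' using eq[THEN bspec, OF 4[of u], unfolded prod.case, THEN bspec, OF 3[of u],
      unfolded prod.case,
        THEN bspec, OF 4[of v], unfolded prod.case, THEN bspec, OF 3[of v], unfolded prod.case] .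
qed

lemma lattice_sum_weights:
  assumes "a > 0" "b > 0"
  shows "lattice_sum a b (\<lambda>u v. chi12 u * chi12 v) z = 4 * z ^ (a + b) * E (z ^ (24 * a)) *
    E (z ^ (24 * b))"
    and "lattice_sum a b (\<lambda>u v. even_coprime u * even_cos3 v) z =
      2 * z ^ (4 * a) * eta_A (z ^ (12 * a)) * eta_B (z ^ (4 * b))"
    and "lattice_sum a b (\<lambda>u v. odd_coprime u * odd_cos3 v) z =
      - 2 * z ^ (a + b) * eta_C (z ^ (12 * a)) * eta_D (z ^ (4 * b))"
    and "lattice_sum a b (\<lambda>u v. even_cos3 u * even_coprime v) z =
      2 * z ^ (4 * b) * eta_A (z ^ (12 * b)) * eta_B (z ^ (4 * a))"
    and "lattice_sum a b (\<lambda>u v. odd_cos3 u * odd_coprime v) z =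
      - 2 * z ^ (a + b) * eta_C (z ^ (12 * b)) * eta_D (z ^ (4 * a))"
    and "lattice_sum a b (\<lambda>u v. half_sign u * half_sign v) z =
      (E (z ^ (4 * a)))\<^sup>2 / E (z ^ (8 * a)) * ((E (z ^ (4 * b)))\<^sup>2 / E (z ^ (8 * b)))"
    and "lattice_sum a b (\<lambda>u v. of_bool (odd u) * of_bool (odd v)) z =
      4 * z ^ (a + b) * (E (z ^ (16 * a)))\<^sup>2 / E (z ^ (8 * a)) * ((E (z ^ (16 * b)))\<^sup>2 / E
        (z ^ (8 * b)))"
proof -
  have za: "norm (z ^ a) < 1" "z ^ a \<noteq> 0" and zb: "norm (z ^ b) < 1" "z ^ b \<noteq> 0"
    using z assms by (auto simp: norm_power_less_1)
  note times = lattice_sum_times[OF z assms, where K = 1 and L = 1]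
  note th = theta_sum_chi12 theta_sum_even_coprime_3 theta_sum_odd_coprime_3 theta_sum_even_cos3
    theta_sum_odd_cos3 theta_sum_half_sign theta_sum_odd_all
  note thz = th[OF za] th[OF zb]
  have pw: "(z ^ n) ^ k = z ^ (k * n)" for n k
    by (simp add: mult.commute flip: power_mult)
  show "lattice_sum a b (\<lambda>u v. chi12 u * chi12 v) z = 4 * z ^ (a + b) * E (z ^ (24 * a)) *
    E (z ^ (24 * b))"
    by (subst times[OF norm_weights(1) norm_weights(1)]) (simp add: thz pw power_add)
  show "lattice_sum a b (\<lambda>u v. even_coprime u * even_cos3 v) z =
    2 * z ^ (4 * a) * eta_A (z ^ (12 * a)) * eta_B (z ^ (4 * b))"
    by (subst times[OF norm_weights(5) norm_weights(3)]) (simp add: thz pw)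
  show "lattice_sum a b (\<lambda>u v. odd_coprime u * odd_cos3 v) z =
    - 2 * z ^ (a + b) * eta_C (z ^ (12 * a)) * eta_D (z ^ (4 * b))"
    by (subst times[OF norm_weights(5) norm_weights(4)]) (simp add: thz pw power_add)
  show "lattice_sum a b (\<lambda>u v. even_cos3 u * even_coprime v) z =
    2 * z ^ (4 * b) * eta_A (z ^ (12 * b)) * eta_B (z ^ (4 * a))"
    by (subst times[OF norm_weights(3) norm_weights(5)]) (simp add: thz pw)
  show "lattice_sum a b (\<lambda>u v. odd_cos3 u * odd_coprime v) z =
    - 2 * z ^ (a + b) * eta_C (z ^ (12 * b)) * eta_D (z ^ (4 * a))"
    by (subst times[OF norm_weights(4) norm_weights(5)]) (simp add: thz pw power_add)
  show "lattice_sum a b (\<lambda>u v. half_sign u * half_sign v) z =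
      (E (z ^ (4 * a)))\<^sup>2 / E (z ^ (8 * a)) * ((E (z ^ (4 * b)))\<^sup>2 / E (z ^ (8 * b)))"
    by (subst times[OF norm_weights(2) norm_weights(2)]) (simp add: thz pw)
  show "lattice_sum a b (\<lambda>u v. of_bool (odd u) * of_bool (odd v)) z =
      4 * z ^ (a + b) * (E (z ^ (16 * a)))\<^sup>2 / E (z ^ (8 * a)) * ((E (z ^ (16 * b)))\<^sup>2 / E
        (z ^ (8 * b)))"
    by (subst times[OF norm_weights(5) norm_weights(5)]) (simp add: thz pw power_add)
qed

lemmas lattice_sum_linear = lattice_sum_add[OF z] lattice_sum_diff[OF z] lattice_sum_cmult[OF z]
  bounded_rules zero_less_numeral zero_less_one

section \<open>Relations among the theta series of discriminants -351 and -39\<close>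

lemma double_cancel: "2 * a - 2 * b = 4 * c * d * e \<Longrightarrow> a - b = 2 * c * d * (e :: complex)"
  by algebra

lemma z16: "z ^ 16 = (z ^ 4) ^ 4"
  by (simp flip: power_mult)

text \<open>The difference of the two conditions modulo 3 is the product of the odd characters of u
  and v modulo 3. Averaging over signs therefore keeps only the part of the condition modulo 4 that
  is odd in both variables. That part is 0 on even pairs and half the product of the characters
  modulo 4 on odd pairs, whence the factor 2.\<close>

lemma weights_chi12:
  fixes a b :: nat
  assumes "a > 0" "b > 0"
  shows "lattice_sum a b (\<lambda>u v. 2 * of_bool (u mod 4 = v mod 4 \<and> u mod 3 = v mod 3) -
    2 * of_bool (u mod 4 = v mod 4 \<and> u mod 3 = (- v) mod 3)) z =
    lattice_sum a b (\<lambda>u v. (chi12 u * chi12 v)) z"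
    (is "lattice_sum a b ?w z = lattice_sum a b ?w' z")
proof -
  \<comment> \<open>The weights as functions of u mod 4, u mod 3, v mod 4 and v mod 3, in this
    order, so that the claim becomes a finite check.\<close>
  let ?W = "\<lambda>a c b d :: int. 2 * of_bool (a = b \<and> c = d) - 2 * of_bool (a = b \<and> c = (- d) mod 3)"
  let ?W' = "\<lambda>a c b d :: int. (((if a = 1 then 1 else if a = 3 then - 1 else 0) *
    (if c = 1 then 1 else if c = 2 then - 1 else 0)) * ((if b = 1 then 1 else if b = 3 then -
    1 else 0) * (if d = 1 then 1 else if d = 2 then - 1 else 0)))"
  show ?thesis
  proof (rule lattice_sum_eqI_mod_12[where W = ?W and W' = ?W'])
    show "?w u v = ?W (u mod 4) (u mod 3) (v mod 4) (v mod 3)"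
      "?w' u v = ?W' (u mod 4) (u mod 3) (v mod 4) (v mod 3)" for u v
      by (simp_all add: residue_simps cong: conj_cong if_cong split del: if_split split_of_bool)
    show "bounded_weight ?w" "bounded_weight ?w'"
      by (intro bounded_rules)+
  qed (use assms in simp_all)
qed

lemma qform_5_minus_8: "qform 5 3 18 (z ^ 8) - qform 8 1 11 (z ^ 8) =
  2 * z ^ 40 * E (z ^ 24) * E (z ^ 936)"
  using weights_chi12[of 1 39]
  unfolding qform_5_3_18_eq_lattice_sum_1_39 qform_8_1_11_eq_lattice_sum_1_39
  by (intro double_cancel) (simp only: lattice_sum_linear lattice_sum_weights simp_thms, simp)

lemma qform_2_minus_8: "qform 2 1 44 (z ^ 8) - qform 8 1 11 (z ^ 8) =
  2 * z ^ 16 * E (z ^ 72) * E (z ^ 312)"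
  using weights_chi12[of 3 13]
  unfolding qform_2_1_44_eq_lattice_sum_3_13 qform_8_1_11_eq_lattice_sum_3_13
  by (intro double_cancel) (simp only: lattice_sum_linear lattice_sum_weights simp_thms, simp)

text \<open>If 3 divides u, the two conditions coincide; otherwise their difference averages to 1
  for 3 dividing v and to -1/2 for other v, which is \<open>cos3 v\<close>. Even and odd pairs then
  give one product weight each.\<close>

lemma qform_1_minus_9: "qform 1 1 88 (z ^ 4) - qform 9 3 10 (z ^ 4) =
    2 * z ^ 4 * (eta_A (z ^ 12) * eta_B (z ^ 156) - z ^ 36 * eta_C (z ^ 12) * eta_D (z ^ 156))"
proof -
  let ?w = "\<lambda>u v :: int. of_bool (even u = even v \<and> v mod 3 = 0) - of_bool (even u = even v \<and>
    u mod 3 = v mod 3)"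
  let ?w' = "\<lambda>u v :: int. (even_coprime u * even_cos3 v) + (odd_coprime u * odd_cos3 v)"
  let ?W = "\<lambda>a c b d :: int. of_bool ((a = 0 \<or> a = 2) = (b = 0 \<or> b = 2) \<and> d = 0) -
    of_bool ((a = 0 \<or> a = 2) = (b = 0 \<or> b = 2) \<and> c = d)"
  let ?W' = "\<lambda>a c b d :: int. (of_bool ((a = 0 \<or> a = 2) \<and> c \<noteq> 0) * (if (b = 0 \<or> b = 2) then
    (if d = 0 then 1 else - 1 / 2) else 0)) + (of_bool (\<not> (a = 0 \<or> a = 2) \<and> c \<noteq> 0) * (if \<not>
    (b = 0 \<or> b = 2) then (if d = 0 then 1 else - 1 / 2) else 0))"
  have "lattice_sum 1 39 ?w z = lattice_sum 1 39 ?w' z"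
  proof (rule lattice_sum_eqI_mod_12[where W = ?W and W' = ?W'])
    show "?w u v = ?W (u mod 4) (u mod 3) (v mod 4) (v mod 3)"
      "?w' u v = ?W' (u mod 4) (u mod 3) (v mod 4) (v mod 3)" for u v
      by (simp_all add: residue_simps cong: conj_cong if_cong split del: if_split split_of_bool)
    show "bounded_weight ?w" "bounded_weight ?w'"
      by (intro bounded_rules)+
  qed simp_all
  then show ?thesis
    unfolding qform_1_1_88_eq_lattice_sum_1_39 qform_9_3_10_eq_lattice_sum_1_39
    by (simp only: lattice_sum_linear lattice_sum_weights) (simp add: algebra_simps flip: power_add)
qed

text \<open>As before with u and v exchanged: for v prime to 3 the difference averages to
  -\<open>cos3 u\<close>, and otherwise to 0.\<close>

lemma qform_4_minus_10: "qform 4 1 22 (z ^ 4) - qform 10 7 10 (z ^ 4) =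
    2 * z ^ 16 * (eta_C (z ^ 156) * eta_D (z ^ 12) - z ^ 36 * eta_A (z ^ 156) * eta_B (z ^ 12))"
proof -
  let ?w = "\<lambda>u v :: int. of_bool (even u = even v \<and> u mod 3 = v mod 3) - of_bool (even u = even v \<and>
    u mod 3 = 0)"
  let ?w' = "\<lambda>u v :: int. (- 1) * (even_cos3 u * even_coprime v) - (odd_cos3 u * odd_coprime v)"
  let ?W = "\<lambda>a c b d :: int. of_bool ((a = 0 \<or> a = 2) = (b = 0 \<or> b = 2) \<and> c = d) -
    of_bool ((a = 0 \<or> a = 2) = (b = 0 \<or> b = 2) \<and> c = 0)"
  let ?W' = "\<lambda>a c b d :: int. (- 1) * ((if (a = 0 \<or> a = 2) then (if c = 0 then 1 else - 1 / 2) else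
    0) * of_bool ((b = 0 \<or> b = 2) \<and> d \<noteq> 0)) - ((if \<not> (a = 0 \<or> a = 2) then (if c = 0 then 1 else -
    1 / 2) else 0) * of_bool (\<not> (b = 0 \<or> b = 2) \<and> d \<noteq> 0))"
  have "lattice_sum 3 13 ?w z = lattice_sum 3 13 ?w' z"
  proof (rule lattice_sum_eqI_mod_12[where W = ?W and W' = ?W'])
    show "?w u v = ?W (u mod 4) (u mod 3) (v mod 4) (v mod 3)"
      "?w' u v = ?W' (u mod 4) (u mod 3) (v mod 4) (v mod 3)" for u v
      by (simp_all add: residue_simps cong: conj_cong if_cong split del: if_split split_of_bool)
    show "bounded_weight ?w" "bounded_weight ?w'"
      by (intro bounded_rules)+
  qed simp_all
  then show ?thesis
    unfolding qform_4_1_22_eq_lattice_sum_3_13 qform_10_7_10_eq_lattice_sum_3_13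
    by (simp only: lattice_sum_linear lattice_sum_weights) (simp add: algebra_simps flip: power_add)
qed

text \<open>Pairs with u and v congruent modulo 4 are of two kinds. Even pairs have halves of equal
  parity and form the doubled lattice, that is, the forms at q^2; odd pairs contribute the product
  weight that the term with \<open>eta_C\<close> and \<open>eta_D\<close> compensates.\<close>

lemma qform_1_minus_9_double: "2 * (qform 1 1 88 (z ^ 16) - qform 9 3 10 (z ^ 16)) =
    2 * qform 2 1 44 (z ^ 8) - qform 5 3 18 (z ^ 8) - qform 8 1 11 (z ^ 8) +
    2 * z ^ 40 * eta_C (z ^ 12) * eta_D (z ^ 156)"
proof -
  let ?w = "\<lambda>u v :: int. 2 * of_bool (even u \<and> even v \<and> even (u div 2) = even (v div 2) \<and>
    (v div 2) mod 3 = 0) - 2 * of_bool (even u \<and> even v \<and> even (u div 2) =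
    even (v div 2) \<and> (u div 2) mod 3 = (v div 2) mod 3)"
  let ?w' = "\<lambda>u v :: int. 2 * of_bool (u mod 4 = v mod 4 \<and> v mod 3 = 0) -
    of_bool (u mod 4 = v mod 4 \<and> u mod 3 = v mod 3) - of_bool (u mod 4 = v mod 4 \<and> u mod 3 = (- v)
    mod 3) - (odd_coprime u * odd_cos3 v)"
  let ?W = "\<lambda>a c b d :: int. 2 * of_bool ((a = 0 \<or> a = 2) \<and> (b = 0 \<or> b = 2) \<and> ((a = 0) = (b = 0)) \<and>
    (- d) mod 3 = 0) - 2 * of_bool ((a = 0 \<or> a = 2) \<and> (b = 0 \<or> b = 2) \<and> ((a = 0) = (b = 0)) \<and>
    (- c) mod 3 = (- d) mod 3)"
  let ?W' = "\<lambda>a c b d :: int. 2 * of_bool (a = b \<and> d = 0) - of_bool (a = b \<and> c = d) -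
    of_bool (a = b \<and> c = (- d) mod 3) - (of_bool (\<not> (a = 0 \<or> a = 2) \<and> c \<noteq> 0) * (if \<not> (b = 0 \<or> b = 2)
    then (if d = 0 then 1 else - 1 / 2) else 0))"
  have "lattice_sum 1 39 ?w z = lattice_sum 1 39 ?w' z"
  proof (rule lattice_sum_eqI_mod_12[where W = ?W and W' = ?W'])
    show "?w u v = ?W (u mod 4) (u mod 3) (v mod 4) (v mod 3)"
      "?w' u v = ?W' (u mod 4) (u mod 3) (v mod 4) (v mod 3)" for u v
      by (simp_all add: residue_simps cong: conj_cong if_cong split del: if_split split_of_bool)
    show "bounded_weight ?w" "bounded_weight ?w'"
      by (intro bounded_rules)+
  qed simp_all
  then show ?thesis
    unfolding z16 qform_1_1_88_eq_lattice_sum_1_39 qform_9_3_10_eq_lattice_sum_1_39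
      qform_2_1_44_eq_lattice_sum_1_39 qform_5_3_18_eq_lattice_sum_1_39
      qform_8_1_11_eq_lattice_sum_1_39 lattice_sum_scale[OF z zero_less_numeral zero_less_numeral]
      lattice_sum_scale[OF z zero_less_one zero_less_numeral]
    by (simp only: lattice_sum_linear lattice_sum_weights) simp
qed

lemma qform_4_minus_10_double: "2 * (qform 4 1 22 (z ^ 16) - qform 10 7 10 (z ^ 16)) =
    qform 2 1 44 (z ^ 8) + qform 8 1 11 (z ^ 8) - 2 * qform 5 3 18 (z ^ 8) -
    2 * z ^ 16 * eta_C (z ^ 156) * eta_D (z ^ 12)"
proof -
  let ?w = "\<lambda>u v :: int. 2 * of_bool (even u \<and> even v \<and> even (u div 2) = even (v div 2) \<and>
    (u div 2) mod 3 = (v div 2) mod 3) - 2 * of_bool (even u \<and> even v \<and> even (u div 2) =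
    even (v div 2) \<and> (u div 2) mod 3 = 0)"
  let ?w' = "\<lambda>u v :: int. of_bool (u mod 4 = v mod 4 \<and> u mod 3 = v mod 3) +
    of_bool (u mod 4 = v mod 4 \<and> u mod 3 = (- v) mod 3) - 2 * of_bool (u mod 4 = v mod 4 \<and>
    u mod 3 = 0) + (odd_cos3 u * odd_coprime v)"
  let ?W = "\<lambda>a c b d :: int. 2 * of_bool ((a = 0 \<or> a = 2) \<and> (b = 0 \<or> b = 2) \<and> ((a = 0) = (b = 0)) \<and>
    (- c) mod 3 = (- d) mod 3) - 2 * of_bool ((a = 0 \<or> a = 2) \<and> (b = 0 \<or> b = 2) \<and>
    ((a = 0) = (b = 0)) \<and> (- c) mod 3 = 0)"
  let ?W' = "\<lambda>a c b d :: int. of_bool (a = b \<and> c = d) + of_bool (a = b \<and> c = (- d) mod 3) -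
    2 * of_bool (a = b \<and> c = 0) + ((if \<not> (a = 0 \<or> a = 2) then (if c = 0 then 1 else - 1 / 2) else
    0) * of_bool (\<not> (b = 0 \<or> b = 2) \<and> d \<noteq> 0))"
  have "lattice_sum 3 13 ?w z = lattice_sum 3 13 ?w' z"
  proof (rule lattice_sum_eqI_mod_12[where W = ?W and W' = ?W'])
    show "?w u v = ?W (u mod 4) (u mod 3) (v mod 4) (v mod 3)"
      "?w' u v = ?W' (u mod 4) (u mod 3) (v mod 4) (v mod 3)" for u v
      by (simp_all add: residue_simps cong: conj_cong if_cong split del: if_split split_of_bool)
    show "bounded_weight ?w" "bounded_weight ?w'"
      by (intro bounded_rules)+
  qed simp_all
  then show ?thesis
    unfolding z16 qform_4_1_22_eq_lattice_sum_3_13 qform_10_7_10_eq_lattice_sum_3_13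
      qform_2_1_44_eq_lattice_sum_3_13 qform_5_3_18_eq_lattice_sum_3_13
      qform_8_1_11_eq_lattice_sum_3_13 lattice_sum_scale[OF z zero_less_numeral zero_less_numeral]
    by (simp only: lattice_sum_linear lattice_sum_weights) simp
qed

text \<open>On even pairs both sides are the sign telling whether u and v agree modulo 4. On odd
  pairs that condition averages to 1/2, so the right-hand side averages to 0.\<close>

lemma weights_half_sign:
  fixes a b :: nat
  assumes "a > 0" "b > 0"
  shows "lattice_sum a b (\<lambda>u v. (half_sign u * half_sign v)) z =
    lattice_sum a b (\<lambda>u v. 2 * of_bool (u mod 4 = v mod 4) - of_bool (even u = even v)) z"
    (is "lattice_sum a b ?w z = lattice_sum a b ?w' z")
proof -
  let ?W = "\<lambda>a c b d :: int. ((if a = 0 then 1 else if a = 2 then - 1 else 0) *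
    (if b = 0 then 1 else if b = 2 then - 1 else 0))"
  let ?W' = "\<lambda>a c b d :: int. 2 * of_bool (a = b) - of_bool ((a = 0 \<or> a = 2) = (b = 0 \<or> b = 2))"
  show ?thesis
  proof (rule lattice_sum_eqI_mod_12[where W = ?W and W' = ?W'])
    show "?w u v = ?W (u mod 4) (u mod 3) (v mod 4) (v mod 3)"
      "?w' u v = ?W' (u mod 4) (u mod 3) (v mod 4) (v mod 3)" for u v
      by (simp_all add: residue_simps cong: conj_cong if_cong split del: if_split split_of_bool)
    show "bounded_weight ?w" "bounded_weight ?w'"
      by (intro bounded_rules)+
  qed (use assms in simp_all)
qed

text \<open>For odd pairs congruence modulo 4 averages to 1/2, so twice the indicator counts each
  pair once; the even pairs are subtracted as the doubled lattice.\<close>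

lemma weights_odd:
  fixes a b :: nat
  assumes "a > 0" "b > 0"
  shows "lattice_sum a b (\<lambda>u v. (of_bool (odd u) * of_bool (odd v))) z =
    lattice_sum a b (\<lambda>u v. 2 * of_bool (u mod 4 = v mod 4) - 2 * of_bool (even u \<and> even v \<and>
      (even (u div 2) = even (v div 2)))) z"
    (is "lattice_sum a b ?w z = lattice_sum a b ?w' z")
proof -
  let ?W = "\<lambda>a c b d :: int. (of_bool (\<not> (a = 0 \<or> a = 2)) * of_bool (\<not> (b = 0 \<or> b = 2)))"
  let ?W' = "\<lambda>a c b d :: int. 2 * of_bool (a = b) - 2 * of_bool ((a = 0 \<or> a = 2) \<and> (b = 0 \<or> b = 2) \<and>
    ((a = 0) = (b = 0)))"
  show ?thesis
  proof (rule lattice_sum_eqI_mod_12[where W = ?W and W' = ?W'])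
    show "?w u v = ?W (u mod 4) (u mod 3) (v mod 4) (v mod 3)"
      "?w' u v = ?W' (u mod 4) (u mod 3) (v mod 4) (v mod 3)" for u v
      by (simp_all add: residue_simps cong: conj_cong if_cong split del: if_split split_of_bool)
    show "bounded_weight ?w" "bounded_weight ?w'"
      by (intro bounded_rules)+
  qed (use assms in simp_all)
qed

lemma theta_alt_1: 
  "(E (z ^ 4))\<^sup>2 / E (z ^ 8) * ((E (z ^ 156))\<^sup>2 / E (z ^ 312)) =
    2 * qform 2 1 5 (z ^ 8) - qform 1 1 10 (z ^ 4)"
  using weights_half_sign[of 1 39]
  unfolding qform_2_1_5_eq_lattice_sum_1_39 qform_1_1_10_eq_lattice_sum_1_39
  by (simp only: lattice_sum_linear lattice_sum_weights simp_thms) simp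

lemma theta_odd_1: 
  "4 * z ^ 40 * (E (z ^ 16))\<^sup>2 / E (z ^ 8) * ((E (z ^ 624))\<^sup>2 / E (z ^ 312)) =
    2 * qform 2 1 5 (z ^ 8) - 2 * qform 1 1 10 (z ^ 16)"
  using weights_odd[of 1 39]
  unfolding z16 qform_2_1_5_eq_lattice_sum_1_39 qform_1_1_10_eq_lattice_sum_1_39
    lattice_sum_scale[OF z zero_less_one zero_less_numeral]
  by (simp only: lattice_sum_linear lattice_sum_weights simp_thms) simp

lemma theta_alt_3: 
  "(E (z ^ 12))\<^sup>2 / E (z ^ 24) * ((E (z ^ 52))\<^sup>2 / E (z ^ 104)) =
    2 * qform 2 1 5 (z ^ 8) - qform 3 3 4 (z ^ 4)"
  using weights_half_sign[of 3 13]
  unfolding qform_2_1_5_eq_lattice_sum_3_13 qform_3_3_4_eq_lattice_sum_3_13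
  by (simp only: lattice_sum_linear lattice_sum_weights simp_thms) simp

lemma theta_odd_3: 
  "4 * z ^ 16 * (E (z ^ 48))\<^sup>2 / E (z ^ 24) * ((E (z ^ 208))\<^sup>2 / E (z ^ 104)) =
    2 * qform 2 1 5 (z ^ 8) - 2 * qform 3 3 4 (z ^ 16)"
  using weights_odd[of 3 13]
  unfolding z16 qform_2_1_5_eq_lattice_sum_3_13 qform_3_3_4_eq_lattice_sum_3_13
    lattice_sum_scale[OF z zero_less_numeral zero_less_numeral]
  by (simp only: lattice_sum_linear lattice_sum_weights simp_thms) simp

end

subsection \<open>The Rogers-Ramanujan combinations as theta series\<close>

text \<open>Carries identities stated at powers of z over to an arbitrary argument. The choice of
  the root is immaterial, since the results mention only that argument.\<close>

lemma complex_root_exists: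
  assumes "n > 0"
  obtains y :: complex where "y ^ n = x"
proof (cases "x = 0")
  case True
  then show ?thesis using assms by (intro that[of 0]) simp
next
  case False
  have "exp (Ln x / of_nat n) ^ n = x"
    using False assms by (simp add: exp_of_nat_mult[symmetric])
  then show ?thesis by (rule that)
qed

lemma norm_less_1_if_power:
  assumes "norm ((y :: complex) ^ n) < 1"
  shows "norm y < 1"
  using assms unfolding norm_power by (meson linorder_not_less one_le_power)

text \<open>The exponent is an integer only for odd \<open>b\<close> (and odd \<open>t\<close>).\<close>

definition rr_term :: "int \<Rightarrow> complex \<Rightarrow> int \<times> int \<Rightarrow> complex" where
  "rr_term t x = (\<lambda>(b, k). (-1) powi k * x powi ((2 * b\<^sup>2 + t\<^sup>2 * b * k + 5 * t * k\<^sup>2) div 2))"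

context
  fixes x :: complex
  assumes x: "norm x < 1" "x \<noteq> 0"
begin

lemma rr_term_summable_1: "(\<lambda>p. norm (rr_term 1 x p)) summable_on {(b, k). odd b}"
proof -
  \<comment> \<open>The order is 16 = 8 * 2: the 8 completes the square, and the 2 clears the halved
    exponent of \<open>rr_term\<close>.\<close>
  obtain y where y: "y ^ 16 = x" using complex_root_exists[of 16 x] by auto
  have y1: "norm y < 1" "y \<noteq> 0" using x norm_less_1_if_power[of y 16] y by auto
  have inj: "inj_on (\<lambda>(b :: int, k :: int). (4 * b + k, k)) {(b, k). odd b}"
    by (auto simp: inj_on_def)
  have "(\<lambda>(u, v). norm (y powi (int 1 * u\<^sup>2 + int 39 * v\<^sup>2))) summable_on (\<lambda>(b, k). (4 * b + k, k))
    ` {(b, k). odd b}"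
    by (rule summable_on_subset_banach[OF lattice_sum_abs_summable[OF y1]]) auto
  then have summ: "((\<lambda>(u, v). norm (y powi (int 1 * u\<^sup>2 + int 39 * v\<^sup>2))) \<circ> (\<lambda>(b, k). (4 * b + k,
    k))) summable_on {(b, k). odd b}"
    by (rule summable_on_reindex[OF inj, THEN iffD1])
  have eq: "((\<lambda>(u, v). norm (y powi (int 1 * u\<^sup>2 + int 39 * v\<^sup>2))) \<circ> (\<lambda>(b, k). (4 * b + k, k))) p =
    norm (rr_term 1 x p)"
    if p_in: "p \<in> {(b, k). odd b}" for p
  proof -
    obtain b k where p: "p = (b, k)" and b: "odd b" using p_in by (cases p) auto
    have "even (2 * b\<^sup>2 + 1\<^sup>2 * b * k + 5 * 1 * k\<^sup>2)" using b by auto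
    then obtain e where e: "2 * b\<^sup>2 + 1\<^sup>2 * b * k + 5 * 1 * k\<^sup>2 = 2 * e" by blast
    have "int 1 * (4 * b + k)\<^sup>2 + int 39 * k\<^sup>2 = 8 * (2 * b\<^sup>2 + 1\<^sup>2 * b * k + 5 * 1 * k\<^sup>2)"
      by (simp add: power2_eq_square algebra_simps)
    then have "int 1 * (4 * b + k)\<^sup>2 + int 39 * k\<^sup>2 = int 16 * e" unfolding e by simp
    moreover have "(2 * b\<^sup>2 + 1\<^sup>2 * b * k + 5 * 1 * k\<^sup>2) div 2 = e" unfolding e by simp
    ultimately show ?thesis
      unfolding p rr_term_def comp_def prod.case y[symmetric] power_int_power
      by (simp only:) (simp add: norm_mult norm_power_int)
  qed
  show ?thesis by (rule summable_on_cong[OF eq, THEN iffD1, OF _ summ])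
qed

text \<open>The forms 2b^2 + bk + 5k^2 and 2b^2 + 9bk + 15k^2 are equivalent under b -> b - 2k,
  which respects the parity of b. This equivalence is why the combinations for U(1,39) and U(3,13)
  agree.\<close>

lemma rr_term_3_eq_1: "rr_term 3 x (b - 2 * k, k) = rr_term 1 x (b, k)"
  by (simp add: rr_term_def power2_eq_square algebra_simps)

lemma rr_term_1_eq_3: "rr_term 1 x (b + 2 * k, k) = rr_term 3 x (b, k)"
  using rr_term_3_eq_1[of "b + 2 * k" k] by simp

lemma rr_term_summable:
  assumes "t = 1 \<or> t = 3" and that: "A \<subseteq> {(b, k). odd b}"
  shows "rr_term t x summable_on A"
proof -
  have "rr_term 1 x summable_on {(b, k). odd b}"
    by (rule abs_summable_summable[OF rr_term_summable_1])
  moreover from this have "rr_term 3 x summable_on {(b, k). odd b}"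
    by (subst summable_on_reindex_bij_witness[of _ "\<lambda>(b, k). (b - 2 * k, k)" "\<lambda>(b, k). (b + 2 * k,
      k)" "{(b, k). odd b}" "rr_term 1 x"])
      (auto simp: rr_term_1_eq_3)
  ultimately show ?thesis
    using assms summable_on_subset_banach[OF _ that] by auto
qed

lemma rr_term_infsum_3: "infsum (rr_term 3 x) {(b, k). odd b} =
  infsum (rr_term 1 x) {(b, k). odd b}"
  by (rule infsum_reindex_bij_witness[of _ "\<lambda>(b, k). (b - 2 * k, k)" "\<lambda>(b, k). (b + 2 * k, k)"])
    (auto simp: rr_term_1_eq_3)

text \<open>Residues of odd b modulo 10. For b = 5c the substitution k -> -k - t c fixes the
  exponent and flips the sign, as t and c are odd, so the class 5 cancels. Negating (b, k)
  identifies the classes 9 and 3 with 1 and 7.\<close>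

lemma rr_term_infsum:
  assumes t: "t = 1 \<or> t = 3"
  shows "infsum (rr_term t x) {(b, k). odd b} =
    2 * (infsum (rr_term t x) {(b, k). b mod 10 = 1} + infsum (rr_term t x) {(b, k). b mod 10 = 7})"
proof -
  let ?F = "rr_term t x"
  let ?A = "{(b :: int, k :: int). b mod 10 = 5}"
  let ?B = "{(b :: int, k :: int). b mod 10 = 1}" and ?B' = "{(b :: int, k :: int). b mod 10 = 7}"
  let ?C = "{(b :: int, k :: int). b mod 10 = 9}" and ?C' = "{(b :: int, k :: int). b mod 10 = 3}"
  have odd_iff: "odd b \<longleftrightarrow> b mod 10 = 5 \<or> b mod 10 = 1 \<or> b mod 10 = 7 \<or> b mod 10 = 9 \<or> b mod 10 =
    3" for b :: int
    by presburger
  have sub: "?A \<subseteq> {(b, k). odd b}" "?B \<subseteq> {(b, k). odd b}" "?B' \<subseteq> {(b, k). odd b}"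
    "?C \<subseteq> {(b, k). odd b}" "?C' \<subseteq> {(b, k). odd b}"
    by (auto simp: odd_iff)
  note summ = rr_term_summable[OF t sub(1)] rr_term_summable[OF t sub(2)] rr_term_summable[OF t
    sub(3)]
    rr_term_summable[OF t sub(4)] rr_term_summable[OF t sub(5)]
  have "{(b, k). odd b} = ?A \<union> (?B \<union> (?B' \<union> (?C \<union> ?C')))"
    unfolding odd_iff by auto
  then have split: "infsum ?F {(b, k). odd b} =
    infsum ?F ?A + (infsum ?F ?B + (infsum ?F ?B' + (infsum ?F ?C + infsum ?F ?C')))"
    by (simp only:) (subst infsum_Un_disjoint; (intro summable_on_Un_disjoint summ)?; auto)+
  have "infsum ?F ?A = infsum (\<lambda>p. - ?F p) ?A"
  proof (rule infsum_reindex_bij_witness[of _ "\<lambda>(b, k). (b, - k - t * (b div 5))" "\<lambda>(b, k). (b, -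
    k - t * (b div 5))"])
    fix p assume "p \<in> ?A"
    then obtain b k where p: "p = (b, k)" and b: "b mod 10 = 5" by auto
    define c where "c = b div 5"
    have c: "b = 5 * c" "odd c" using b unfolding c_def by presburger+
    have e: "2 * b\<^sup>2 + t\<^sup>2 * b * (- k - t * c) + 5 * t * (- k - t * c)\<^sup>2 = 2 * b\<^sup>2 + t\<^sup>2 * b * k +
      5 * t * k\<^sup>2"
      unfolding c by (simp add: power2_eq_square algebra_simps)
    have sgn: "(-1 :: complex) powi (- k - t * c) = - ((-1) powi k)"
      using c(2) t by (auto simp: neg_one_powi)
    show "- ?F (case p of (b, k) \<Rightarrow> (b, - k - t * (b div 5))) = ?F p"
      unfolding p rr_term_def prod.case c_def[symmetric] e sgn by simp
  qed auto
  then have A: "infsum ?F ?A = 0"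
    unfolding infsum_uminus by simp
  have refl: "?F (- b, - k) = ?F (b, k)" for b k
    unfolding rr_term_def by (simp add: neg_one_powi)
  have C: "infsum ?F ?C = infsum ?F ?B"
    by (rule infsum_reindex_bij_witness[of _ "\<lambda>(b, k). (- b, - k)" "\<lambda>(b, k). (- b, - k)"])
      (auto simp: refl zmod_zminus1_eq_if)
  have C': "infsum ?F ?C' = infsum ?F ?B'"
    by (rule infsum_reindex_bij_witness[of _ "\<lambda>(b, k). (- b, - k)" "\<lambda>(b, k). (- b, - k)"])
      (auto simp: refl zmod_zminus1_eq_if)
  show ?thesis
    unfolding split A C C' by simp
qed

text \<open>Completing the square in k gives 5t (k + t b/10)^2. On b = 10m + r, choosing k = l n m
  as plus or minus n, minus t m, plus a constant frees this square from m. The double sum then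
  separates into two Rogers-Ramanujan series.\<close>

lemma rr_term_class:
  fixes \<alpha> \<beta> e1 e2 :: nat and f g :: "int \<Rightarrow> int"
  assumes bij: "bij_betw (\<lambda>(n :: int, m). (10 * m + r, l n m)) UNIV {(b, k). b mod 10 = s}"
    and sums: "(\<lambda>n. norm ((-1) powi n * (x ^ \<alpha>) powi f n)) summable_on UNIV"
      "(\<lambda>m. norm ((-1) powi m * (x ^ \<beta>) powi g m)) summable_on UNIV"
    and sign: "\<And>n m. (-1) powi l n m = \<sigma> * (-1 :: complex) powi n * (-1) powi m"
    and form: "\<And>n m. 2 * (10 * m + r)\<^sup>2 + t\<^sup>2 * (10 * m + r) * l n m + 5 * t * (l n m)\<^sup>2 =
      2 * (int e + int \<alpha> * f n + int \<beta> * g m)"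
  shows "infsum (rr_term t x) {(b, k). b mod 10 = s} =
    \<sigma> * x ^ e * ((\<Sum>\<^sub>\<infinity>n. (-1) powi n * (x ^ \<alpha>) powi f n) * (\<Sum>\<^sub>\<infinity>m. (-1) powi m * (x ^ \<beta>) powi g m))"
proof -
  have "infsum (rr_term t x) {(b, k). b mod 10 = s} =
    infsum (\<lambda>p. rr_term t x (case p of (n, m) \<Rightarrow> (10 * m + r, l n m))) UNIV"
    by (rule infsum_reindex_bij_betw[OF bij, symmetric])
  also have "\<dots> = infsum (\<lambda>p. \<sigma> * x ^ e * (case p of (n, m) \<Rightarrow>
      ((-1) powi n * (x ^ \<alpha>) powi f n) * ((-1) powi m * (x ^ \<beta>) powi g m))) UNIV"
  proof (rule infsum_cong)
    fix p :: "int \<times> int"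
    obtain n m where p: "p = (n, m)" by (cases p)
    show "rr_term t x (case p of (n, m) \<Rightarrow> (10 * m + r, l n m)) = \<sigma> * x ^ e * (case p of (n, m) \<Rightarrow>
      ((-1) powi n * (x ^ \<alpha>) powi f n) * ((-1) powi m * (x ^ \<beta>) powi g m))"
      using x(2) unfolding p prod.case rr_term_def form sign
      by (simp add: power_int_add power_int_power mult_ac)
  qed
  also have "\<dots> = \<sigma> * x ^ e * infsum (\<lambda>(n, m).
      ((-1) powi n * (x ^ \<alpha>) powi f n) * ((-1) powi m * (x ^ \<beta>) powi g m)) UNIV"
    by (rule infsum_cmult_right')
  also have "infsum (\<lambda>(n, m). ((-1) powi n * (x ^ \<alpha>) powi f n) * ((-1) powi m * (x ^ \<beta>) powi g m))
    UNIV =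
    (\<Sum>\<^sub>\<infinity>n. (-1) powi n * (x ^ \<alpha>) powi f n) * (\<Sum>\<^sub>\<infinity>m. (-1) powi m * (x ^ \<beta>) powi g m)"
    by (rule infsum_times[OF sums])
  finally show ?thesis .
qed

lemma rr_summable:
  assumes "a > 0"
  shows "(\<lambda>n. norm ((-1) powi n * (x ^ a) powi (n * (5 * n + 1) div 2))) summable_on UNIV"
    "(\<lambda>n. norm ((-1) powi n * (x ^ a) powi (n * (5 * n - 3) div 2))) summable_on UNIV"
proof -
  have xa: "norm (x ^ a) < 1" "x ^ a \<noteq> 0" using x assms norm_power_less_1 by auto
  show "(\<lambda>n. norm ((-1) powi n * (x ^ a) powi (n * (5 * n + 1) div 2))) summable_on UNIV"
    using abs_summable_quadratic[OF xa, of 5 "\<lambda>n. n * (5 * n + 1) div 2" 3] rr_exponent_1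
    by (simp add: norm_mult norm_power_int)
  show "(\<lambda>n. norm ((-1) powi n * (x ^ a) powi (n * (5 * n - 3) div 2))) summable_on UNIV"
    using abs_summable_quadratic[OF xa, of 5 "\<lambda>n. n * (5 * n - 3) div 2" 1] rr_exponent_2
    by (simp add: norm_mult norm_power_int)
qed

lemma rr_GH:
  assumes "a > 0"
  shows "(\<Sum>\<^sub>\<infinity>n. (-1) powi n * (x ^ a) powi (n * (5 * n + 1) div 2)) = E (x ^ a) * G (x ^ a)"
    "(\<Sum>\<^sub>\<infinity>n. (-1) powi n * (x ^ a) powi (n * (5 * n - 3) div 2)) = E (x ^ a) * H (x ^ a)"
  using rogers_ramanujan_G[of "x ^ a"] rogers_ramanujan_H[of "x ^ a"] x assms norm_power_less_1
    by auto

lemma bij_mod_10: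
  fixes l :: "int \<Rightarrow> int \<Rightarrow> int"
  assumes "0 \<le> s" "s < 10" "r = s \<or> r = s - 10" and l: "\<And>n m. l n m = c * n + d * m + d'" "c =
    1 \<or> c = - 1"
  shows "bij_betw (\<lambda>(n :: int, m). (10 * m + r, l n m)) UNIV {(b, k). b mod 10 = s}"
proof -
  have r: "(10 * m + r) mod 10 = s" for m using assms(1-3) by auto
  have rep: "\<exists>m. b = 10 * m + r" if "b mod 10 = s" for b
  proof -
    have "b = 10 * (b div 10) + s" using that mult_div_mod_eq[of 10 b] by simp
    then show ?thesis
      using assms(3) by (auto intro: exI[of _ "b div 10"] exI[of _ "b div 10 + 1"])
  qed
  have surj: "\<exists>n m. b = 10 * m + r \<and> k = l n m" if bs: "b mod 10 = s" for b k
  proof -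
    obtain m where m: "b = 10 * m + r"
      using rep[OF bs] by blast
    have "k = l (c * (k - d * m - d')) m"
      using l by auto
    with m show ?thesis by blast
  qed
  show ?thesis
    by (rule bij_betw_pairsI) (use r surj l in auto)
qed

lemma double_rr_exponent:
  "2 * (n * (5 * n + 1) div 2) = n * (5 * n + 1 :: int)" "2 * (n * (5 * n - 3) div 2) =
    n * (5 * n - 3 :: int)"
  by (auto simp: dvd_mult_div_cancel)

lemma rr_term_infsum_U_1_39:
  "infsum (rr_term 1 x) {(b, k). odd b} = 2 * (x * (E x * E (x ^ 39) * U 1 39 x))"
proof -
  have 1: "infsum (rr_term 1 x) {(b, k). b mod 10 = 1} = 1 * x ^ 1 *
      ((\<Sum>\<^sub>\<infinity>n. (-1) powi n * (x ^ 1) powi (n * (5 * n + 1) div 2)) *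
       (\<Sum>\<^sub>\<infinity>m. (-1) powi m * (x ^ 39) powi (m * (5 * m + 1) div 2)))"
  proof (rule rr_term_class[where r = 1 and l = "\<lambda>n m. n - m"])
    show "bij_betw (\<lambda>(n :: int, m). (10 * m + 1, n - m)) UNIV {(b, k). b mod 10 = 1}"
      by (rule bij_mod_10[where c = 1 and d = "- 1" and d' = 0]) auto
    fix n m :: int
    have "2 * (10 * m + 1)\<^sup>2 + 1\<^sup>2 * (10 * m + 1) * (n - m) + 5 * 1 * (n - m)\<^sup>2 =
      2 * (int 1 + int 1 * i + int 39 * j)"
      if "2 * i = n * (5 * n + 1)" "2 * j = m * (5 * m + 1)" for i j
      using that by (simp add: power2_eq_square algebra_simps)
    from this[OF double_rr_exponent(1) double_rr_exponent(1)]
    show "2 * (10 * m + 1)\<^sup>2 + 1\<^sup>2 * (10 * m + 1) * (n - m) + 5 * 1 * (n - m)\<^sup>2 =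
        2 * (int 1 + int 1 * (n * (5 * n + 1) div 2) + int 39 * (m * (5 * m + 1) div 2))" .
  qed (use rr_summable[of 1] rr_summable[of 39] in \<open>auto simp: neg_one_powi\<close>)
  have 2: "infsum (rr_term 1 x) {(b, k). b mod 10 = 7} = 1 * x ^ 9 *
      ((\<Sum>\<^sub>\<infinity>n. (-1) powi n * (x ^ 1) powi (n * (5 * n - 3) div 2)) *
       (\<Sum>\<^sub>\<infinity>m. (-1) powi m * (x ^ 39) powi (m * (5 * m - 3) div 2)))"
  proof (rule rr_term_class[where r = "- 3" and l = "\<lambda>n m. n - m"])
    show "bij_betw (\<lambda>(n :: int, m). (10 * m + - 3, n - m)) UNIV {(b, k). b mod 10 = 7}"
      by (rule bij_mod_10[where c = 1 and d = "- 1" and d' = 0]) auto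
    fix n m :: int
    have "2 * (10 * m + - 3)\<^sup>2 + 1\<^sup>2 * (10 * m + - 3) * (n - m) + 5 * 1 * (n - m)\<^sup>2 =
      2 * (int 9 + int 1 * i + int 39 * j)"
      if "2 * i = n * (5 * n - 3)" "2 * j = m * (5 * m - 3)" for i j
      using that by (simp add: power2_eq_square algebra_simps)
    from this[OF double_rr_exponent(2) double_rr_exponent(2)]
    show "2 * (10 * m + - 3)\<^sup>2 + 1\<^sup>2 * (10 * m + - 3) * (n - m) + 5 * 1 * (n - m)\<^sup>2 =
        2 * (int 9 + int 1 * (n * (5 * n - 3) div 2) + int 39 * (m * (5 * m - 3) div 2))" .
  qed (use rr_summable[of 1] rr_summable[of 39] in \<open>auto simp: neg_one_powi\<close>)
  have U: "U 1 39 x = G x * G (x ^ 39) + x ^ 8 * H x * H (x ^ 39)"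
    by (simp add: U_def)
  show ?thesis
    unfolding U using rr_GH[of 1] rr_GH[of 39] rr_term_infsum[of 1] unfolding 1 2
    by (simp add: algebra_simps eval_nat_numeral)
qed

lemma rr_term_infsum_U_3_13:
  "infsum (rr_term 3 x) {(b, k). odd b} = 2 * (x * (E (x ^ 3) * E (x ^ 13) * U 3 13 x))"
proof -
  have 1: "infsum (rr_term 3 x) {(b, k). b mod 10 = 1} = 1 * x ^ 1 *
      ((\<Sum>\<^sub>\<infinity>n. (-1) powi n * (x ^ 3) powi (n * (5 * n - 3) div 2)) *
       (\<Sum>\<^sub>\<infinity>m. (-1) powi m * (x ^ 13) powi (m * (5 * m + 1) div 2)))"
  proof (rule rr_term_class[where r = 1 and l = "\<lambda>n m. - n - 3 * m"])
    show "bij_betw (\<lambda>(n :: int, m). (10 * m + 1, - n - 3 * m)) UNIV {(b, k). b mod 10 = 1}"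
      by (rule bij_mod_10[where c = "- 1" and d = "- 3" and d' = 0]) auto
    fix n m :: int
    have "2 * (10 * m + 1)\<^sup>2 + 3\<^sup>2 * (10 * m + 1) * (- n - 3 * m) + 5 * 3 * (- n - 3 * m)\<^sup>2 =
      2 * (int 1 + int 3 * i + int 13 * j)"
      if "2 * i = n * (5 * n - 3)" "2 * j = m * (5 * m + 1)" for i j
      using that by (simp add: power2_eq_square algebra_simps)
    from this[OF double_rr_exponent(2) double_rr_exponent(1)]
    show "2 * (10 * m + 1)\<^sup>2 + 3\<^sup>2 * (10 * m + 1) * (- n - 3 * m) + 5 * 3 * (- n - 3 * m)\<^sup>2 =
        2 * (int 1 + int 3 * (n * (5 * n - 3) div 2) + int 13 * (m * (5 * m + 1) div 2))" .
  qed (use rr_summable[of 3] rr_summable[of 13] in \<open>auto simp: neg_one_powi\<close>)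
  have 2: "infsum (rr_term 3 x) {(b, k). b mod 10 = 7} = (- 1) * x ^ 3 *
      ((\<Sum>\<^sub>\<infinity>n. (-1) powi n * (x ^ 3) powi (n * (5 * n + 1) div 2)) *
       (\<Sum>\<^sub>\<infinity>m. (-1) powi m * (x ^ 13) powi (m * (5 * m - 3) div 2)))"
  \<comment> \<open>For b = 10m - 3 the square in k involves k + 3m - 9/10. The shift by 1 makes
    this n + 1/10, which gives the exponent n(5n+1)/2, and it also produces the sign -1.\<close>
  proof (rule rr_term_class[where r = "- 3" and l = "\<lambda>n m. n - 3 * m + 1"])
    show "bij_betw (\<lambda>(n :: int, m). (10 * m + - 3, n - 3 * m + 1)) UNIV {(b, k). b mod 10 = 7}"
      by (rule bij_mod_10[where c = 1 and d = "- 3" and d' = 1]) auto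
    fix n m :: int
    have "2 * (10 * m + - 3)\<^sup>2 + 3\<^sup>2 * (10 * m + - 3) * (n - 3 * m + 1) + 5 * 3 * (n - 3 * m +
      1)\<^sup>2 = 2 * (int 3 + int 3 * i + int 13 * j)"
      if "2 * i = n * (5 * n + 1)" "2 * j = m * (5 * m - 3)" for i j
      using that by (simp add: power2_eq_square algebra_simps)
    from this[OF double_rr_exponent(1) double_rr_exponent(2)]
    show "2 * (10 * m + - 3)\<^sup>2 + 3\<^sup>2 * (10 * m + - 3) * (n - 3 * m + 1) + 5 * 3 * (n - 3 * m +
      1)\<^sup>2 =
        2 * (int 3 + int 3 * (n * (5 * n + 1) div 2) + int 13 * (m * (5 * m - 3) div 2))" .
  qed (use rr_summable[of 3] rr_summable[of 13] in \<open>auto simp: neg_one_powi\<close>)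
  have U: "U 3 13 x = H (x ^ 3) * G (x ^ 13) - x\<^sup>2 * G (x ^ 3) * H (x ^ 13)"
    by (simp add: U_def)
  have "infsum (rr_term 3 x) {(b, k). odd b} =
    2 * (1 * x ^ 1 * ((E (x ^ 3) * H (x ^ 3)) * (E (x ^ 13) * G (x ^ 13))) +
      (- 1) * x ^ 3 * ((E (x ^ 3) * G (x ^ 3)) * (E (x ^ 13) * H (x ^ 13))))"
    using rr_GH[of 3] rr_GH[of 13] rr_term_infsum[of 3] unfolding 1 2 by simp
  then show ?thesis
    unfolding U by (simp add: algebra_simps power2_eq_square power3_eq_cube)
qed

text \<open>Even k leads to u^2 + 39 v^2 and odd k, with negative sign, to 3 u^2 + 13 v^2, in both
  cases on pairs of equal parity that are incongruent modulo 4 (up to the sign of v). The excluded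
  congruent pairs give (2,1,5) on either lattice and cancel.\<close>

lemma rr_term_infsum_qform:
  "infsum (rr_term 1 x) {(b, k). odd b} = qform 1 1 10 x - qform 3 3 4 x"
proof -
  obtain z where zx: "z ^ 4 = x" using complex_root_exists[of 4 x] by auto
  have z: "norm z < 1" "z \<noteq> 0" using x norm_less_1_if_power[of z 4] zx by auto
  let ?F = "rr_term 1 x"
  let ?A = "{(b :: int, k :: int). odd b \<and> even k}" and ?B = "{(b :: int, k :: int). odd b \<and> odd k}"
  have "{(b :: int, k :: int). odd b} = ?A \<union> ?B" by auto
  then have split: "infsum ?F {(b, k). odd b} = infsum ?F ?A + infsum ?F ?B"
    by (simp only:) (rule infsum_Un_disjoint; (rule rr_term_summable)?; auto)
  have neutral: "lattice_sum a b (\<lambda>u v. of_bool (P u v)) z =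
    infsum (\<lambda>(u, v). z powi (int a * u\<^sup>2 + int b * v\<^sup>2)) {(u, v). P u v}"
    for a b P
    unfolding lattice_sum_def by (rule infsum_cong_neutral) auto
  have A: "infsum ?F ?A = lattice_sum 1 39 (\<lambda>u v. of_bool ((u - v) mod 4 = 2)) z"
    unfolding neutral
  proof (rule infsum_reindex_bij_witness[of _ "\<lambda>(u, v). ((u - v) div 2, 2 * v)" "\<lambda>(b, k). (2 * b +
    k div 2, k div 2)"])
    fix p assume "p \<in> {(u :: int, v). (u - v) mod 4 = 2}"
    then obtain u v where p: "p = (u, v)" and uv: "(u - v) mod 4 = 2" by auto
    have "u - v = 2 * ((u - v) div 2)" "odd ((u - v) div 2)" using uv by presburger+
    then show "(case (case p of (u, v) \<Rightarrow> ((u - v) div 2, 2 * v)) of (b, k) \<Rightarrow> (2 * b + k div 2,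
      k div 2)) = p"
      "(case p of (u, v) \<Rightarrow> ((u - v) div 2, 2 * v)) \<in> ?A"
      by (auto simp: p)
  next
    fix p assume "p \<in> ?A"
    then obtain b j where p: "p = (b, 2 * j)" and b: "odd b" by (auto elim: evenE)
    show "(case (case p of (b, k) \<Rightarrow> (2 * b + k div 2, k div 2)) of (u, v) \<Rightarrow> ((u - v) div 2,
      2 * v)) = p"
      by (simp add: p)
    show "(case p of (b, k) \<Rightarrow> (2 * b + k div 2, k div 2)) \<in> {(u, v). (u - v) mod 4 = 2}"
      using b unfolding p by simp presburger
    have e1: "(2 * b\<^sup>2 + 1\<^sup>2 * b * (2 * j) + 5 * 1 * (2 * j)\<^sup>2) div 2 = b\<^sup>2 + b * j + 10 * j\<^sup>2"
      by (rule div2_eqI) (simp add: power2_eq_square algebra_simps)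
    have e2: "int 1 * (2 * b + j)\<^sup>2 + int 39 * j\<^sup>2 = int 4 * (b\<^sup>2 + b * j + 10 * j\<^sup>2)"
      by (simp add: power2_eq_square algebra_simps)
    have e3: "2 * j div 2 = j" by simp
    show "(case (case p of (b, k) \<Rightarrow> (2 * b + k div 2, k div 2)) of (u, v) \<Rightarrow> z powi (int 1 * u\<^sup>2 +
      int 39 * v\<^sup>2)) = ?F p"
      unfolding p rr_term_def prod.case zx[symmetric] power_int_power e1 e3 e2
        by (simp add: neg_one_powi)
  qed
  have B: "infsum ?F ?B = - lattice_sum 3 13 (\<lambda>u v. of_bool ((u + v) mod 4 = 2)) z"
    unfolding neutral infsum_uminus[symmetric]
  proof (rule infsum_reindex_bij_witness[of _ "\<lambda>(u, v). ((u + v) div 2 + (v - u), (u + v) div 2)"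
        "\<lambda>(b, k). (k - (b - k) div 2, k + (b - k) div 2)"])
    fix p assume "p \<in> {(u :: int, v). (u + v) mod 4 = 2}"
    then obtain u v where p: "p = (u, v)" and uv: "(u + v) mod 4 = 2" by auto
    define k where "k = (u + v) div 2"
    have k: "v = 2 * k - u" "odd k" using uv unfolding k_def by presburger+
    have "k + (v - u) = k + 2 * (k - u)" using k by simp
    then show "(case (case p of (u, v) \<Rightarrow> ((u + v) div 2 + (v - u), (u + v) div 2)) of (b, k) \<Rightarrow> (k -
      (b - k) div 2, k + (b - k) div 2)) = p"
      "(case p of (u, v) \<Rightarrow> ((u + v) div 2 + (v - u), (u + v) div 2)) \<in> ?B"
      unfolding p prod.case k_def[symmetric] using k by auto
  next
    fix p assume "p \<in> ?B"
    then obtain b k where p: "p = (b, k)" and bk: "odd b" "odd k" by auto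
    define l where "l = (b - k) div 2"
    have b: "b = k + 2 * l" using bk unfolding l_def by presburger
    show "(case (case p of (b, k) \<Rightarrow> (k - (b - k) div 2, k + (b - k) div 2)) of (u, v) \<Rightarrow>
      ((u + v) div 2 + (v - u), (u + v) div 2)) = p"
      unfolding p prod.case l_def[symmetric] using b by simp
    show "(case p of (b, k) \<Rightarrow> (k - (b - k) div 2, k + (b - k) div 2)) \<in> {(u, v). (u + v) mod 4 = 2}"
      unfolding p prod.case l_def[symmetric] using bk(2) by simp presburger
    have e1: "(2 * b\<^sup>2 + 1\<^sup>2 * b * k + 5 * 1 * k\<^sup>2) div 2 = 4 * k\<^sup>2 + 5 * k * l + 4 * l\<^sup>2"
      unfolding b by (rule div2_eqI) (simp add: power2_eq_square algebra_simps)
    have e2: "int 3 * (k - l)\<^sup>2 + int 13 * (k + l)\<^sup>2 = int 4 * (4 * k\<^sup>2 + 5 * k * l + 4 * l\<^sup>2)"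
      by (simp add: power2_eq_square algebra_simps)
    show "- (case (case p of (b, k) \<Rightarrow> (k - (b - k) div 2, k + (b - k) div 2)) of (u, v) \<Rightarrow> z powi
      (int 3 * u\<^sup>2 + int 13 * v\<^sup>2)) = ?F p"
      using bk(2) unfolding p rr_term_def prod.case l_def[symmetric] zx[symmetric] power_int_power
        e1 e2
      by (simp add: neg_one_powi)
  qed
  have "lattice_sum 3 13 (\<lambda>u v. of_bool ((u + v) mod 4 = 2)) z =
    lattice_sum 3 13 (\<lambda>u v. of_bool ((u - v) mod 4 = 2)) z"
    using lattice_sum_neg(2)[OF z, of 3 13 "\<lambda>u v. of_bool ((u - v) mod 4 = 2)"] by simp
  moreover have w: "of_bool ((u - v) mod 4 = 2) =
    (of_bool (even u = even v) - of_bool (u mod 4 = v mod 4) :: complex)" for u v :: int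
  proof -
    have "(u - v) mod 4 = 2 \<longleftrightarrow> even u = even v \<and> u mod 4 \<noteq> v mod 4" by presburger
    moreover have "even u = even v" if "u mod 4 = v mod 4" using that by presburger
    ultimately show ?thesis by auto
  qed
  ultimately show ?thesis
    unfolding split A B w
    using qform_1_1_10_eq_lattice_sum_1_39[of z] qform_3_3_4_eq_lattice_sum_3_13[of z]
      qform_2_1_5_eq_lattice_sum_1_39[of z] qform_2_1_5_eq_lattice_sum_3_13[of z]
    by (simp add: lattice_sum_diff[OF z] bounded_weight_intros w zx)
qed

theorem U_1_39_eq_qform: "2 * x * (E x * E (x ^ 39) * U 1 39 x) = qform 1 1 10 x - qform 3 3 4 x"
  using rr_term_infsum_qform rr_term_infsum_U_1_39 by (simp add: mult.assoc)

theorem U_3_13_eq_qform: "2 * x * (E (x ^ 3) * E (x ^ 13) * U 3 13 x) =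
  qform 1 1 10 x - qform 3 3 4 x"
  using rr_term_infsum_qform rr_term_infsum_U_3_13 rr_term_infsum_3 by (simp add: mult.assoc)

end

subsection \<open>The modular equation\<close>

definition EP :: "nat \<Rightarrow> complex \<Rightarrow> complex" where
  "EP n x = E (x ^ n) * E (x ^ (39 * n))"

definition ER :: "nat \<Rightarrow> complex \<Rightarrow> complex" where
  "ER n x = E (x ^ (3 * n)) * E (x ^ (13 * n))"

text \<open>The eta expression serves as the definition so that \<open>T4\<close> makes sense at 0
  and is free of roots; \<open>qform_diffs_root\<close> identifies it with the theta
  difference.\<close>

definition T4 :: "complex \<Rightarrow> complex" where
  "T4 x = (EP 2 x)\<^sup>2 * ER 1 x * ER 4 x / (EP 1 x * EP 4 x * ER 2 x) -
    x ^ 3 * ((ER 2 x)\<^sup>2 * EP 4 x / (ER 4 x * EP 2 x))"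

definition T3 :: "complex \<Rightarrow> complex" where
  "T3 x = (EP 2 x)\<^sup>2 * ER 4 x / (EP 4 x * ER 2 x) -
    x ^ 3 * (EP 1 x * EP 4 x * (ER 2 x)\<^sup>2 / (EP 2 x * ER 1 x * ER 4 x))"

lemma EP_power: "EP n (x ^ k) = EP (k * n) x"
  by (simp add: EP_def mult_ac flip: power_mult)

lemma ER_power: "ER n (x ^ k) = ER (k * n) x"
  by (simp add: ER_def mult_ac flip: power_mult)

lemma EP_nonzero: "norm x < 1 \<Longrightarrow> n > 0 \<Longrightarrow> EP n x \<noteq> 0"
  and ER_nonzero: "norm x < 1 \<Longrightarrow> n > 0 \<Longrightarrow> ER n x \<noteq> 0"
  by (simp_all add: EP_def ER_def E_nonzero norm_power_less_1)

lemma E_power_holomorphic: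
  assumes "n > 0"
  shows "(\<lambda>x. E (x ^ n)) holomorphic_on ball 0 1"
proof -
  have "(E \<circ> (\<lambda>x. x ^ n)) holomorphic_on ball 0 1"
    by (rule holomorphic_on_compose_gen[OF _ E_holomorphic])
      (use assms in \<open>auto intro!: holomorphic_intros simp: norm_power_less_1\<close>)
  then show ?thesis by (simp add: o_def)
qed

lemma EP_holomorphic [holomorphic_intros]: "n > 0 \<Longrightarrow> EP n holomorphic_on ball 0 1"
  and ER_holomorphic [holomorphic_intros]: "n > 0 \<Longrightarrow> ER n holomorphic_on ball 0 1"
  unfolding EP_def[abs_def] ER_def[abs_def] by (auto intro!: holomorphic_intros E_power_holomorphic)

lemma EP_0 [simp]: "n > 0 \<Longrightarrow> EP n 0 = 1" and ER_0 [simp]: "n > 0 \<Longrightarrow> ER n 0 = 1"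
  by (simp_all add: EP_def ER_def power_0_left)

lemma eta_AB: "eta_A x * eta_B (x ^ 13) = (EP 2 x)\<^sup>2 * ER 1 x * ER 4 x / (EP 1 x * EP 4 x * ER 2 x)"
  unfolding eta_A_def eta_B_def EP_def ER_def
  by (simp add: power_mult_distrib mult_ac flip: power_mult)

lemma eta_CD: "eta_C x * eta_D (x ^ 13) = (ER 2 x)\<^sup>2 * EP 4 x / (ER 4 x * EP 2 x)"
  unfolding eta_C_def eta_D_def EP_def ER_def
  by (simp add: power_mult_distrib mult_ac flip: power_mult)

lemma eta_CD': "eta_C (x ^ 13) * eta_D x = (EP 2 x)\<^sup>2 * ER 4 x / (EP 4 x * ER 2 x)"
  unfolding eta_C_def eta_D_def EP_def ER_def
  by (simp add: power_mult_distrib mult_ac flip: power_mult)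

lemma eta_AB': "eta_A (x ^ 13) * eta_B x =
  EP 1 x * EP 4 x * (ER 2 x)\<^sup>2 / (EP 2 x * ER 1 x * ER 4 x)"
  unfolding eta_A_def eta_B_def EP_def ER_def
  by (simp add: power_mult_distrib mult_ac flip: power_mult)

lemma T4_eta: "T4 x = eta_A x * eta_B (x ^ 13) - x ^ 3 * eta_C x * eta_D (x ^ 13)"
  unfolding T4_def eta_AB[symmetric] eta_CD[symmetric] by (simp add: mult.assoc)

lemma T3_eta: "T3 x = eta_C (x ^ 13) * eta_D x - x ^ 3 * eta_A (x ^ 13) * eta_B x"
  unfolding T3_def eta_AB'[symmetric] eta_CD'[symmetric] by (simp add: mult.assoc)

lemma T4_T3:
  assumes "norm x < 1"
  shows "T4 x * EP 1 x = T3 x * ER 1 x"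
  using EP_nonzero[OF assms, of 1] EP_nonzero[OF assms, of 2] EP_nonzero[OF assms, of 4]
    ER_nonzero[OF assms, of 1] ER_nonzero[OF assms, of 2] ER_nonzero[OF assms, of 4]
  unfolding T4_def T3_def by (simp add: field_simps)

text \<open>\<open>WU x\<close> is the common value of \<open>E(x) E(x\<^sup>3\<^sup>9) U(1,39,x)\<close> and \<open>E(x\<^sup>3) E(x\<^sup>1\<^sup>3) U(3,13,x)\<close>.\<close>

definition WU :: "complex \<Rightarrow> complex" where
  "WU x = EP 1 x * U 1 39 x"

context
  fixes z :: complex
  assumes z: "norm z < 1" "z \<noteq> 0"
begin

lemma qform_diffs_root:
  "qform 5 3 18 (z ^ 8) - qform 8 1 11 (z ^ 8) = 2 * z ^ 40 * EP 1 (z ^ 24)"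
  "qform 2 1 44 (z ^ 8) - qform 8 1 11 (z ^ 8) = 2 * z ^ 16 * ER 1 (z ^ 24)"
  "qform 1 1 88 (z ^ 4) - qform 9 3 10 (z ^ 4) = 2 * z ^ 4 * T4 (z ^ 12)"
  "qform 4 1 22 (z ^ 4) - qform 10 7 10 (z ^ 4) = 2 * z ^ 16 * T3 (z ^ 12)"
  using qform_5_minus_8[OF z] qform_2_minus_8[OF z] qform_1_minus_9[OF z] qform_4_minus_10[OF z]
  unfolding T4_eta T3_eta EP_def ER_def by (simp_all flip: power_mult)

end

context
  fixes x :: complex
  assumes x: "norm x < 1" "x \<noteq> 0"
begin

text \<open>Unfolding \<open>T4_def\<close> at x^2 would bring in x^2, x^4 and x^8. The duplication
  relations express the same values through P and R at x and x^2 only, since the forms at q on their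
  right-hand side combine into the differences already evaluated.\<close>

lemma T4_square: "2 * T4 (x\<^sup>2) = 2 * ER 1 x - x * EP 1 x +
  x * ((ER 1 x)\<^sup>2 * EP 2 x / (ER 2 x * EP 1 x))"
  and T3_square: "2 * x\<^sup>2 * T3 (x\<^sup>2) = ER 1 x - 2 * x * EP 1 x - (EP 1 x)\<^sup>2 * ER 2 x /
    (EP 2 x * ER 1 x)"
proof -
  obtain z where zx: "z ^ 24 = x" using complex_root_exists[of 24 x] by auto
  have z: "norm z < 1" "z \<noteq> 0" using x norm_less_1_if_power[of z 24] zx by auto
  have z4: "norm (z ^ 4) < 1" "z ^ 4 \<noteq> 0" using z norm_power_less_1 by auto
  \<comment> \<open>With q = z^8 and x = q^3 this is q^2, not an integral power of x. It is common
    to all terms and is cancelled at the end.\<close>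
  define a where "a = z ^ 16"
  have a: "a \<noteq> 0" "z ^ 40 = x * a" "z ^ 64 = x\<^sup>2 * a" "x\<^sup>2 = z ^ 48"
    using z by (simp_all add: a_def flip: zx power_add power_mult)
  have p: "(z ^ 12) ^ k = z ^ (12 * k)" "(z ^ 4) ^ k = z ^ (4 * k)" for k
    by (simp_all flip: power_mult)
  have CD: "eta_C (z ^ 12) * eta_D (z ^ 156) = (ER 1 x)\<^sup>2 * EP 2 x / (ER 2 x * EP 1 x)"
    using eta_CD[of "z ^ 12"] ER_power[of 1 z 24] ER_power[of 2 z 24] EP_power[of 1 z 24]
      EP_power[of 2 z 24]
    unfolding ER_power EP_power p zx by simp
  have CD': "eta_C (z ^ 156) * eta_D (z ^ 12) = (EP 1 x)\<^sup>2 * ER 2 x / (EP 2 x * ER 1 x)"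
    using eta_CD'[of "z ^ 12"] ER_power[of 1 z 24] ER_power[of 2 z 24] EP_power[of 1 z 24]
      EP_power[of 2 z 24]
    unfolding ER_power EP_power p zx by simp
  have cancel: "a * (2 * T) = a * (2 * R - x * P + x * C)"
    if "2 * (2 * a * T) = 2 * (2 * a * R) - 2 * (x * a) * P + 2 * (x * a) * C" for T R P C
    using that by algebra
  have cancel': "a * (2 * x\<^sup>2 * T) = a * (R - 2 * x * P - C)"
    if "2 * (2 * (x\<^sup>2 * a) * T) = 2 * a * R - 2 * (2 * (x * a) * P) - 2 * a * C" for T R P C
    using that by algebra
  have q8: "qform 5 3 18 (z ^ 8) - qform 8 1 11 (z ^ 8) = 2 * (x * a) * EP 1 x"
    "qform 2 1 44 (z ^ 8) - qform 8 1 11 (z ^ 8) = 2 * a * ER 1 x"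
    using qform_diffs_root(1,2)[OF z] unfolding zx a(2) a_def .
  have q16: "qform 1 1 88 (z ^ 16) - qform 9 3 10 (z ^ 16) = 2 * a * T4 (x\<^sup>2)"
    "qform 4 1 22 (z ^ 16) - qform 10 7 10 (z ^ 16) = 2 * (x\<^sup>2 * a) * T3 (x\<^sup>2)"
    using qform_diffs_root(3,4)[OF z4] unfolding a(3)[symmetric] a(4) a_def p by simp_all
  have "2 * (2 * a * T4 (x\<^sup>2)) = 2 * (2 * a * ER 1 x) - 2 * (x * a) * EP 1 x +
      2 * (x * a) * (eta_C (z ^ 12) * eta_D (z ^ 156))"
  proof -
    have "2 * (qform 1 1 88 (z ^ 16) - qform 9 3 10 (z ^ 16)) =
        2 * (qform 2 1 44 (z ^ 8) - qform 8 1 11 (z ^ 8)) - (qform 5 3 18 (z ^ 8) - qform 8 1 11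
          (z ^ 8)) +
        2 * z ^ 40 * (eta_C (z ^ 12) * eta_D (z ^ 156))"
      unfolding qform_1_minus_9_double[OF z] by (simp add: algebra_simps)
    then show ?thesis unfolding q16 q8 a(2) .
  qed
  then have "a * (2 * T4 (x\<^sup>2)) =
    a * (2 * ER 1 x - x * EP 1 x + x * ((ER 1 x)\<^sup>2 * EP 2 x / (ER 2 x * EP 1 x)))"
    unfolding CD by (rule cancel)
  then show "2 * T4 (x\<^sup>2) = 2 * ER 1 x - x * EP 1 x + x * ((ER 1 x)\<^sup>2 * EP 2 x / (ER 2 x * EP 1 x))"
    using a(1) mult_left_cancel by blast
  have "2 * (2 * (x\<^sup>2 * a) * T3 (x\<^sup>2)) = 2 * a * ER 1 x - 2 * (2 * (x * a) * EP 1 x) -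
      2 * a * (eta_C (z ^ 156) * eta_D (z ^ 12))"
  proof -
    have "2 * (qform 4 1 22 (z ^ 16) - qform 10 7 10 (z ^ 16)) =
        (qform 2 1 44 (z ^ 8) - qform 8 1 11 (z ^ 8)) - 2 * (qform 5 3 18 (z ^ 8) - qform 8 1 11
          (z ^ 8)) -
        2 * a * (eta_C (z ^ 156) * eta_D (z ^ 12))"
      unfolding qform_4_minus_10_double[OF z] a_def by (simp add: algebra_simps)
    then show ?thesis unfolding q16 q8 .
  qed
  then have "a * (2 * x\<^sup>2 * T3 (x\<^sup>2)) =
    a * (ER 1 x - 2 * x * EP 1 x - (EP 1 x)\<^sup>2 * ER 2 x / (EP 2 x * ER 1 x))"
    unfolding CD' by (rule cancel')
  then show "2 * x\<^sup>2 * T3 (x\<^sup>2) = ER 1 x - 2 * x * EP 1 x - (EP 1 x)\<^sup>2 * ER 2 x / (EP 2 x * ER 1 x)"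
    using a(1) mult_left_cancel by blast
qed

lemma WU_eq_U_3_13: "WU x = ER 1 x * U 3 13 x"
proof -
  have "2 * x * WU x = 2 * x * (ER 1 x * U 3 13 x)"
    using U_1_39_eq_qform[OF x] U_3_13_eq_qform[OF x] unfolding WU_def EP_def ER_def by simp
  then show ?thesis using x(2) by simp
qed

lemma WU_qform: "2 * x * WU x = qform 1 1 10 x - qform 3 3 4 x"
  using U_1_39_eq_qform[OF x] unfolding WU_def EP_def by simp

text \<open>The series (2,1,5) occurs in the alternating relations for both lattices and drops out
  of their difference.\<close>

lemma WU_alternating: "2 * x * WU x = (ER 1 x)\<^sup>2 / ER 2 x - (EP 1 x)\<^sup>2 / EP 2 x"
proof -
  obtain z where zx: "z ^ 4 = x" using complex_root_exists[of 4 x] by auto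
  have z: "norm z < 1" "z \<noteq> 0" using x norm_less_1_if_power[of z 4] zx by auto
  have "(E (z ^ 4))\<^sup>2 / E (z ^ 8) * ((E (z ^ 156))\<^sup>2 / E (z ^ 312)) = (EP 1 x)\<^sup>2 / EP 2 x"
    "(E (z ^ 12))\<^sup>2 / E (z ^ 24) * ((E (z ^ 52))\<^sup>2 / E (z ^ 104)) = (ER 1 x)\<^sup>2 / ER 2 x"
    unfolding EP_def ER_def zx[symmetric] by (simp_all add: power_mult_distrib flip: power_mult)
  then show ?thesis
    using theta_alt_1[OF z] theta_alt_3[OF z] WU_qform unfolding zx by simp
qed

end

text \<open>The same elimination with the odd theta products. In contrast to
  \<open>WU_alternating\<close> the result has no division by x, so it extends holomorphically to
  the origin.\<close>

lemma WU_square: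
  assumes x: "norm x < 1" "x \<noteq> 0"
  shows "WU (x\<^sup>2) = (ER 2 x)\<^sup>2 / ER 1 x - x ^ 3 * ((EP 2 x)\<^sup>2 / EP 1 x)"
proof -
  obtain z where zx: "z ^ 8 = x" using complex_root_exists[of 8 x] by auto
  have z: "norm z < 1" "z \<noteq> 0" using x norm_less_1_if_power[of z 8] zx by auto
  have p: "z ^ 40 = x ^ 5" "z ^ 16 = x\<^sup>2" by (simp_all flip: zx power_mult)
  have x2: "norm (x\<^sup>2) < 1" "x\<^sup>2 \<noteq> 0" using x norm_power_less_1 by auto
  have "4 * z ^ 40 * (E (z ^ 16))\<^sup>2 / E (z ^ 8) * ((E (z ^ 624))\<^sup>2 / E (z ^ 312)) =
    4 * x ^ 5 * ((EP 2 x)\<^sup>2 / EP 1 x)"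
    "4 * z ^ 16 * (E (z ^ 48))\<^sup>2 / E (z ^ 24) * ((E (z ^ 208))\<^sup>2 / E (z ^ 104)) =
      4 * x\<^sup>2 * ((ER 2 x)\<^sup>2 / ER 1 x)"
    unfolding EP_def ER_def zx[symmetric] by (simp_all add: power_mult_distrib flip: power_mult)
  then have "4 * x\<^sup>2 * ((ER 2 x)\<^sup>2 / ER 1 x) - 4 * x ^ 5 * ((EP 2 x)\<^sup>2 / EP 1 x) =
    2 * (2 * x\<^sup>2 * WU (x\<^sup>2))"
    using theta_odd_1[OF z] theta_odd_3[OF z] unfolding WU_qform[OF x2] p(2) by simp
  moreover have "x ^ 5 = x\<^sup>2 * x ^ 3"
    by (simp flip: power_add)
  moreover have "v * w = v * (a - c * b)" if "4 * v * a - 4 * (v * c) * b = 2 * (2 * v * w)"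
    for v w a b c :: complex
    using that by algebra
  ultimately have "x\<^sup>2 * WU (x\<^sup>2) = x\<^sup>2 * ((ER 2 x)\<^sup>2 / ER 1 x - x ^ 3 * ((EP 2 x)\<^sup>2 / EP 1 x))"
    by metis
  then show ?thesis using x2(2) mult_left_cancel by blast
qed

definition haupt :: "complex \<Rightarrow> complex" where
  "haupt x = x * EP 1 x / ER 1 x"

text \<open>The level-two modular equation of the Hauptmodul of \<open>\<Gamma>\<^sub>0(39)+39\<close>.\<close>

lemma haupt_modular_equation:
  assumes x: "norm x < 1" "x \<noteq> 0"
  defines "s \<equiv> haupt x" and "t \<equiv> haupt (x\<^sup>2)"
  shows "s ^ 3 + t ^ 3 + 2 * s * t * (s + t) = s\<^sup>2 * t\<^sup>2 + s * t"
proof -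
  have x2: "norm (x\<^sup>2) < 1" using x norm_power_less_1 by auto
  define R S where "R = ER 1 x" and "S = ER 2 x"
  note nz = EP_nonzero[OF x(1), of 1] EP_nonzero[OF x(1), of 2]
  have RS: "R \<noteq> 0" "S \<noteq> 0" using ER_nonzero[OF x(1)] by (auto simp: R_def S_def)
  have P1: "EP 1 x = s * R / x" and P2: "EP 2 x = t * S / x\<^sup>2"
    using x(2) RS unfolding s_def t_def haupt_def R_def S_def by (simp_all add: EP_power ER_power)
  have st: "s \<noteq> 0" "t \<noteq> 0" using nz unfolding P1 P2 by auto
  \<comment> \<open>P T4 = R T3 at x^2. Once both duplication formulas are inserted and P is written
    as s R / x, everything apart from s and t is the common factor \<open>R * S\<close>.\<close>
  have "x\<^sup>2 * (2 * T4 (x\<^sup>2) * EP 2 x) = 2 * x\<^sup>2 * T3 (x\<^sup>2) * S"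
    using T4_T3[OF x2] unfolding S_def by (simp add: EP_power ER_power)
  then have "x\<^sup>2 * ((2 * R - x * (s * R / x) + x * (R\<^sup>2 * (t * S / x\<^sup>2) / (S * (s * R / x)))) *
    (t * S / x\<^sup>2)) =
      (R - 2 * x * (s * R / x) - (s * R / x)\<^sup>2 * S / ((t * S / x\<^sup>2) * R)) * S"
    unfolding T4_square[OF x] T3_square[OF x] P1 P2 R_def[symmetric] S_def[symmetric] .
  moreover have "x\<^sup>2 * ((2 * R - x * (s * R / x) + x * (R\<^sup>2 * (t * S / x\<^sup>2) / (S * (s * R / x)))) *
    (t * S / x\<^sup>2)) =
      (R * S) * (t * (2 - s + t / s))"
    using RS st x(2) by (simp add: field_simps power2_eq_square)
  moreover have "(R - 2 * x * (s * R / x) - (s * R / x)\<^sup>2 * S / ((t * S / x\<^sup>2) * R)) * S =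
      (R * S) * (1 - 2 * s - s\<^sup>2 / t)"
    using RS st x(2) by (simp add: field_simps power2_eq_square)
  ultimately have "(R * S) * (t * (2 - s + t / s)) = (R * S) * (1 - 2 * s - s\<^sup>2 / t)"
    by metis
  then have "t * (2 - s + t / s) = 1 - 2 * s - s\<^sup>2 / t"
    using RS by simp
  then show ?thesis
    using st by (simp add: field_simps power2_eq_square power3_eq_cube)
qed

text \<open>Here s and u are distinct roots of the cubic X^3 + (2t - t^2) X^2 + (2t^2 - t) X + t^3.
  By Vieta the third root is t^2 - 2t - s - u, and the product of all three is -t^3, so t^3 = s u (s
  + u + 2t - t^2). Dividing by s t u removes u from the combination that occurs in
  \<open>T4\<close>.\<close>

lemma modular_equation_neighbours:
  fixes s t u :: complex
  assumes nz: "s \<noteq> 0" "t \<noteq> 0" "u \<noteq> 0" and "s \<noteq> u"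
    and st: "s ^ 3 + t ^ 3 + 2 * s * t * (s + t) = s\<^sup>2 * t\<^sup>2 + s * t"
    and tu: "t ^ 3 + u ^ 3 + 2 * t * u * (t + u) = t\<^sup>2 * u\<^sup>2 + t * u"
  shows "t\<^sup>2 / (s * u) - u / t = (s + 2 * t - t\<^sup>2) / t"
proof -
  have "(u - s) * (u\<^sup>2 + u * s + s\<^sup>2 + (2 * t - t\<^sup>2) * (u + s) + 2 * t\<^sup>2 - t) = 0"
    using st tu by algebra
  then have "u\<^sup>2 + u * s + s\<^sup>2 + (2 * t - t\<^sup>2) * (u + s) + 2 * t\<^sup>2 - t = 0"
    using \<open>s \<noteq> u\<close> by simp
  then have "t ^ 3 = s * u * (u + s + 2 * t - t\<^sup>2)"
    using st by algebra
  then have "t\<^sup>2 / (s * u) = (u + s + 2 * t - t\<^sup>2) / t"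
    using nz by (simp add: frac_eq_eq power2_eq_square power3_eq_cube mult_ac)
  then show ?thesis
    by (simp add: add_divide_distrib diff_divide_distrib)
qed

subsection \<open>The product identity\<close>

lemma haupt_nonzero: "norm x < 1 \<Longrightarrow> x \<noteq> 0 \<Longrightarrow> haupt x \<noteq> 0"
  using EP_nonzero[of x 1] ER_nonzero[of x 1] by (simp add: haupt_def)

text \<open>\<open>T4 x\<close> is taken from its definition, with u eliminated as above, and
  T4(x^2) from duplication; likewise W(x) from the alternating relations and W(x^2) from the odd
  ones. After the cancellation of unequal powers of R and S, both sides equal
  \<open>R^2 * S^2 * (s + t)^2 / x^2\<close>.\<close>

lemma T4_WU_doubling:
  assumes x: "norm x < 1" "x \<noteq> 0" and ne: "haupt x \<noteq> haupt (x ^ 4)"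
  shows "(EP 1 x * T4 x) * (EP 2 x * T4 (x\<^sup>2)) = (WU x)\<^sup>2 * (WU (x\<^sup>2))\<^sup>2"
proof -
  have x2: "norm (x\<^sup>2) < 1" "x\<^sup>2 \<noteq> 0" and x4: "norm (x ^ 4) < 1" "x ^ 4 \<noteq> 0" "(x\<^sup>2)\<^sup>2 = x ^ 4"
    using x norm_power_less_1 by (auto simp flip: power_mult)
  define s t u where "s = haupt x" and "t = haupt (x\<^sup>2)" and "u = haupt (x ^ 4)"
  define R S V where "R = ER 1 x" and "S = ER 2 x" and "V = ER 4 x"
  have RSV: "R \<noteq> 0" "S \<noteq> 0" "V \<noteq> 0" using ER_nonzero[OF x(1)] by (auto simp: R_def S_def V_def)
  have P: "EP 1 x = s * R / x" "EP 2 x = t * S / x\<^sup>2" "EP 4 x = u * V / x ^ 4"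
    using x(2) RSV unfolding s_def t_def u_def haupt_def R_def S_def V_def
      by (simp_all add: EP_power ER_power)
  have nz: "s \<noteq> 0" "t \<noteq> 0" "u \<noteq> 0"
    using haupt_nonzero x x2 x4 by (auto simp: s_def t_def u_def)
  have st: "s ^ 3 + t ^ 3 + 2 * s * t * (s + t) = s\<^sup>2 * t\<^sup>2 + s * t"
    unfolding s_def t_def by (rule haupt_modular_equation[OF x])
  have tu: "t ^ 3 + u ^ 3 + 2 * t * u * (t + u) = t\<^sup>2 * u\<^sup>2 + t * u"
    using haupt_modular_equation[OF x2] unfolding t_def u_def x4(3) .
  have WUx: "2 * x * WU x = R\<^sup>2 / S * (1 - s\<^sup>2 / t)"
    unfolding WU_alternating[OF x] P R_def[symmetric] S_def[symmetric]
    using RSV nz x(2) by (simp add: field_simps power2_eq_square)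
  have "T4 x = (t * S / x\<^sup>2)\<^sup>2 * R * V / ((s * R / x) * (u * V / x ^ 4) * S) -
      x ^ 3 * (S\<^sup>2 * (u * V / x ^ 4) / (V * (t * S / x\<^sup>2)))"
    unfolding T4_def P R_def[symmetric] S_def[symmetric] V_def[symmetric] ..
  also have "\<dots> = x * S * (t\<^sup>2 / (s * u) - u / t)"
    using RSV nz x(2) by (simp add: field_simps power2_eq_square power3_eq_cube power4_eq_xxxx)
  also have "\<dots> = x * S * ((s + 2 * t - t\<^sup>2) / t)"
    using modular_equation_neighbours[OF nz _ st tu] ne unfolding s_def u_def by simp
  finally have "EP 1 x * T4 x = s * R * S * (s + 2 * t - t\<^sup>2) / t"
    unfolding P using x(2) by simp
  moreover have "2 * T4 (x\<^sup>2) = R * (2 - s + t / s)"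
    unfolding T4_square[OF x] P R_def[symmetric] S_def[symmetric]
    using RSV nz x(2) by (simp add: field_simps power2_eq_square)
  then have "T4 (x\<^sup>2) = R * (2 - s + t / s) / 2"
    by (simp add: nonzero_eq_divide_eq mult.commute)
  then have "EP 2 x * T4 (x\<^sup>2) = (t * S / x\<^sup>2) * (R * (2 - s + t / s) / 2)"
    unfolding P by (simp only:)
  moreover have "WU x = R\<^sup>2 / S * (1 - s\<^sup>2 / t) / (2 * x)"
    unfolding WUx[symmetric] using x(2) by simp
  moreover have "WU (x\<^sup>2) = S\<^sup>2 / R * (1 - t\<^sup>2 / s)"
    unfolding WU_square[OF x] P R_def[symmetric] S_def[symmetric]
    using RSV nz x(2) by (simp add: field_simps power2_eq_square power3_eq_cube)
  moreover have "(s * R * S * (s + 2 * t - t\<^sup>2) / t) * ((t * S / x\<^sup>2) * (R * (2 - s + t / s) / 2)) =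
      R\<^sup>2 * S\<^sup>2 / x\<^sup>2 * (s + t)\<^sup>2"
  proof -
    \<comment> \<open>Expanding the product and subtracting 2 (s + t)^2 leaves exactly the modular
      equation.\<close>
    have "(s + 2 * t - t\<^sup>2) * (2 * s - s\<^sup>2 + t) = 2 * (s + t)\<^sup>2"
      using st by algebra
    moreover have "(s * R * S * (s + 2 * t - t\<^sup>2) / t) * ((t * S / x\<^sup>2) * (R * (2 - s + t / s) /
      2)) =
        R\<^sup>2 * S\<^sup>2 / (2 * x\<^sup>2) * ((s + 2 * t - t\<^sup>2) * (2 * s - s\<^sup>2 + t))"
      using nz x(2) by (simp add: field_simps power2_eq_square)
    ultimately show ?thesis by simp
  qed
  moreover have "(R\<^sup>2 / S * (1 - s\<^sup>2 / t) / (2 * x))\<^sup>2 * (S\<^sup>2 / R * (1 - t\<^sup>2 / s))\<^sup>2 =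
      R\<^sup>2 * S\<^sup>2 / x\<^sup>2 * (s + t)\<^sup>2"
  proof -
    have "(t - s\<^sup>2) * (s - t\<^sup>2) = 2 * s * t * (s + t)"
      using st by algebra
    moreover have "(R\<^sup>2 / S * (1 - s\<^sup>2 / t) / (2 * x)) * (S\<^sup>2 / R * (1 - t\<^sup>2 / s)) =
        R * S / (2 * x * s * t) * ((t - s\<^sup>2) * (s - t\<^sup>2))"
      using nz x(2) RSV by (simp add: field_simps power2_eq_square)
    ultimately have "(R\<^sup>2 / S * (1 - s\<^sup>2 / t) / (2 * x)) * (S\<^sup>2 / R * (1 - t\<^sup>2 / s)) =
      R * S / x * (s + t)"
      using nz x(2) by simp
    then have "((R\<^sup>2 / S * (1 - s\<^sup>2 / t) / (2 * x)) * (S\<^sup>2 / R * (1 - t\<^sup>2 / s)))\<^sup>2 =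
      (R * S / x * (s + t))\<^sup>2"
      by simp
    then show ?thesis by (simp only: power_mult_distrib power_divide)
  qed
  ultimately show ?thesis by (simp only:)
qed

text \<open>Everything is evaluated at \<open>x\<^sup>2\<close>, so that the functions are visibly holomorphic at the
  origin.\<close>

theorem EP_T4_eq_WU_square:
  assumes "norm x < 1" "x \<noteq> 0"
  shows "EP 1 x * T4 x = (WU x)\<^sup>2"
proof -
  define W where "W = (\<lambda>x. (ER 2 x)\<^sup>2 / ER 1 x - x ^ 3 * ((EP 2 x)\<^sup>2 / EP 1 x))"
  define T where "T = (\<lambda>x. (EP 4 x)\<^sup>2 * ER 2 x * ER 8 x / (EP 2 x * EP 8 x * ER 4 x) -
    x ^ 6 * ((ER 4 x)\<^sup>2 * EP 8 x / (ER 8 x * EP 4 x)))"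
  \<comment> \<open>\<open>D x\<close> is the cleared-denominator form of s(x^2) - s(x^8), up to the
    factor x^2. It equals 1 at 0, so the two values are distinct for small nonzero x.\<close>
  define D where "D = (\<lambda>x. EP 2 x * ER 8 x - x ^ 6 * EP 8 x * ER 2 x)"
  have W: "WU (x\<^sup>2) = W x" if "norm x < 1" "x \<noteq> 0" for x
    using WU_square[OF that] by (simp add: W_def)
  have T: "T4 (x\<^sup>2) = T x" for x
    by (simp add: T4_def T_def EP_power ER_power flip: power_mult)
  have D: "haupt (x\<^sup>2) \<noteq> haupt ((x\<^sup>2) ^ 4)" if "norm x < 1" "x \<noteq> 0" "D x \<noteq> 0" for x
  proof
    assume eq: "haupt (x\<^sup>2) = haupt ((x\<^sup>2) ^ 4)"
    have "x\<^sup>2 * EP 2 x / ER 2 x = x ^ 8 * EP 8 x / ER 8 x"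
      using eq unfolding haupt_def by (simp add: EP_power ER_power flip: power_mult)
    then have "x\<^sup>2 * D x = 0"
      using ER_nonzero[OF that(1), of 2] ER_nonzero[OF that(1), of 8]
      by (simp add: D_def field_simps flip: power_add)
    then show False using that by simp
  qed
  have hol: "W holomorphic_on ball 0 1" "T holomorphic_on ball 0 1" "D holomorphic_on ball 0 1"
    unfolding W_def T_def D_def by (auto intro!: holomorphic_intros simp: EP_nonzero ER_nonzero)
  have at_0: "W 0 = 1" "T 0 = 1" "D 0 = 1"
    by (simp_all add: W_def T_def D_def)
  note cont = hol[THEN holomorphic_on_imp_continuous_on, unfolded continuous_on_eq_continuous_at[OF
    open_ball]]
  have "isCont W 0" "isCont T 0" "isCont D 0" "isCont (EP 2) 0"
    using cont holomorphic_on_imp_continuous_on[OF EP_holomorphic[of 2]]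
    by (auto simp: continuous_on_eq_continuous_at)
  define Y where "Y = (\<lambda>x. EP 2 x * T x / (W x)\<^sup>2)"
  have Y0: "isCont Y 0" "Y 0 = 1"
    unfolding Y_def using \<open>isCont W 0\<close> \<open>isCont T 0\<close> \<open>isCont (EP 2) 0\<close> at_0
    by (auto intro!: continuous_intros)
  have ev: "eventually (\<lambda>x. f x \<noteq> 0) (nhds 0)" if "isCont f 0" "f 0 =
    1" for f :: "complex \<Rightarrow> complex"
  proof -
    have "(f \<longlongrightarrow> f 0) (nhds 0)"
      using that(1) unfolding isCont_def tendsto_at_iff_tendsto_nhds .
    then show ?thesis by (rule tendsto_imp_eventually_ne) (use that(2) in simp)
  qed
  have "eventually (\<lambda>x. W x \<noteq> 0) (nhds 0)" "eventually (\<lambda>x. D x \<noteq> 0) (nhds 0)"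
    using ev \<open>isCont W 0\<close> \<open>isCont D 0\<close> at_0 by auto
  then have "eventually (\<lambda>x. W x \<noteq> 0 \<and> D x \<noteq> 0) (nhds 0)"
    by eventually_elim auto
  then obtain r where r: "r > 0" "\<And>x. norm x < r \<Longrightarrow> W x \<noteq> 0 \<and> D x \<noteq> 0"
    unfolding eventually_nhds_metric by (auto simp: dist_norm)
  define d where "d = min r 1"
  have d: "0 < d" "d \<le> 1" "\<And>x. norm x < d \<Longrightarrow> W x \<noteq> 0" "\<And>x. norm x < d \<Longrightarrow> D x \<noteq> 0"
    using r by (auto simp: d_def)
  have small: "norm (x ^ n) < d" if "norm x < d" "n > 0" for x :: complex and n
  proof -
    have "norm x ^ n \<le> norm x ^ 1"
      using that d by (intro power_decreasing) auto
    then show ?thesis using that by (simp add: norm_power)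
  qed
  have step: "Y x * Y (x\<^sup>2) = 1" if "norm x < d" "x \<noteq> 0" for x
  proof -
    have x1: "norm x < 1" using that d by simp
    have x2: "norm (x\<^sup>2) < 1" "x\<^sup>2 \<noteq> 0" using x1 that norm_power_less_1 by auto
    have "(EP 1 (x\<^sup>2) * T4 (x\<^sup>2)) * (EP 2 (x\<^sup>2) * T4 ((x\<^sup>2)\<^sup>2)) = (WU (x\<^sup>2))\<^sup>2 * (WU ((x\<^sup>2)\<^sup>2))\<^sup>2"
      using T4_WU_doubling[OF x2 D[OF x1 that(2) d(4)[OF that(1)]]] .
    then have "(EP 2 x * T x) * (EP 2 (x\<^sup>2) * T (x\<^sup>2)) = (W x)\<^sup>2 * (W (x\<^sup>2))\<^sup>2"
      unfolding T W[OF x1 that(2)] W[OF x2] EP_power[of 1] by simp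
    then show ?thesis
      using d(3)[OF that(1)] d(3)[OF small[OF that(1), of 2]] by (simp add: Y_def field_simps)
  qed
  have step4: "Y x = Y (x ^ 4)" if "norm x < d" "x \<noteq> 0" for x
  proof -
    have "Y x * Y (x\<^sup>2) = 1" "Y (x\<^sup>2) * Y ((x\<^sup>2)\<^sup>2) = 1"
      using step[OF that] step[of "x\<^sup>2"] small[OF that(1), of 2] that(2) by auto
    moreover have "a = c" if "a * b = 1" "b * c = 1" for a b c :: complex
      using that by algebra
    ultimately have "Y x = Y ((x\<^sup>2)\<^sup>2)"
      by blast
    then show ?thesis by (simp flip: power_mult)
  qed
  have Y1: "Y x = 1" if "norm x < d" "x \<noteq> 0" for x
  proof -
    have iter: "Y x = Y (x ^ (4 ^ n))" for n
    proof (induction n)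
      case (Suc n)
      have "Y (x ^ (4 ^ n)) = Y ((x ^ (4 ^ n)) ^ 4)"
        using step4[of "x ^ (4 ^ n)"] small[OF that(1), of "4 ^ n"] that(2) by simp
      with Suc show ?case by (simp add: mult.commute flip: power_mult)
    qed simp
    have "(\<lambda>n. x ^ (4 ^ n)) \<longlonglongrightarrow> 0"
    proof (rule filterlim_compose[OF LIMSEQ_power_zero])
      show "norm x < 1" using that d by simp
      show "filterlim (\<lambda>n. 4 ^ n :: nat) sequentially sequentially"
        by (rule filterlim_subseq) (auto simp: strict_mono_def)
    qed
    then have "(\<lambda>n. Y (x ^ (4 ^ n))) \<longlonglongrightarrow> Y 0"
      by (rule isCont_tendsto_compose[OF Y0(1)])
    then show ?thesis
      unfolding iter[symmetric] Y0 by (simp add: LIMSEQ_const_iff)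
  qed
  \<comment> \<open>The identity is continued without the quotient \<open>Y\<close>, since
    \<open>W\<close> is known to be nonzero only near 0.\<close>
  have "EP 2 w * T w - (W w)\<^sup>2 = 0" if "w \<in> ball 0 1" for w
  proof (rule analytic_continuation_open[of "ball 0 d" "ball 0 1" "\<lambda>x. EP 2 x * T x - (W x)\<^sup>2"
    "\<lambda>_. 0"])
    show "(\<lambda>x. EP 2 x * T x - (W x)\<^sup>2) holomorphic_on ball 0 1"
      by (intro holomorphic_intros hol) auto
    fix w :: complex assume w: "w \<in> ball 0 d"
    show "EP 2 w * T w - (W w)\<^sup>2 = 0"
    proof (cases "w = 0")
      case True
      then show ?thesis using at_0 by simp
    next
      case False
      then show ?thesis using Y1[of w] d(3)[of w] w by (simp add: Y_def field_simps)
    qed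
  qed (use d that in \<open>auto simp: subset_ball\<close>)
  note id = this
  \<comment> \<open>The identity holds at squares w^2, and every x is one.\<close>
  obtain w where w: "w\<^sup>2 = x" using complex_root_exists[of 2 x] by auto
  have "norm w < 1" "w \<noteq> 0" using assms norm_less_1_if_power[of w 2] w by auto
  then show ?thesis
    using id[of w] W[of w] T[of w] EP_power[of 1 w 2] unfolding w by simp
qed

text \<open>The passage through roots requires q to be nonzero, so the origin is treated apart. A
  positive definite form vanishes only at (0, 0), and \<open>0 powi e\<close> is 0 for every other
  exponent that occurs.\<close>

lemma qform_at_0:
  assumes "a > 0" "4 * a * c - b\<^sup>2 > 0"
  shows "qform a b c 0 = 1"
proof -
  have zero: "n = 0 \<and> m = 0" if "a * n\<^sup>2 + b * n * m + c * m\<^sup>2 = 0" for n m :: int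
  proof -
    have "4 * a * (a * n\<^sup>2 + b * n * m + c * m\<^sup>2) = (2 * a * n + b * m)\<^sup>2 + (4 * a * c - b\<^sup>2) * m\<^sup>2"
      by (simp add: power2_eq_square algebra_simps)
    then have *: "(2 * a * n + b * m)\<^sup>2 + (4 * a * c - b\<^sup>2) * m\<^sup>2 = 0" using that by simp
    then have "(4 * a * c - b\<^sup>2) * m\<^sup>2 = 0"
      using assms(2) by (smt (verit) mult_nonneg_nonneg zero_le_power2)
    then have "m = 0" using assms(2) by simp
    with * assms(1) show ?thesis by simp
  qed
  have "qform a b c 0 = infsum (\<lambda>(n, m). 0 powi (a * n\<^sup>2 + b * n * m + c * m\<^sup>2)) {(0, 0)}"
    unfolding qform_def
  proof (rule infsum_cong_neutral)
    fix p :: "int \<times> int"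
    assume "p \<in> UNIV - {(0, 0)}"
    then obtain n m where p: "p = (n, m)" "\<not> (n = 0 \<and> m = 0)" by (cases p) auto
    then have "a * n\<^sup>2 + b * n * m + c * m\<^sup>2 \<noteq> 0" using zero by blast
    then show "(case p of (n, m) \<Rightarrow> 0 powi (a * n\<^sup>2 + b * n * m + c * m\<^sup>2)) = (0 :: complex)"
      by (simp add: p)
  qed auto
  then show ?thesis by simp
qed

theorem theorem4p2:
  fixes q Q :: complex
  assumes "norm q < 1"
    and "Q = q ^ 13"
  shows "qform 2 1 44 q - qform 8 1 11 q = 2 * q ^ 2 * E (q ^ 9) * E (Q ^ 3) \<and>
    qform 5 3 18 q - qform 8 1 11 q = 2 * q ^ 5 * E (q ^ 3) * E (Q ^ 9) \<and>
    qform 4 1 22 q - qform 10 7 10 q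
      = 2 * q ^ 4 * E (q ^ 9) * E (Q ^ 3) * (U 3 13 (q ^ 3)) ^ 2 \<and>
    qform 1 1 88 q - qform 9 3 10 q
      = 2 * q * E (q ^ 3) * E (Q ^ 9) * (U 1 39 (q ^ 3)) ^ 2 \<and>
    (qform 1 1 88 q - qform 9 3 10 q \<noteq> 0 \<longrightarrow>
      (qform 4 1 22 q - qform 10 7 10 q) / (qform 1 1 88 q - qform 9 3 10 q)
        = (qform 5 3 18 q - qform 8 1 11 q) / (qform 2 1 44 q - qform 8 1 11 q)) \<and>
    (q \<noteq> 0 \<longrightarrow>
      (qform 5 3 18 q - qform 8 1 11 q) / (qform 2 1 44 q - qform 8 1 11 q)
        = q ^ 3 * ((E (q ^ 3) * E (Q ^ 9)) / (E (q ^ 9) * E (Q ^ 3))))"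
proof (cases "q = 0")
  case True
  \<comment> \<open>At q = 0 every difference is 1 - 1 = 0, and the two quotient identities hold
    vacuously.\<close>
  have "qform 2 1 44 0 = 1" "qform 8 1 11 0 = 1" "qform 5 3 18 0 = 1" "qform 4 1 22 0 = 1"
    "qform 10 7 10 0 = 1" "qform 1 1 88 0 = 1" "qform 9 3 10 0 = 1"
    by (rule qform_at_0; simp)+
  then show ?thesis unfolding True by simp
next
  case False
  define x where "x = q ^ 3"
  have x: "norm x < 1" "x \<noteq> 0"
    using assms(1) False norm_power_less_1 by (auto simp: x_def)
  define P R where "P = EP 1 x" and "R = ER 1 x"
  have nz: "P \<noteq> 0" "R \<noteq> 0"
    using EP_nonzero[OF x(1)] ER_nonzero[OF x(1)] by (auto simp: P_def R_def)
  have PR: "E (q ^ 3) * E (Q ^ 9) = P" "E (q ^ 9) * E (Q ^ 3) = R"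
    unfolding P_def R_def EP_def ER_def x_def assms(2) by (simp_all flip: power_mult)
  \<comment> \<open>One root serves both kinds of identity: those diagonalized with multiplier 8 are
    read at z, those with multiplier 4 at z^2.\<close>
  obtain z where zq: "z ^ 8 = q" using complex_root_exists[of 8 q] by auto
  have z: "norm z < 1" "z \<noteq> 0" using assms(1) False norm_less_1_if_power[of z 8] zq by auto
  have z2: "norm (z\<^sup>2) < 1" "z\<^sup>2 \<noteq> 0" using z norm_power_less_1 by auto
  have p: "(z\<^sup>2) ^ 4 = q" "(z\<^sup>2) ^ 12 = x" "(z\<^sup>2) ^ 16 = q ^ 4" "z ^ 24 = x" "z ^ 40 =
    q ^ 5" "z ^ 16 = q\<^sup>2"
    by (simp_all add: x_def flip: zq power_mult)
  have q: "qform 5 3 18 q - qform 8 1 11 q = 2 * q ^ 5 * P"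
    "qform 2 1 44 q - qform 8 1 11 q = 2 * q\<^sup>2 * R"
    "qform 1 1 88 q - qform 9 3 10 q = 2 * q * T4 x"
    "qform 4 1 22 q - qform 10 7 10 q = 2 * q ^ 4 * T3 x"
    using qform_diffs_root(1,2)[OF z] qform_diffs_root(3,4)[OF z2] unfolding zq p P_def R_def
      by simp_all
  have U: "WU x = P * U 1 39 x" "WU x = R * U 3 13 x"
    using WU_eq_U_3_13[OF x] by (simp_all add: WU_def P_def R_def)
  have T: "T4 x * P = T3 x * R" "P * T4 x = (WU x)\<^sup>2"
    using T4_T3[OF x(1)] EP_T4_eq_WU_square[OF x] by (simp_all add: P_def R_def)
  have "P * T4 x = P * (P * (U 1 39 x)\<^sup>2)"
    unfolding T(2) U(1) by (simp add: power2_eq_square mult_ac)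
  then have T4: "T4 x = P * (U 1 39 x)\<^sup>2" using nz by simp
  have "R * T3 x = (WU x)\<^sup>2"
    using T by (simp add: mult.commute)
  then have "R * T3 x = R * (R * (U 3 13 x)\<^sup>2)"
    unfolding U(2) by (simp add: power2_eq_square mult_ac)
  then have T3: "T3 x = R * (U 3 13 x)\<^sup>2" using nz by simp
  have ratio: "2 * q ^ 5 * P / (2 * q\<^sup>2 * R) = q ^ 3 * (P / R)"
    using False nz by (simp add: field_simps flip: power_add)
  have ratio': "2 * q ^ 4 * T3 x / (2 * q * T4 x) = q ^ 3 * (P / R)" if "2 * q * T4 x \<noteq> 0"
  proof -
    have "T3 x / T4 x = P / R"
      using T(1) that nz by (simp add: field_simps)
    moreover have "2 * q ^ 4 * T3 x / (2 * q * T4 x) = q ^ 3 * (T3 x / T4 x)"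
      using False by (simp add: eval_nat_numeral)
    ultimately show ?thesis by simp
  qed
  have Uq: "U 3 13 (q ^ 3) = U 3 13 x" "U 1 39 (q ^ 3) = U 1 39 x"
    by (simp_all add: x_def)
  show ?thesis
    unfolding q ratio mult.assoc[of _ "E _" "E _"] PR Uq
    by (intro conjI impI refl ratio') (simp_all add: T3 T4 mult.assoc)
qed

end
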